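(* Let $Q$ be a manifold and $k\geq1$. Rank-zero exact canonical foliated $k$-presymplectic structures are equivalent to families of $k$ exact differential two-forms on $Q$, in the following sense. (i) If $(S,\omega^1_S,\ldots,\omega^k_S)$, with $S\subset\bigoplus_{\alpha=1}^kT^*Q$, is a rank-zero exact canonical foliated $k$-presymplectic manifold, then there exists a unique family of exact differential two-forms $\omega^1_Q,\ldots,\omega^k_Q$ on $Q$ such that $(\pi|_S)^*\omega^\alpha_Q=\omega^\alpha_S$ for $\alpha=1,\ldots,k$. (ii) Conversely, for every family $\omega^1_Q,\ldots,\omega^k_Q$ of exact differential two-forms on $Q$, there exists a rank-zero exact canonical foliated $k$-presymplectic manifold $(S,\omega^1_S,\ldots,\omega^k_S)$, with $S\subset\bigoplus_{\alpha=1}^kT^*Q$, such that $\omega^\alpha_S=(\pi|_S)^*\omega^\alpha_Q$ for $\alpha=1,\ldots,k$.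
   Context: All manifolds are real, smooth, Hausdorff, connected, second countable and finite-dimensional; all structures are smooth; differential forms are assumed to have constant rank. Let $\bigoplus_{\alpha=1}^kT^*Q$ be the Whitney sum of $k$ copies of $T^*Q$, with projections $\pi^\alpha:\bigoplus_{\alpha=1}^kT^*Q\to T^*Q$ onto the $\alpha$-th component and $\pi:\bigoplus_{\alpha=1}^kT^*Q\to Q$. Its canonical two-forms are $\omega^\alpha=(\pi^\alpha)^*\omega$, $\alpha=1,\ldots,k$, where $\omega$ is the canonical symplectic form of $T^*Q$ (locally $\omega=\mathrm{d}q^i\wedge\mathrm{d}p_i$ in adapted coordinates, summation understood). A canonical foliated $k$-presymplectic manifold is a tuple $(S,\omega^1_S,\ldots,\omega^k_S)$ given by a submanifold $S\subset\bigoplus_{\alpha=1}^kT^*Q$ such that $\pi|_S:S\to Q$ is a fibre bundle, endowed with the two-forms $\omega^\alpha_S=\jmath_S^*\omega^\alpha$, where $\jmath_S:S\to\bigoplus_{\alpha=1}^kT^*Q$ is the inclusion; $(\omega^1_S,\ldots,\omega^k_S)$ is then called a canonical foliated $k$-presymplectic structure. Its rank is the rank (fibre dimension) of the fibration $\pi|_S:S\to Q$; rank zero is understood to mean that the fibre is a single point, so that $\pi|_S:S\to Q$ is a diffeomorphism. It is exact if $\omega^1_S,\ldots,\omega^k_S$ are exact. *)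

theory Defs
  imports "HOL-Analysis.Analysis"
begin

section \<open>Smooth functions on open subsets of R^n\<close>

text \<open>
  R^n is the library's \<^term>\<open>Euclidean_space n\<close>: the functions \<^typ>\<open>nat \<Rightarrow> real\<close> that vanish at
  all indices \<open>\<ge> n\<close>. Dimensions are therefore natural numbers, dimension 0 is included,
  and R^m is literally the subspace of R^n on which the coordinates \<open>\<ge> m\<close> vanish.
\<close>

definition partial :: "nat \<Rightarrow> ((nat \<Rightarrow> real) \<Rightarrow> real) \<Rightarrow> (nat \<Rightarrow> real) \<Rightarrow> real" where
  "partial i f x = deriv (\<lambda>t. f (x(i := t))) (x i)"

text \<open>The set \<open>U\<close> is meant to be open in R^n. The type-class topology on \<^typ>\<open>nat \<Rightarrow> real\<close> is the
  product topology, which induces the usual topology of R^n.\<close>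

fun C_on :: "nat \<Rightarrow> nat \<Rightarrow> (nat \<Rightarrow> real) set \<Rightarrow> ((nat \<Rightarrow> real) \<Rightarrow> real) \<Rightarrow> bool" where
  "C_on 0 n U f \<longleftrightarrow> continuous_on U f"
| "C_on (Suc r) n U f \<longleftrightarrow> continuous_on U f \<and>
     (\<forall>i<n. (\<forall>x\<in>U. (\<lambda>t. f (x(i := t))) differentiable at (x i)) \<and> C_on r n U (partial i f))"

definition smooth_on :: "nat \<Rightarrow> (nat \<Rightarrow> real) set \<Rightarrow> ((nat \<Rightarrow> real) \<Rightarrow> real) \<Rightarrow> bool" where
  "smooth_on n U f \<longleftrightarrow> (\<forall>r. C_on r n U f)"

section \<open>Manifolds\<close>

text \<open>A chart is a pair (domain, coordinate map); values outside the domain are irrelevant.\<close>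

type_synonym 'a chart = "'a set \<times> ('a \<Rightarrow> nat \<Rightarrow> real)"

definition is_chart :: "'a topology \<Rightarrow> nat \<Rightarrow> 'a chart \<Rightarrow> bool" where
  "is_chart X n c \<longleftrightarrow> openin X (fst c) \<and> openin (Euclidean_space n) (snd c ` fst c) \<and>
     homeomorphic_map (subtopology X (fst c)) (subtopology (Euclidean_space n) (snd c ` fst c)) (snd c)"

definition chart_inv :: "'a chart \<Rightarrow> (nat \<Rightarrow> real) \<Rightarrow> 'a" where
  "chart_inv c = inv_into (fst c) (snd c)"

definition smooth_transition :: "nat \<Rightarrow> 'a chart \<Rightarrow> 'a chart \<Rightarrow> bool" where
  "smooth_transition n c d \<longleftrightarrow>
     (\<forall>j<n. smooth_on n (snd c ` (fst c \<inter> fst d)) (\<lambda>x. snd d (chart_inv c x) j))"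

definition compatible :: "nat \<Rightarrow> 'a chart \<Rightarrow> 'a chart \<Rightarrow> bool" where
  "compatible n c d \<longleftrightarrow> smooth_transition n c d \<and> smooth_transition n d c"

record 'a mfd =
  mfd_top :: "'a topology"
  mfd_dim :: nat
  mfd_charts :: "'a chart set"

abbreviation carrier :: "'a mfd \<Rightarrow> 'a set" where
  "carrier M \<equiv> topspace (mfd_top M)"

text \<open>The smooth structure is a maximal atlas: a chart belongs to it iff it is compatible with all its
  members.\<close>

definition smooth_manifold :: "'a mfd \<Rightarrow> bool" where
  "smooth_manifold M \<longleftrightarrow>
     Hausdorff_space (mfd_top M) \<and> second_countable (mfd_top M) \<and>
     (\<Union>c\<in>mfd_charts M. fst c) = carrier M \<and>
     mfd_charts M = {c. is_chart (mfd_top M) (mfd_dim M) c \<and> (\<forall>a\<in>mfd_charts M. compatible (mfd_dim M) c a)}"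

definition connected_manifold :: "'a mfd \<Rightarrow> bool" where
  "connected_manifold M \<longleftrightarrow> smooth_manifold M \<and> connected_space (mfd_top M)"

text \<open>The maximal atlas determined by an atlas \<open>A\<close>.\<close>

definition mfd_generated :: "'a topology \<Rightarrow> nat \<Rightarrow> 'a chart set \<Rightarrow> 'a mfd" where
  "mfd_generated X n A = \<lparr>mfd_top = X, mfd_dim = n,
     mfd_charts = {c. is_chart X n c \<and> (\<forall>a\<in>A. compatible n c a)}\<rparr>"

text \<open>The topology for which the (open) chart domains and their coordinate maps become open and
  homeomorphic, respectively; used for bundles, whose total spaces have no prior topology.\<close>

definition atlas_topology :: "nat \<Rightarrow> 'a chart set \<Rightarrow> 'a topology" where
  "atlas_topology n A = topology (\<lambda>W. W \<subseteq> (\<Union>c\<in>A. fst c) \<and>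
     (\<forall>c\<in>A. openin (Euclidean_space n) (snd c ` (W \<inter> fst c))))"

definition smooth_map :: "'a mfd \<Rightarrow> 'b mfd \<Rightarrow> ('a \<Rightarrow> 'b) \<Rightarrow> bool" where
  "smooth_map M N F \<longleftrightarrow> continuous_map (mfd_top M) (mfd_top N) F \<and>
     (\<forall>c\<in>mfd_charts M. \<forall>d\<in>mfd_charts N. \<forall>j<mfd_dim N.
        smooth_on (mfd_dim M) (snd c ` {p \<in> fst c. F p \<in> fst d}) (\<lambda>x. snd d (F (chart_inv c x)) j))"

definition diffeomorphism :: "'a mfd \<Rightarrow> 'b mfd \<Rightarrow> ('a \<Rightarrow> 'b) \<Rightarrow> bool" where
  "diffeomorphism M N F \<longleftrightarrow> bij_betw F (carrier M) (carrier N) \<and>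
     smooth_map M N F \<and> smooth_map N M (inv_into (carrier M) F)"

definition open_submfd :: "'a mfd \<Rightarrow> 'a set \<Rightarrow> 'a mfd" where
  "open_submfd M U = \<lparr>mfd_top = subtopology (mfd_top M) U, mfd_dim = mfd_dim M,
     mfd_charts = {c \<in> mfd_charts M. fst c \<subseteq> U}\<rparr>"

definition prod_chart :: "nat \<Rightarrow> 'a chart \<Rightarrow> 'b chart \<Rightarrow> ('a \<times> 'b) chart" where
  "prod_chart m c d = (fst c \<times> fst d, \<lambda>(p, q) i. if i < m then snd c p i else snd d q (i - m))"

definition prod_mfd :: "'a mfd \<Rightarrow> 'b mfd \<Rightarrow> ('a \<times> 'b) mfd" where
  "prod_mfd M N = mfd_generated (prod_topology (mfd_top M) (mfd_top N)) (mfd_dim M + mfd_dim N)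
     {prod_chart (mfd_dim M) c d | c d. c \<in> mfd_charts M \<and> d \<in> mfd_charts N}"

text \<open>Embedded submanifolds of dimension \<open>m\<close>, given by slice charts.\<close>

definition slice_charts :: "'a mfd \<Rightarrow> nat \<Rightarrow> 'a set \<Rightarrow> 'a chart set" where
  "slice_charts N m S = {c \<in> mfd_charts N.
     snd c ` (fst c \<inter> S) = {x \<in> snd c ` fst c. \<forall>i\<ge>m. x i = 0}}"

definition embedded_submanifold :: "'a mfd \<Rightarrow> nat \<Rightarrow> 'a set \<Rightarrow> bool" where
  "embedded_submanifold N m S \<longleftrightarrow> m \<le> mfd_dim N \<and> S \<subseteq> carrier N \<and>
     (\<forall>p\<in>S. \<exists>c\<in>slice_charts N m S. p \<in> fst c)"

definition submfd :: "'a mfd \<Rightarrow> nat \<Rightarrow> 'a set \<Rightarrow> 'a mfd" where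
  "submfd N m S = mfd_generated (subtopology (mfd_top N) S) m
     {(fst c \<inter> S, snd c) | c. c \<in> slice_charts N m S}"

definition fibre_bundle :: "'e mfd \<Rightarrow> 'b mfd \<Rightarrow> 'f mfd \<Rightarrow> ('e \<Rightarrow> 'b) \<Rightarrow> bool" where
  "fibre_bundle E B F pr \<longleftrightarrow> smooth_map E B pr \<and> carrier F \<noteq> {} \<and>
     (\<forall>b\<in>carrier B. \<exists>U. openin (mfd_top B) U \<and> b \<in> U \<and>
        (\<exists>\<Phi>. diffeomorphism (open_submfd E {e \<in> carrier E. pr e \<in> U}) (prod_mfd (open_submfd B U) F) \<Phi> \<and>
             (\<forall>e\<in>carrier E. pr e \<in> U \<longrightarrow> fst (\<Phi> e) = pr e)))"

section \<open>Tangent vectors and tangent maps\<close>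

text \<open>A tangent vector at \<open>p\<close> is a family of coordinate vectors, one for each chart around \<open>p\<close>, that
  transforms by the Jacobians of the chart transitions. Entries without meaning are set to 0, so that
  equality of tangent vectors is equality of functions.\<close>

type_synonym 'a tvec = "'a chart \<Rightarrow> nat \<Rightarrow> real"

definition charts_at :: "'a mfd \<Rightarrow> 'a \<Rightarrow> 'a chart set" where
  "charts_at M p = {c \<in> mfd_charts M. p \<in> fst c}"

text \<open>The entry \<open>(j, i)\<close> of the Jacobian matrix at \<open>p\<close> of a map in the charts \<open>c\<close> and \<open>d\<close>.\<close>

definition jacobian :: "('a \<Rightarrow> 'b) \<Rightarrow> 'a chart \<Rightarrow> 'b chart \<Rightarrow> 'a \<Rightarrow> nat \<Rightarrow> nat \<Rightarrow> real" where
  "jacobian F c d p j i = partial i (\<lambda>x. snd d (F (chart_inv c x)) j) (snd c p)"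

definition tangent_space :: "'a mfd \<Rightarrow> 'a \<Rightarrow> 'a tvec set" where
  "tangent_space M p = {v.
     (\<forall>c\<in>charts_at M p. \<forall>d\<in>charts_at M p. \<forall>j<mfd_dim M.
        v d j = (\<Sum>i<mfd_dim M. jacobian (\<lambda>q. q) c d p j i * v c i)) \<and>
     (\<forall>c j. c \<notin> charts_at M p \<or> j \<ge> mfd_dim M \<longrightarrow> v c j = 0)}"

definition coord_vector :: "'a mfd \<Rightarrow> 'a chart \<Rightarrow> 'a \<Rightarrow> nat \<Rightarrow> 'a tvec" where
  "coord_vector M c p i = (\<lambda>d j.
     if d \<in> charts_at M p \<and> j < mfd_dim M then jacobian (\<lambda>q. q) c d p j i else 0)"

definition tangent_map :: "'a mfd \<Rightarrow> 'b mfd \<Rightarrow> ('a \<Rightarrow> 'b) \<Rightarrow> 'a \<Rightarrow> 'a tvec \<Rightarrow> 'b tvec" where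
  "tangent_map M N F p v = (THE w. w \<in> tangent_space N (F p) \<and>
     (\<forall>c\<in>charts_at M p. \<forall>d\<in>charts_at N (F p). \<forall>j<mfd_dim N.
        w d j = (\<Sum>i<mfd_dim M. jacobian F c d p j i * v c i)))"

section \<open>Differential forms\<close>

definition cotangent_space :: "'a mfd \<Rightarrow> 'a \<Rightarrow> ('a tvec \<Rightarrow> real) set" where
  "cotangent_space M p = {\<theta>.
     (\<forall>u\<in>tangent_space M p. \<forall>v\<in>tangent_space M p. \<forall>a b.
        \<theta> (\<lambda>c i. a * u c i + b * v c i) = a * \<theta> u + b * \<theta> v) \<and>
     (\<forall>u. u \<notin> tangent_space M p \<longrightarrow> \<theta> u = 0)}"

type_synonym 'a form1 = "'a \<Rightarrow> 'a tvec \<Rightarrow> real"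
type_synonym 'a form2 = "'a \<Rightarrow> 'a tvec \<Rightarrow> 'a tvec \<Rightarrow> real"

definition coeff1 :: "'a mfd \<Rightarrow> 'a form1 \<Rightarrow> 'a chart \<Rightarrow> nat \<Rightarrow> (nat \<Rightarrow> real) \<Rightarrow> real" where
  "coeff1 M \<theta> c i x = (let p = chart_inv c x in \<theta> p (coord_vector M c p i))"

definition coeff2 :: "'a mfd \<Rightarrow> 'a form2 \<Rightarrow> 'a chart \<Rightarrow> nat \<Rightarrow> nat \<Rightarrow> (nat \<Rightarrow> real) \<Rightarrow> real" where
  "coeff2 M \<omega> c i j x = (let p = chart_inv c x in \<omega> p (coord_vector M c p i) (coord_vector M c p j))"

text \<open>Forms are set to 0 away from the points and tangent vectors of \<open>M\<close>, so that equality of forms is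
  equality of functions.\<close>

definition one_forms :: "'a mfd \<Rightarrow> 'a form1 set" where
  "one_forms M = {\<theta>.
     (\<forall>p\<in>carrier M. \<theta> p \<in> cotangent_space M p) \<and> (\<forall>p. p \<notin> carrier M \<longrightarrow> \<theta> p = (\<lambda>u. 0)) \<and>
     (\<forall>c\<in>mfd_charts M. \<forall>i<mfd_dim M. smooth_on (mfd_dim M) (snd c ` fst c) (coeff1 M \<theta> c i))}"

text \<open>The rank of \<open>\<omega>\<close> at \<open>p\<close> is the dimension of the image of \<open>u \<mapsto> \<omega> p u\<close> in the cotangent space,
  i.e. the largest number of linearly independent covectors of that form.\<close>

definition rank_at :: "'a mfd \<Rightarrow> 'a form2 \<Rightarrow> 'a \<Rightarrow> nat" where
  "rank_at M \<omega> p = Max {r. \<exists>u :: nat \<Rightarrow> 'a tvec. (\<forall>i<r. u i \<in> tangent_space M p) \<and>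
     (\<forall>a :: nat \<Rightarrow> real. (\<forall>v\<in>tangent_space M p. (\<Sum>i<r. a i * \<omega> p (u i) v) = 0) \<longrightarrow> (\<forall>i<r. a i = 0))}"

text \<open>Two-forms have constant rank by convention. The one-forms above are not subject to this, as they
  only serve as primitives.\<close>

definition two_forms :: "'a mfd \<Rightarrow> 'a form2 set" where
  "two_forms M = {\<omega>.
     (\<forall>p\<in>carrier M. \<forall>u\<in>tangent_space M p. \<omega> p u \<in> cotangent_space M p \<and>
        (\<lambda>v. \<omega> p v u) \<in> cotangent_space M p \<and> \<omega> p u u = 0) \<and>
     (\<forall>p u v. p \<notin> carrier M \<or> u \<notin> tangent_space M p \<longrightarrow> \<omega> p u v = 0) \<and>
     (\<forall>c\<in>mfd_charts M. \<forall>i<mfd_dim M. \<forall>j<mfd_dim M.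
        smooth_on (mfd_dim M) (snd c ` fst c) (coeff2 M \<omega> c i j)) \<and>
     (\<exists>r. \<forall>p\<in>carrier M. rank_at M \<omega> p = r)}"

text \<open>In coordinates, \<open>d\<theta> = \<Sum>i j. (\<partial>_i \<theta>_j) dx^i \<and> dx^j\<close> with \<open>(dx^i \<and> dx^j)(u,v) = u^i v^j - u^j v^i\<close>.
  The value does not depend on the chart.\<close>

definition ext_deriv :: "'a mfd \<Rightarrow> 'a form1 \<Rightarrow> 'a form2" where
  "ext_deriv M \<theta> p u v =
     (if p \<in> carrier M \<and> u \<in> tangent_space M p \<and> v \<in> tangent_space M p
      then THE w. \<forall>c\<in>charts_at M p. w =
        (\<Sum>i<mfd_dim M. \<Sum>j<mfd_dim M.
           partial i (coeff1 M \<theta> c j) (snd c p) * (u c i * v c j - u c j * v c i))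
      else 0)"

definition exact_two_forms :: "'a mfd \<Rightarrow> 'a form2 set" where
  "exact_two_forms M = {\<omega> \<in> two_forms M. \<exists>\<theta>\<in>one_forms M. \<omega> = ext_deriv M \<theta>}"

definition pullback :: "'a mfd \<Rightarrow> 'b mfd \<Rightarrow> ('a \<Rightarrow> 'b) \<Rightarrow> 'b form2 \<Rightarrow> 'a form2" where
  "pullback M N F \<omega> p u v =
     (if p \<in> carrier M \<and> u \<in> tangent_space M p \<and> v \<in> tangent_space M p
      then \<omega> (F p) (tangent_map M N F p u) (tangent_map M N F p v) else 0)"

section \<open>The cotangent bundle and its Whitney sums\<close>

text \<open>Adapted coordinates \<open>(q^0, ..., q^{n-1}, p_0, ..., p_{n-1})\<close>.\<close>

definition cotangent_chart :: "'a mfd \<Rightarrow> 'a chart \<Rightarrow> ('a \<times> ('a tvec \<Rightarrow> real)) chart" where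
  "cotangent_chart Q c =
     (let n = mfd_dim Q in
      ({(q, p). q \<in> fst c \<and> p \<in> cotangent_space Q q},
       \<lambda>(q, p) i. if i < n then snd c q i
                  else if i < n + n then p (coord_vector Q c q (i - n)) else 0))"

definition cotangent_bundle :: "'a mfd \<Rightarrow> ('a \<times> ('a tvec \<Rightarrow> real)) mfd" where
  "cotangent_bundle Q =
     (let A = cotangent_chart Q ` mfd_charts Q; m = mfd_dim Q + mfd_dim Q
      in mfd_generated (atlas_topology m A) m A)"

text \<open>\<open>dq^i \<and> dp_i\<close> (summation understood) in any adapted chart.\<close>

definition canonical_symplectic :: "'a mfd \<Rightarrow> ('a \<times> ('a tvec \<Rightarrow> real)) form2" where
  "canonical_symplectic Q z u v =
     (if z \<in> carrier (cotangent_bundle Q) \<and> u \<in> tangent_space (cotangent_bundle Q) z \<and>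
         v \<in> tangent_space (cotangent_bundle Q) z
      then THE w. \<forall>c\<in>charts_at Q (fst z). w =
        (let n = mfd_dim Q; c' = cotangent_chart Q c
         in \<Sum>i<n. u c' i * v c' (n + i) - v c' i * u c' (n + i))
      else 0)"

text \<open>A point of the Whitney sum of \<open>k\<close> copies is a pair \<open>(q, p)\<close> with covectors \<open>p \<alpha>\<close> at \<open>q\<close> for
  \<open>\<alpha> \<in> {1..k}\<close>. Its coordinates are \<open>q^i\<close>, followed by those of \<open>p 1\<close>, ..., \<open>p k\<close>.\<close>

type_synonym 'a wpoint = "'a \<times> (nat \<Rightarrow> 'a tvec \<Rightarrow> real)"

definition whitney_chart :: "'a mfd \<Rightarrow> nat \<Rightarrow> 'a chart \<Rightarrow> 'a wpoint chart" where
  "whitney_chart Q k c =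
     (let n = mfd_dim Q in
      ({(q, p). q \<in> fst c \<and> p \<in> {1..k} \<rightarrow>\<^sub>E cotangent_space Q q},
       \<lambda>(q, p) i. if i < n then snd c q i
                  else if i < n + k * n
                  then p ((i - n) div n + 1) (coord_vector Q c q ((i - n) mod n)) else 0))"

definition whitney_sum :: "'a mfd \<Rightarrow> nat \<Rightarrow> 'a wpoint mfd" where
  "whitney_sum Q k =
     (let A = whitney_chart Q k ` mfd_charts Q; m = mfd_dim Q + k * mfd_dim Q
      in mfd_generated (atlas_topology m A) m A)"

definition whitney_component :: "nat \<Rightarrow> 'a wpoint \<Rightarrow> 'a \<times> ('a tvec \<Rightarrow> real)" where
  "whitney_component \<alpha> = (\<lambda>(q, p). (q, p \<alpha>))"

definition whitney_proj :: "'a wpoint \<Rightarrow> 'a" where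
  "whitney_proj = fst"

definition canonical_two_form :: "'a mfd \<Rightarrow> nat \<Rightarrow> nat \<Rightarrow> 'a wpoint form2" where
  "canonical_two_form Q k \<alpha> =
     pullback (whitney_sum Q k) (cotangent_bundle Q) (whitney_component \<alpha>) (canonical_symplectic Q)"

section \<open>Canonical foliated k-presymplectic manifolds\<close>

text \<open>The smooth manifold carried by a subset \<open>S\<close> that fibres over \<open>Q\<close> with rank \<open>r\<close>.\<close>

definition foliated_mfd :: "'a mfd \<Rightarrow> nat \<Rightarrow> nat \<Rightarrow> 'a wpoint set \<Rightarrow> 'a wpoint mfd" where
  "foliated_mfd Q k r S = submfd (whitney_sum Q k) (mfd_dim Q + r) S"

text \<open>\<open>F\<close> is the typical fibre, so that the rank is \<open>mfd_dim F\<close>. The role of \<open>\<pi>\<close> restricted to \<open>S\<close> is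
  played by \<^term>\<open>whitney_proj\<close> on the manifold \<open>S\<close>, and that of the inclusion by the identity.\<close>

definition canonical_foliated_presymplectic ::
  "'a mfd \<Rightarrow> nat \<Rightarrow> 'f mfd \<Rightarrow> 'a wpoint set \<Rightarrow> (nat \<Rightarrow> 'a wpoint form2) \<Rightarrow> bool" where
  "canonical_foliated_presymplectic Q k F S \<omega> \<longleftrightarrow>
     smooth_manifold F \<and>
     embedded_submanifold (whitney_sum Q k) (mfd_dim Q + mfd_dim F) S \<and>
     connected_manifold (foliated_mfd Q k (mfd_dim F) S) \<and>
     fibre_bundle (foliated_mfd Q k (mfd_dim F) S) Q F whitney_proj \<and>
     (\<forall>\<alpha>\<in>{1..k}. \<omega> \<alpha> \<in> two_forms (foliated_mfd Q k (mfd_dim F) S) \<and>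
        \<omega> \<alpha> = pullback (foliated_mfd Q k (mfd_dim F) S) (whitney_sum Q k) (\<lambda>z. z) (canonical_two_form Q k \<alpha>))"

text \<open>Rank zero means that the fibre is a single point, not merely zero-dimensional. Points of the
  fibre are taken from \<^typ>\<open>'a wpoint\<close>, because the fibres of \<open>S\<close> live there.\<close>

definition rank_zero_exact_cfp ::
  "'a mfd \<Rightarrow> nat \<Rightarrow> 'a wpoint set \<Rightarrow> (nat \<Rightarrow> 'a wpoint form2) \<Rightarrow> bool" where
  "rank_zero_exact_cfp Q k S \<omega> \<longleftrightarrow>
     (\<exists>F :: 'a wpoint mfd. canonical_foliated_presymplectic Q k F S \<omega> \<and>
        mfd_dim F = 0 \<and> (\<exists>z. carrier F = {z})) \<and>
     (\<forall>\<alpha>\<in>{1..k}. \<omega> \<alpha> \<in> exact_two_forms (foliated_mfd Q k 0 S))"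

end

theory Submission
  imports Defs
begin

text \<open>
  A bundle \<open>\<pi> : S \<rightarrow> Q\<close> whose fibre is a point is a diffeomorphism. Forms on \<open>S\<close> and forms on \<open>Q\<close>
  therefore correspond to each other by pullback along \<open>\<pi>\<close> and its inverse, and this correspondence
  preserves smoothness, constancy of the rank and exactness. This settles the passage from \<open>S\<close> to \<open>Q\<close>
  (\<open>point_bundle_diffeomorphism\<close>, \<open>pullback_exact\<close>, \<open>pullback_inverse\<close>, combined in
  \<open>two_forms_of_rank_zero_bundle\<close>).

  Conversely, given exact forms \<open>d\<Theta> 1, ..., d\<Theta> k\<close> on \<open>Q\<close>, let \<open>S\<close> be the image of the section
  \<open>q \<mapsto> (- \<Theta> 1 q, ..., - \<Theta> k q)\<close> of the Whitney sum. Along this section \<open>p = - \<Theta> \<alpha>\<close>, so the form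
  \<open>dq \<and> dp\<close> of the component \<open>\<alpha>\<close> restricts to \<open>d\<Theta> \<alpha>\<close> (\<open>graph_canonical_form\<close>). Translating
  adapted coordinates by the one-forms takes \<open>S\<close> to the zero section, so \<open>S\<close> is an embedded submanifold
  with slice charts (\<open>graph_embedded\<close>), and \<open>\<pi>\<close> restricted to \<open>S\<close> is a diffeomorphism that is
  trivially a bundle with one-point fibre (\<open>rank_zero_bundle_of_two_forms\<close>).

  The groundwork consists of the chain rule and the symmetry of second derivatives on R^n, and of what
  follows from them on manifolds: tangent maps are well defined, and the coordinate expression of the
  exterior derivative is the same in all charts. Diffeomorphisms are handled throughout by \<open>matched\<close>
  charts, i.e. pairs of charts in which the map is the identity. A diffeomorphism matches the members of
  the two maximal atlases, and in matched charts everything that is to be compared has equal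
  coordinates. The smooth structures of the Whitney sum and of the cotangent bundle are constructed
  from their adapted charts.
\<close>

section \<open>Calculus on open subsets of Euclidean space\<close>

definition rspace :: "nat \<Rightarrow> (nat \<Rightarrow> real) set" where
  "rspace n = {x. \<forall>i\<ge>n. x i = 0}"

lemma in_rspace_iff: "x \<in> rspace n \<longleftrightarrow> (\<forall>i\<ge>n. x i = 0)"
  by (simp add: rspace_def)

lemma topspace_Euclidean_rspace: "topspace (Euclidean_space n) = rspace n"
  by (simp add: topspace_Euclidean_space rspace_def)

lemma Euclidean_space_eq_top_of_set: "Euclidean_space n = top_of_set (rspace n)"
  by (simp add: Euclidean_space_def euclidean_product_topology rspace_def)

lemma openin_Euclidean_subset: "openin (Euclidean_space n) U \<Longrightarrow> U \<subseteq> rspace n"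
  using openin_subset topspace_Euclidean_rspace by blast

text \<open>Functions on the natural numbers carry no norm, so neighbourhoods in R^n are described by
  coordinate boxes instead of balls.\<close>

lemma openin_Euclidean_box:
  assumes "openin (Euclidean_space n) U" "x \<in> U"
  obtains e where "e > 0"
    "\<And>y. y \<in> rspace n \<Longrightarrow> (\<And>i. i < n \<Longrightarrow> \<bar>y i - x i\<bar> < e) \<Longrightarrow> y \<in> U"
proof -
  obtain T where T: "openin (powertop_real UNIV) T" "U = T \<inter> rspace n"
    using assms(1) unfolding Euclidean_space_def openin_subtopology rspace_def by auto
  then obtain X where X: "x \<in> PiE UNIV X" "\<And>i. open (X i)" "PiE UNIV X \<subseteq> T"
    using product_topology_open_contains_basis[OF T(1)] assms(2)
    by (metis (no_types, lifting) IntD1 open_openin)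
  have "\<exists>e>0. \<forall>y. \<bar>y - x i\<bar> < e \<longrightarrow> y \<in> X i" for i
    using X(1) X(2)[of i] unfolding open_dist by (auto simp: dist_real_def)
  then obtain ee where ee: "\<And>i. ee i > 0" "\<And>i y. \<bar>y - x i\<bar> < ee i \<Longrightarrow> y \<in> X i"
    by metis
  let ?e = "Min (insert 1 (ee ` {..<n}))"
  show thesis
  proof
    show "?e > 0" using ee(1) by (subst Min_gr_iff) auto
    fix y assume y: "y \<in> rspace n" "\<And>i. i < n \<Longrightarrow> \<bar>y i - x i\<bar> < ?e"
    have "y i \<in> X i" for i
    proof (cases "i < n")
      case True
      then have "?e \<le> ee i" by (intro Min_le) auto
      then show ?thesis using y(2)[OF True] by (intro ee(2)) linarith
    next
      case False
      then have "y i = x i" using y(1) assms(2) T(2) by (auto simp: in_rspace_iff)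
      then show ?thesis using X(1) by auto
    qed
    then show "y \<in> U" using X(3) T(2) y(1) by auto
  qed
qed

lemma eventually_line_in_open:
  assumes "openin (Euclidean_space n) U" "x \<in> U" "i < n"
  shows "\<forall>\<^sub>F t in nhds (x i). x(i := t) \<in> U"
proof -
  obtain e where e: "e > 0"
    "\<And>y. y \<in> rspace n \<Longrightarrow> (\<And>i. i < n \<Longrightarrow> \<bar>y i - x i\<bar> < e) \<Longrightarrow> y \<in> U"
    by (rule openin_Euclidean_box[OF assms(1,2)]) blast
  have "x \<in> rspace n" using assms(1,2) openin_Euclidean_subset by blast
  then have "x(i := t) \<in> U" if "dist t (x i) < e" for t
    using that assms(3) e(1) by (intro e(2)) (auto simp: dist_real_def in_rspace_iff)
  then show ?thesis unfolding eventually_nhds_metric using e(1) by blast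
qed

text \<open>Coordinate lines stay inside an open set near each of its points, so partial derivatives only see
  the values on that set.\<close>

lemma partial_cong:
  fixes f g :: "(nat \<Rightarrow> real) \<Rightarrow> real"
  assumes "openin (Euclidean_space n) U" "x \<in> U" "i < n" "\<And>y. y \<in> U \<Longrightarrow> f y = g y"
  shows "partial i f x = partial i g x"
  unfolding partial_def
  by (intro deriv_cong_ev refl eventually_mono[OF eventually_line_in_open[OF assms(1-3)]])
    (use assms(4) in auto)

lemma line_differentiable_cong:
  fixes f g :: "(nat \<Rightarrow> real) \<Rightarrow> real"
  assumes "openin (Euclidean_space n) U" "x \<in> U" "i < n" "\<And>y. y \<in> U \<Longrightarrow> f y = g y"
    "(\<lambda>t. f (x(i := t))) differentiable at (x i)"
  shows "(\<lambda>t. g (x(i := t))) differentiable at (x i)"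
proof -
  obtain D where "((\<lambda>t. f (x(i := t))) has_real_derivative D) (at (x i))"
    using assms(5) real_differentiable_def by blast
  then have "((\<lambda>t. g (x(i := t))) has_real_derivative D) (at (x i))"
    by (rule DERIV_cong_ev[THEN iffD1, rotated -1])
      (use assms(4) in \<open>auto intro!: eventually_mono[OF eventually_line_in_open[OF assms(1-3)]]\<close>)
  then show ?thesis using real_differentiable_def by blast
qed

lemma C_on_cong:
  assumes "openin (Euclidean_space n) U" "\<And>y. y \<in> U \<Longrightarrow> f y = g y" "C_on r n U f"
  shows "C_on r n U g"
  using assms(2,3)
proof (induction r arbitrary: f g)
  case 0
  then show ?case using continuous_on_cong[of U U f g] by simp
next
  case (Suc r)
  have "continuous_on U g" using Suc.prems continuous_on_cong[of U U f g] by simp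
  moreover have "C_on r n U (partial i g)" if "i < n" for i
    using Suc.IH[of "partial i f" "partial i g"] partial_cong[of n U _ i f g, OF assms(1) _ that Suc.prems(1)]
      Suc.prems(2) that by auto
  ultimately show ?case
    using line_differentiable_cong[of n U _ _ f g, OF assms(1) _ _ Suc.prems(1)] Suc.prems(2) by auto
qed

lemma C_on_SucD: "C_on (Suc r) n U f \<Longrightarrow> C_on r n U f"
  by (induction r arbitrary: f) auto

lemma C_on_continuous: "C_on r n U f \<Longrightarrow> continuous_on U f"
  by (cases r) auto

lemma C_on_subset: "C_on r m V f \<Longrightarrow> U \<subseteq> V \<Longrightarrow> n \<le> m \<Longrightarrow> C_on r n U f"
  by (induction r arbitrary: f) (auto intro: continuous_on_subset)

lemma continuous_on_local:
  fixes f :: "(nat \<Rightarrow> real) \<Rightarrow> real"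
  assumes "U \<subseteq> rspace n"
    and loc: "\<And>x. x \<in> U \<Longrightarrow> \<exists>V. openin (Euclidean_space n) V \<and> x \<in> V \<and> continuous_on V f"
  shows "continuous_on U f"
proof -
  have "continuous (at x within U) f" if "x \<in> U" for x
  proof -
    from loc[OF that]
    obtain V where V: "openin (Euclidean_space n) V" "x \<in> V" "continuous_on V f"
      by auto
    then obtain T where T: "open T" "V = rspace n \<inter> T"
      unfolding Euclidean_space_eq_top_of_set openin_open by auto
    have "continuous_on (U \<inter> T) f"
      by (rule continuous_on_subset[OF V(3)]) (use T(2) assms(1) in auto)
    then have "continuous (at x within (U \<inter> T)) f"
      using that V(2) T(2) by (auto simp: continuous_on_eq_continuous_within)
    moreover have "at x within (U \<inter> T) = at x within U"
      by (rule at_within_nhd[of x T]) (use T V(2) in auto)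
    ultimately show ?thesis by (simp add: continuous_within)
  qed
  then show ?thesis by (simp add: continuous_on_eq_continuous_within)
qed

lemma C_on_local:
  assumes U: "U \<subseteq> rspace n"
    and "\<And>x. x \<in> U \<Longrightarrow> \<exists>V. openin (Euclidean_space n) V \<and> x \<in> V \<and> C_on r n V f"
  shows "C_on r n U f"
  using assms(2)
proof (induction r arbitrary: f)
  case 0
  then show ?case using continuous_on_local[OF U, of f] by simp
next
    case (Suc r)
    have "continuous_on U f" 
    proof (rule continuous_on_local[OF U])
      fix x assume "x \<in> U"
      from Suc.prems[OF this] obtain V where "openin (Euclidean_space n) V" "x \<in> V" "C_on (Suc r) n V f"
        by auto
      then show "\<exists>V. openin (Euclidean_space n) V \<and> x \<in> V \<and> continuous_on V f"
        by auto
    qed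
    moreover have "C_on r n U (partial i f)" if "i < n" for i
    proof (rule Suc.IH)
      fix x assume "x \<in> U"
      from Suc.prems[OF this] obtain V where "openin (Euclidean_space n) V" "x \<in> V" "C_on (Suc r) n V f"
        by auto
      then show "\<exists>V. openin (Euclidean_space n) V \<and> x \<in> V \<and> C_on r n V (partial i f)"
        using that by auto
    qed
    moreover have "(\<lambda>t. f (x(i := t))) differentiable at (x i)" if "x \<in> U" "i < n" for x i
    proof -
      from Suc.prems[OF that(1)]
      obtain V where "openin (Euclidean_space n) V" "x \<in> V" "C_on (Suc r) n V f"
        by auto
      then show ?thesis using that(2) by simp
    qed
    ultimately show ?case by simp
qed

lemma C_on_const: "C_on r n U (\<lambda>x. c)"
proof (induction r arbitrary: c)
  case (Suc r)
  have "partial i (\<lambda>x. c) = (\<lambda>x. 0)" for i by (auto simp: partial_def)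
  then show ?case using Suc by simp
qed simp

lemma C_on_coordinate: "C_on r n U (\<lambda>x. x j)"
proof (cases r)
  case (Suc r')
  have "partial i (\<lambda>x. x j) = (\<lambda>x. if i = j then 1 else 0)" for i
    by (auto simp: partial_def)
  then have "C_on r' n U (partial i (\<lambda>x. x j))" for i by (simp add: C_on_const)
  moreover have "(\<lambda>t. (x(i := t)) j) differentiable at (x i)" for x :: "nat \<Rightarrow> real" and i
    by (cases "i = j") auto
  ultimately show ?thesis
    using Suc continuous_on_subset[OF continuous_on_product_coordinates] by simp
qed (auto intro: continuous_on_subset[OF continuous_on_product_coordinates])

lemma has_real_derivative_imp_differentiable:
  "(f has_real_derivative D) (at x) \<Longrightarrow> f differentiable at x"
  using real_differentiable_def by blast

lemma line_has_derivative:
  assumes "C_on (Suc r) n U f" "x \<in> U" "i < n"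
  shows "((\<lambda>t. f (x(i := t))) has_real_derivative partial i f x) (at (x i))"
  using assms by (auto simp: partial_def DERIV_deriv_iff_real_differentiable)

lemma C_on_add:
  assumes "openin (Euclidean_space n) U" "C_on r n U f" "C_on r n U g"
  shows "C_on r n U (\<lambda>x. f x + g x)"
  using assms(2,3)
proof (induction r arbitrary: f g)
  case 0
  then show ?case by (auto intro: continuous_intros)
next
  case (Suc r)
  have D: "((\<lambda>t. f (x(i := t)) + g (x(i := t))) has_real_derivative partial i f x + partial i g x) (at (x i))"
    if "x \<in> U" "i < n" for x i
    by (intro DERIV_add line_has_derivative[OF Suc.prems(1) that] line_has_derivative[OF Suc.prems(2) that])
  have P: "partial i (\<lambda>x. f x + g x) x = partial i f x + partial i g x" if "x \<in> U" "i < n" for x i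
    unfolding partial_def[of i "\<lambda>x. f x + g x"] by (rule DERIV_imp_deriv[OF D[OF that]])
  have "C_on r n U (partial i (\<lambda>x. f x + g x))" if "i < n" for i
    by (rule C_on_cong[OF assms(1), of "\<lambda>x. partial i f x + partial i g x"])
      (use P that Suc in auto)
  then show ?case using Suc.prems has_real_derivative_imp_differentiable[OF D] by (auto intro!: continuous_on_add)
qed

lemma C_on_mult:
  assumes "openin (Euclidean_space n) U" "C_on r n U f" "C_on r n U g"
  shows "C_on r n U (\<lambda>x. f x * g x)"
  using assms(2,3)
proof (induction r arbitrary: f g)
  case 0
  then show ?case by (auto intro: continuous_intros)
next
  case (Suc r)
  have D: "((\<lambda>t. f (x(i := t)) * g (x(i := t))) has_real_derivative
      partial i f x * g x + partial i g x * f x) (at (x i))"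
    if "x \<in> U" "i < n" for x i
    using DERIV_mult[OF line_has_derivative[OF Suc.prems(1) that] line_has_derivative[OF Suc.prems(2) that]]
    by (simp only: fun_upd_triv)
  have P: "partial i (\<lambda>x. f x * g x) x = partial i f x * g x + partial i g x * f x"
    if "x \<in> U" "i < n" for x i
    unfolding partial_def[of i "\<lambda>x. f x * g x"] by (rule DERIV_imp_deriv[OF D[OF that]])
  have fg: "C_on r n U f" "C_on r n U g" using Suc.prems by (blast dest: C_on_SucD)+
  have "C_on r n U (partial i (\<lambda>x. f x * g x))" if "i < n" for i
    by (rule C_on_cong[OF assms(1), of "\<lambda>x. partial i f x * g x + partial i g x * f x"])
      (use P that Suc.prems fg in \<open>auto intro!: C_on_add[OF assms(1)] Suc.IH\<close>)
  then show ?case using Suc.prems has_real_derivative_imp_differentiable[OF D] by (auto intro!: continuous_on_mult)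
qed

lemma C_on_sum:
  assumes "openin (Euclidean_space n) U" "\<And>a. a \<in> A \<Longrightarrow> C_on r n U (f a)"
  shows "C_on r n U (\<lambda>x. \<Sum>a\<in>A. f a x)"
  using assms(2)
  by (induction A rule: infinite_finite_induct) (auto simp: C_on_const C_on_add[OF assms(1)])

text \<open>A function with continuous partial derivatives is differentiable. The linear approximation is
  obtained by changing one coordinate at a time: the mean value inequality bounds the error of each change by
  the oscillation of one partial derivative over a small box.\<close>

lemma total_differential:
  assumes U: "openin (Euclidean_space n) U" and f: "C_on (Suc 0) n U f" and x: "x \<in> U" and "\<epsilon> > 0"
  shows "\<exists>\<delta>>0. \<forall>y\<in>rspace n. (\<forall>i<n. \<bar>y i - x i\<bar> < \<delta>) \<longrightarrow>
       \<bar>f y - f x - (\<Sum>i<n. partial i f x * (y i - x i))\<bar> \<le> \<epsilon> * (\<Sum>i<n. \<bar>y i - x i\<bar>)"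
proof -
  define V where "V = U \<inter> (\<Inter>i\<in>{..<n}. {y \<in> U. partial i f y \<in> {partial i f x - \<epsilon><..<partial i f x + \<epsilon>}})"
  have xr: "x \<in> rspace n" using x U openin_Euclidean_subset by blast
  have op: "openin (Euclidean_space n) {y \<in> U. partial i f y \<in> {partial i f x - \<epsilon><..<partial i f x + \<epsilon>}}"
    if "i < n" for i
  proof -
    have "continuous_on U (partial i f)" using f that by simp
    then have "openin (top_of_set U) (U \<inter> partial i f -` {partial i f x - \<epsilon><..<partial i f x + \<epsilon>})"
      by (simp add: continuous_openin_preimage_gen)
    then have "openin (Euclidean_space n) (U \<inter> partial i f -` {partial i f x - \<epsilon><..<partial i f x + \<epsilon>})"
      using U unfolding Euclidean_space_eq_top_of_set by (meson openin_trans)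
    moreover have "U \<inter> partial i f -` {partial i f x - \<epsilon><..<partial i f x + \<epsilon>} =
      {y \<in> U. partial i f y \<in> {partial i f x - \<epsilon><..<partial i f x + \<epsilon>}}" by auto
    ultimately show ?thesis by simp
  qed
  have "openin (Euclidean_space n) V"
  proof (cases "n = 0")
    case True
    then show ?thesis using U by (simp add: V_def)
  next
    case False
    then show ?thesis unfolding V_def by (intro openin_Int U openin_INT2) (use op in auto)
  qed
  moreover have "x \<in> V" using x \<open>\<epsilon> > 0\<close> by (auto simp: V_def)
  ultimately obtain \<delta> where \<delta>: "\<delta> > 0"
    "\<And>y. y \<in> rspace n \<Longrightarrow> (\<And>i. i < n \<Longrightarrow> \<bar>y i - x i\<bar> < \<delta>) \<Longrightarrow> y \<in> V"
    by (rule openin_Euclidean_box) blast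
  have "\<bar>f y - f x - (\<Sum>i<n. partial i f x * (y i - x i))\<bar> \<le> \<epsilon> * (\<Sum>i<n. \<bar>y i - x i\<bar>)"
    if y: "y \<in> rspace n" "\<And>i. i < n \<Longrightarrow> \<bar>y i - x i\<bar> < \<delta>" for y
  proof -
    define z where "z k = (\<lambda>i. if i < k then y i else x i)" for k
    have step: "\<bar>f (z (Suc k)) - f (z k) - partial k f x * (y k - x k)\<bar> \<le> \<epsilon> * \<bar>y k - x k\<bar>"
      if "k < n" for k
    proof -
      define \<phi> where "\<phi> t = f ((z k)(k := t))" for t
      have inV: "(z k)(k := t) \<in> V" if "\<bar>t - x k\<bar> < \<delta>" for t
        using that \<open>k < n\<close> y xr \<delta>(1) by (intro \<delta>(2)) (auto simp: z_def in_rspace_iff)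
      have d: "(\<phi> has_real_derivative partial k f ((z k)(k := t))) (at t)" if "\<bar>t - x k\<bar> < \<delta>" for t
        using line_has_derivative[OF f _ \<open>k < n\<close>, of "(z k)(k := t)"] inV[OF that]
        unfolding \<phi>_def V_def by simp
      have near: "\<bar>partial k f ((z k)(k := t)) - partial k f x\<bar> \<le> \<epsilon>" if "\<bar>t - x k\<bar> < \<delta>" for t
      proof -
        have "partial k f ((z k)(k := t)) \<in> {partial k f x - \<epsilon><..<partial k f x + \<epsilon>}"
          using inV[OF that] \<open>k < n\<close> by (auto simp: V_def)
        then show ?thesis by auto
      qed
      have "norm ((\<phi> (y k) - y k * partial k f x) - (\<phi> (x k) - x k * partial k f x)) \<le> \<epsilon> * norm (y k - x k)"
      proof (rule field_differentiable_bound[where S = "ball (x k) \<delta>" and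
            f' = "\<lambda>t. partial k f ((z k)(k := t)) - 1 * partial k f x"])
        fix t assume t: "t \<in> ball (x k) \<delta>"
        then have t': "\<bar>t - x k\<bar> < \<delta>" by (simp add: dist_real_def abs_minus_commute)
        show "((\<lambda>t. \<phi> t - t * partial k f x) has_field_derivative
            partial k f ((z k)(k := t)) - 1 * partial k f x) (at t within ball (x k) \<delta>)"
          by (intro DERIV_diff DERIV_cmult_right has_field_derivative_at_within[OF d[OF t']] DERIV_ident)
        show "norm (partial k f ((z k)(k := t)) - 1 * partial k f x) \<le> \<epsilon>"
          using near[OF t'] by simp
      qed (use y(2)[OF \<open>k < n\<close>] \<delta>(1) in \<open>auto simp: dist_real_def abs_minus_commute\<close>)
      moreover have "\<phi> (y k) = f (z (Suc k))"
        unfolding \<phi>_def by (rule arg_cong[of _ _ f]) (auto simp: z_def)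
      moreover have "\<phi> (x k) = f (z k)"
        unfolding \<phi>_def by (rule arg_cong[of _ _ f]) (auto simp: z_def)
      ultimately show ?thesis by (simp add: algebra_simps)
    qed
    have "z 0 = x" "z n = y" using xr y(1) by (auto simp: z_def fun_eq_iff in_rspace_iff)
    then have "f y - f x = (\<Sum>k<n. f (z (Suc k)) - f (z k))"
      using sum_lessThan_telescope[of "\<lambda>k. f (z k)" n] by simp
    then have "\<bar>f y - f x - (\<Sum>i<n. partial i f x * (y i - x i))\<bar> =
        \<bar>\<Sum>k<n. f (z (Suc k)) - f (z k) - partial k f x * (y k - x k)\<bar>"
      by (simp add: sum_subtractf)
    also have "\<dots> \<le> (\<Sum>k<n. \<epsilon> * \<bar>y k - x k\<bar>)"
      using step by (intro order_trans[OF sum_abs] sum_mono) auto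
    finally show ?thesis by (simp add: sum_distrib_left)
  qed
  then show ?thesis using \<open>\<delta> > 0\<close> by auto
qed

text \<open>Curves suffice for the chain rule below, as a partial derivative of a composite is a derivative
  along the image of a coordinate line. The error term of the linear approximation, divided by \<open>t -
  t0\<close>, is at most \<open>\<epsilon>\<close> times a sum of difference quotients of
  \<open>\<gamma>\<close>, and these are bounded.\<close>

lemma chain_rule_curve:
  assumes U: "openin (Euclidean_space n) U" and f: "C_on (Suc 0) n U f" and x: "\<gamma> t0 \<in> U"
    and \<gamma>: "\<forall>\<^sub>F t in nhds t0. \<gamma> t \<in> rspace n"
    and d: "\<And>i. i < n \<Longrightarrow> ((\<lambda>t. \<gamma> t i) has_real_derivative d i) (at t0)"
  shows "((\<lambda>t. f (\<gamma> t)) has_real_derivative (\<Sum>i<n. partial i f (\<gamma> t0) * d i)) (at t0)"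
proof -
  let ?L = "\<lambda>t. \<Sum>i<n. partial i f (\<gamma> t0) * (\<gamma> t i - \<gamma> t0 i)"
  define R where "R t = f (\<gamma> t) - f (\<gamma> t0) - ?L t" for t
  define B where "B = (\<Sum>i<n. \<bar>d i\<bar>) + 1"
  have B: "B > 0" unfolding B_def by (simp add: add_nonneg_pos sum_nonneg)
  have q: "((\<lambda>t. \<Sum>i<n. \<bar>(\<gamma> t i - \<gamma> t0 i) / (t - t0)\<bar>) \<longlongrightarrow> (\<Sum>i<n. \<bar>d i\<bar>)) (at t0)"
    using d by (intro tendsto_intros) (auto simp: has_field_derivative_iff)
  have bd: "\<forall>\<^sub>F t in at t0. (\<Sum>i<n. \<bar>(\<gamma> t i - \<gamma> t0 i) / (t - t0)\<bar>) < B"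
    using order_tendstoD(2)[OF q, of B] by (simp add: B_def)
  have R: "((\<lambda>t. R t / (t - t0)) \<longlongrightarrow> 0) (at t0)"
  proof (rule tendstoI)
    fix e :: real assume "e > 0"
    then have "e / (2 * B) > 0" using B by simp
    from total_differential[OF U f x this] obtain \<delta> where \<delta>: "\<delta> > 0"
      "\<forall>y\<in>rspace n. (\<forall>i<n. \<bar>y i - \<gamma> t0 i\<bar> < \<delta>) \<longrightarrow>
       \<bar>f y - f (\<gamma> t0) - (\<Sum>i<n. partial i f (\<gamma> t0) * (y i - \<gamma> t0 i))\<bar> \<le> e / (2 * B) * (\<Sum>i<n. \<bar>y i - \<gamma> t0 i\<bar>)"
      by (elim exE conjE)
    have "\<forall>\<^sub>F t in at t0. \<forall>i\<in>{..<n}. \<bar>\<gamma> t i - \<gamma> t0 i\<bar> < \<delta>"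
    proof (rule eventually_ball_finite)
      show "\<forall>i\<in>{..<n}. \<forall>\<^sub>F t in at t0. \<bar>\<gamma> t i - \<gamma> t0 i\<bar> < \<delta>"
      proof
        fix i assume "i \<in> {..<n}"
        then have "isCont (\<lambda>t. \<gamma> t i) t0" using DERIV_isCont[OF d[of i]] by simp
        then have "((\<lambda>t. \<gamma> t i) \<longlongrightarrow> \<gamma> t0 i) (at t0)" by (simp add: isCont_def)
        from tendstoD[OF this \<delta>(1)] show "\<forall>\<^sub>F t in at t0. \<bar>\<gamma> t i - \<gamma> t0 i\<bar> < \<delta>"
          by (simp add: dist_real_def)
      qed
    qed simp
    moreover have "\<forall>\<^sub>F t in at t0. \<gamma> t \<in> rspace n"
      using \<gamma> by (simp add: eventually_nhds_conv_at)
    moreover have "\<forall>\<^sub>F t in at t0. t \<noteq> t0" by (simp add: eventually_at_filter)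
    ultimately show "\<forall>\<^sub>F t in at t0. dist (R t / (t - t0)) 0 < e"
      using bd
    proof eventually_elim
      case (elim t)
      have "\<bar>R t\<bar> \<le> e / (2 * B) * (\<Sum>i<n. \<bar>\<gamma> t i - \<gamma> t0 i\<bar>)"
        unfolding R_def by (rule \<delta>(2)[rule_format]) (use elim(1,2) in auto)
      then have "\<bar>R t\<bar> / \<bar>t - t0\<bar> \<le> e / (2 * B) * (\<Sum>i<n. \<bar>\<gamma> t i - \<gamma> t0 i\<bar>) / \<bar>t - t0\<bar>"
        by (rule divide_right_mono) simp
      also have "\<dots> = e / (2 * B) * (\<Sum>i<n. \<bar>(\<gamma> t i - \<gamma> t0 i) / (t - t0)\<bar>)"
        unfolding abs_divide by (simp only: sum_divide_distrib[symmetric] times_divide_eq_right)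
      also have "\<dots> \<le> e / (2 * B) * B"
        by (rule mult_left_mono) (use elim(4) \<open>e / (2 * B) > 0\<close> in linarith)+
      also have "\<dots> < e" using B \<open>e > 0\<close> by (simp add: field_simps)
      finally show ?case by (simp only: dist_real_def diff_0_right abs_divide)
    qed
  qed
  have "((\<lambda>t. R t / (t - t0) + (\<Sum>i<n. partial i f (\<gamma> t0) * ((\<gamma> t i - \<gamma> t0 i) / (t - t0))))
      \<longlongrightarrow> 0 + (\<Sum>i<n. partial i f (\<gamma> t0) * d i)) (at t0)"
    using d by (intro tendsto_add R tendsto_sum tendsto_mult tendsto_const)
      (auto simp: has_field_derivative_iff)
  moreover have "R t / (t - t0) + (\<Sum>i<n. partial i f (\<gamma> t0) * ((\<gamma> t i - \<gamma> t0 i) / (t - t0)))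
      = (f (\<gamma> t) - f (\<gamma> t0)) / (t - t0)" for t
    unfolding times_divide_eq_right sum_divide_distrib[symmetric] add_divide_distrib[symmetric]
    by (simp add: R_def)
  ultimately show ?thesis by (simp only: has_field_derivative_iff add_0)
qed

lemma continuous_on_into_rspace:
  assumes "\<And>j. j < m \<Longrightarrow> continuous_on U (\<lambda>x. F x j)" "F ` U \<subseteq> rspace m"
  shows "continuous_on U F"
proof (rule continuous_on_coordinatewise_then_product)
  fix j
  show "continuous_on U (\<lambda>x. F x j)"
  proof (cases "j < m")
    case False
    then have "F x j = 0" if "x \<in> U" for x using assms(2) that by (force simp: in_rspace_iff)
    then show ?thesis using continuous_on_cong[of U U "\<lambda>x. F x j" "\<lambda>x. 0"] by simp
  qed (use assms(1) in auto)
qed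

lemma chain_rule_partial:
  assumes U: "openin (Euclidean_space n) U" and V: "openin (Euclidean_space m) V"
    and F: "\<And>j. j < m \<Longrightarrow> C_on (Suc 0) n U (\<lambda>x. F x j)" "F ` U \<subseteq> V"
    and g: "C_on (Suc 0) m V g" and x: "x \<in> U" and i: "i < n"
  shows "((\<lambda>t. g (F (x(i := t)))) has_real_derivative
      (\<Sum>j<m. partial j g (F x) * partial i (\<lambda>x. F x j) x)) (at (x i))"
    "partial i (\<lambda>x. g (F x)) x = (\<Sum>j<m. partial j g (F x) * partial i (\<lambda>x. F x j) x)"
proof -
  have "((\<lambda>t. g (F (x(i := t)))) has_real_derivative
      (\<Sum>j<m. partial j g (F (x(i := x i))) * partial i (\<lambda>x. F x j) x)) (at (x i))"
  proof (rule chain_rule_curve[OF V g, where \<gamma> = "\<lambda>t. F (x(i := t))"])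
    show "F (x(i := x i)) \<in> V" using F(2) x by auto
    show "\<forall>\<^sub>F t in nhds (x i). F (x(i := t)) \<in> rspace m"
      using eventually_line_in_open[OF U x i] F(2) openin_Euclidean_subset[OF V]
      by (auto elim!: eventually_mono)
  qed (use line_has_derivative[OF F(1) x i] in auto)
  then show D: "((\<lambda>t. g (F (x(i := t)))) has_real_derivative
      (\<Sum>j<m. partial j g (F x) * partial i (\<lambda>x. F x j) x)) (at (x i))" by simp
  then show "partial i (\<lambda>x. g (F x)) x = (\<Sum>j<m. partial j g (F x) * partial i (\<lambda>x. F x j) x)"
    unfolding partial_def[of i "\<lambda>x. g (F x)"] by (rule DERIV_imp_deriv)
qed

lemma C_on_mono: "C_on r n U f \<Longrightarrow> s \<le> r \<Longrightarrow> C_on s n U f"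
  by (induction r) (auto simp: le_Suc_eq dest: C_on_SucD simp del: C_on.simps)

text \<open>By induction on the order of differentiability: the partial derivatives of a composite are sums of
  products in which every factor is one order lower.\<close>

lemma C_on_compose:
  assumes U: "openin (Euclidean_space n) U" and V: "openin (Euclidean_space m) V"
    and "\<And>j. j < m \<Longrightarrow> C_on r n U (\<lambda>x. F x j)" "F ` U \<subseteq> V" "C_on r m V g"
  shows "C_on r n U (\<lambda>x. g (F x))"
  using assms(3,5)
proof (induction r arbitrary: g)
  case 0
  have "continuous_on U F"
    using 0 assms(4) openin_Euclidean_subset[OF V] by (intro continuous_on_into_rspace[of m]) auto
  then show ?case using continuous_on_compose2[OF _ _ assms(4)] 0 by simp
next
  case (Suc r)
  have 1: "\<And>j. j < m \<Longrightarrow> C_on (Suc 0) n U (\<lambda>x. F x j)" "C_on (Suc 0) m V g"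
    using Suc.prems C_on_mono[of "Suc r" _ _ _ "Suc 0"] by (auto simp del: C_on.simps)
  have 2: "C_on r n U (\<lambda>x. h (F x))" if "C_on r m V h" for h
    using Suc.IH[OF _ that] Suc.prems(1) C_on_SucD by blast
  have "C_on r n U (partial i (\<lambda>x. g (F x)))" if "i < n" for i
  proof (rule C_on_cong[OF U])
    show "C_on r n U (\<lambda>x. \<Sum>j<m. partial j g (F x) * partial i (\<lambda>x. F x j) x)"
      using Suc.prems that by (intro C_on_sum[OF U] C_on_mult[OF U] 2) auto
    show "(\<Sum>j<m. partial j g (F x) * partial i (\<lambda>x. F x j) x) = partial i (\<lambda>x. g (F x)) x" if "x \<in> U" for x
      using chain_rule_partial(2)[OF U V 1(1) assms(4) 1(2) that \<open>i < n\<close>] by simp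
  qed
  moreover have "continuous_on U (\<lambda>x. g (F x))"
    using 2 Suc.prems(2) C_on_SucD C_on_continuous by blast
  ultimately show ?case
    using chain_rule_partial(1)[OF U V 1(1) assms(4) 1(2)] by (auto intro!: has_real_derivative_imp_differentiable)
qed

text \<open>The mean value theorem, applied along the coordinate \<open>i\<close> and then along
  \<open>j\<close>.\<close>

lemma second_difference:
  assumes U: "openin (Euclidean_space n) U" and f: "C_on 2 n U f" and ij: "i < n" "j < n" "i \<noteq> j"
    and h: "h > 0" and box: "\<And>s t. 0 \<le> s \<Longrightarrow> s \<le> h \<Longrightarrow> 0 \<le> t \<Longrightarrow> t \<le> h \<Longrightarrow> x(i := x i + s, j := x j + t) \<in> U"
  obtains s t where "0 < s" "s < h" "0 < t" "t < h"
    "f (x(i := x i + h, j := x j + h)) - f (x(i := x i + h)) - f (x(j := x j + h)) + f x =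
      h * h * partial j (partial i f) (x(i := x i + s, j := x j + t))"
proof -
  have f': "C_on (Suc 0) n U f" "C_on (Suc 0) n U (partial i f)"
    using f ij by (auto simp: numeral_2_eq_2)
  define P where "P s t = x(i := x i + s, j := x j + t)" for s t
  have Di: "((\<lambda>s. f (P s t)) has_real_derivative partial i f (P s t)) (at s)"
    if "0 \<le> s" "s \<le> h" "0 \<le> t" "t \<le> h" for s t
  proof -
    have "((\<lambda>u. f ((P s t)(i := u))) has_real_derivative partial i f (P s t)) (at (s + x i))"
      using line_has_derivative[OF f'(1) box[OF that] ij(1)] ij(3) by (simp add: P_def add.commute)
    then have "((\<lambda>s'. f ((P s t)(i := s' + x i))) has_real_derivative partial i f (P s t)) (at s)"
      by (simp only: DERIV_shift)
    moreover have "(P s t)(i := s' + x i) = P s' t" for s'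
      using ij(3) by (auto simp: P_def)
    ultimately show ?thesis by simp
  qed
  have Dj: "((\<lambda>t. partial i f (P s t)) has_real_derivative partial j (partial i f) (P s t)) (at t)"
    if "0 \<le> s" "s \<le> h" "0 \<le> t" "t \<le> h" for s t
  proof -
    have "((\<lambda>u. partial i f ((P s t)(j := u))) has_real_derivative partial j (partial i f) (P s t)) (at (t + x j))"
      using line_has_derivative[OF f'(2) box[OF that] ij(2)] by (simp add: P_def add.commute)
    then have "((\<lambda>t'. partial i f ((P s t)(j := t' + x j))) has_real_derivative
        partial j (partial i f) (P s t)) (at t)"
      by (simp only: DERIV_shift)
    moreover have "(P s t)(j := t' + x j) = P s t'" for t'
      by (auto simp: P_def)
    ultimately show ?thesis by simp
  qed
  have "\<exists>s. 0 < s \<and> s < h \<and> (f (P h h) - f (P h 0)) - (f (P 0 h) - f (P 0 0)) =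
      (h - 0) * (partial i f (P s h) - partial i f (P s 0))"
    using h by (intro MVT2[where f = "\<lambda>s. f (P s h) - f (P s 0)"] DERIV_diff Di) auto
  then obtain s where s: "0 < s" "s < h" "(f (P h h) - f (P h 0)) - (f (P 0 h) - f (P 0 0)) =
      h * (partial i f (P s h) - partial i f (P s 0))" by auto
  have "\<exists>t. 0 < t \<and> t < h \<and> partial i f (P s h) - partial i f (P s 0) =
      (h - 0) * partial j (partial i f) (P s t)"
    using h s by (intro MVT2[where f = "\<lambda>t. partial i f (P s t)"] Dj) auto
  then obtain t where t: "0 < t" "t < h" "partial i f (P s h) - partial i f (P s 0) =
      h * partial j (partial i f) (P s t)" by auto
  have P: "P h 0 = x(i := x i + h)" "P 0 h = x(j := x j + h)" "P 0 0 = x"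
    using ij(3) by (auto simp: P_def)
  show thesis
    by (rule that[OF s(1,2) t(1,2)]) (use s(3) t(3) P in \<open>simp add: P_def\<close>)
qed

text \<open>The second difference of \<open>f\<close> is symmetric in the coordinates \<open>i\<close> and
  \<open>j\<close>. Divided by the square of the step, it is a value of either mixed derivative at a point
  near \<open>x\<close>, so by continuity the two agree at \<open>x\<close>.\<close>

lemma partial_commute:
  assumes U: "openin (Euclidean_space n) U" and f: "C_on 2 n U f" and ij: "i < n" "j < n" and x: "x \<in> U"
  shows "partial i (partial j f) x = partial j (partial i f) x"
proof (cases "i = j")
  case False
  let ?A = "partial j (partial i f)" and ?B = "partial i (partial j f)"
  have cont: "continuous_on U ?A" "continuous_on U ?B"
    using f ij by (auto simp: numeral_2_eq_2)
  have "\<bar>?A x - ?B x\<bar> \<le> e" if "e > 0" for e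
  proof -
    define W where "W = {y \<in> U. \<bar>?A y - ?A x\<bar> < e / 2} \<inter> {y \<in> U. \<bar>?B y - ?B x\<bar> < e / 2}"
    have "openin (Euclidean_space n) {y \<in> U. \<bar>g y - g x\<bar> < e / 2}" if "continuous_on U g" for g
    proof -
      have "openin (top_of_set U) (U \<inter> g -` ball (g x) (e / 2))"
        using that by (simp add: continuous_openin_preimage_gen)
      moreover have "U \<inter> g -` ball (g x) (e / 2) = {y \<in> U. \<bar>g y - g x\<bar> < e / 2}"
        by (auto simp: dist_real_def abs_minus_commute)
      ultimately show ?thesis using U unfolding Euclidean_space_eq_top_of_set by (metis openin_trans)
    qed
    then have "openin (Euclidean_space n) W" unfolding W_def using cont by (intro openin_Int) auto
    moreover have "x \<in> W" using x \<open>e > 0\<close> by (auto simp: W_def)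
    ultimately obtain d where d: "d > 0"
      "\<And>y. y \<in> rspace n \<Longrightarrow> (\<And>i. i < n \<Longrightarrow> \<bar>y i - x i\<bar> < d) \<Longrightarrow> y \<in> W"
      by (rule openin_Euclidean_box) blast
    define h where "h = d / 2"
    have h: "h > 0" "h < d" using d(1) by (auto simp: h_def)
    have xr: "x \<in> rspace n" using x U openin_Euclidean_subset by blast
    have inW: "x(i := x i + s, j := x j + t) \<in> W" if "0 \<le> s" "s \<le> h" "0 \<le> t" "t \<le> h" for s t
      using that h xr ij d(1) by (intro d(2)) (auto simp: in_rspace_iff)
    have inW': "x(j := x j + s, i := x i + t) \<in> W" if "0 \<le> s" "s \<le> h" "0 \<le> t" "t \<le> h" for s t
      using inW[OF that(3,4,1,2)] False by (simp add: fun_upd_twist)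
    have WU: "W \<subseteq> U" by (auto simp: W_def)
    obtain s t where st: "0 < s" "s < h" "0 < t" "t < h"
      "f (x(i := x i + h, j := x j + h)) - f (x(i := x i + h)) - f (x(j := x j + h)) + f x =
      h * h * ?A (x(i := x i + s, j := x j + t))"
      using second_difference[OF U f ij False h(1), of x] inW WU by blast
    obtain s' t' where st': "0 < s'" "s' < h" "0 < t'" "t' < h"
      "f (x(j := x j + h, i := x i + h)) - f (x(j := x j + h)) - f (x(i := x i + h)) + f x =
      h * h * ?B (x(j := x j + s', i := x i + t'))"
      using second_difference[OF U f ij(2,1) False[symmetric] h(1), of x] inW' WU by blast
    have "h * h * ?A (x(i := x i + s, j := x j + t)) = h * h * ?B (x(j := x j + s', i := x i + t'))"
      using st(5) st'(5) unfolding fun_upd_twist[OF False] by linarith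
    then have "?A (x(i := x i + s, j := x j + t)) = ?B (x(j := x j + s', i := x i + t'))"
      using h(1) by simp
    moreover have "\<bar>?A (x(i := x i + s, j := x j + t)) - ?A x\<bar> < e / 2"
      using inW[of s t] st by (auto simp: W_def)
    moreover have "\<bar>?B (x(j := x j + s', i := x i + t')) - ?B x\<bar> < e / 2"
      using inW'[of s' t'] st' by (auto simp: W_def)
    ultimately show ?thesis by linarith
  qed
  then have "\<bar>?A x - ?B x\<bar> \<le> 0" by (rule field_le_epsilon) simp
  then show ?thesis by simp
qed simp

section \<open>Smooth functions\<close>

lemma smooth_on_cong:
  assumes "openin (Euclidean_space n) U" "\<And>y. y \<in> U \<Longrightarrow> f y = g y" "smooth_on n U f"
  shows "smooth_on n U g"
  using assms(3) unfolding smooth_on_def by (auto intro: C_on_cong[OF assms(1,2)])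

lemma smooth_on_subset: "smooth_on m V f \<Longrightarrow> U \<subseteq> V \<Longrightarrow> n \<le> m \<Longrightarrow> smooth_on n U f"
  unfolding smooth_on_def by (auto intro: C_on_subset)

lemma smooth_on_local:
  assumes U: "U \<subseteq> rspace n"
    and loc: "\<And>x. x \<in> U \<Longrightarrow> \<exists>V. openin (Euclidean_space n) V \<and> x \<in> V \<and> smooth_on n V f"
  shows "smooth_on n U f"
  unfolding smooth_on_def
proof
  fix r
  show "C_on r n U f"
  proof (rule C_on_local[OF U])
    fix x assume "x \<in> U"
    from loc[OF this] show "\<exists>V. openin (Euclidean_space n) V \<and> x \<in> V \<and> C_on r n V f"
      unfolding smooth_on_def by auto
  qed
qed

lemma smooth_on_const: "smooth_on n U (\<lambda>x. c)"
  by (simp add: smooth_on_def C_on_const)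

lemma smooth_on_coordinate: "smooth_on n U (\<lambda>x. x j)"
  by (simp add: smooth_on_def C_on_coordinate)

lemma smooth_on_add:
  "openin (Euclidean_space n) U \<Longrightarrow> smooth_on n U f \<Longrightarrow> smooth_on n U g \<Longrightarrow> smooth_on n U (\<lambda>x. f x + g x)"
  by (simp add: smooth_on_def C_on_add)

lemma smooth_on_mult:
  "openin (Euclidean_space n) U \<Longrightarrow> smooth_on n U f \<Longrightarrow> smooth_on n U g \<Longrightarrow> smooth_on n U (\<lambda>x. f x * g x)"
  by (simp add: smooth_on_def C_on_mult)

lemma smooth_on_sum:
  "openin (Euclidean_space n) U \<Longrightarrow> (\<And>a. a \<in> A \<Longrightarrow> smooth_on n U (f a)) \<Longrightarrow> smooth_on n U (\<lambda>x. \<Sum>a\<in>A. f a x)"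
  by (simp add: smooth_on_def C_on_sum)

lemma smooth_on_compose:
  assumes "openin (Euclidean_space n) U" "openin (Euclidean_space m) V"
    "\<And>j. j < m \<Longrightarrow> smooth_on n U (\<lambda>x. F x j)" "F ` U \<subseteq> V" "smooth_on m V g"
  shows "smooth_on n U (\<lambda>x. g (F x))"
  using assms(3,5) C_on_compose[OF assms(1,2) _ assms(4)] unfolding smooth_on_def by simp

lemma smooth_on_partial: "smooth_on n U f \<Longrightarrow> i < n \<Longrightarrow> smooth_on n U (partial i f)"
  unfolding smooth_on_def by (metis C_on.simps(2))

lemma smooth_on_continuous: "smooth_on n U f \<Longrightarrow> continuous_on U f"
  using C_on_continuous[of 0 n U f] unfolding smooth_on_def by blast

lemma smooth_on_chain_rule:
  assumes "openin (Euclidean_space n) U" "openin (Euclidean_space m) V"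
    "\<And>j. j < m \<Longrightarrow> smooth_on n U (\<lambda>x. F x j)" "F ` U \<subseteq> V" "smooth_on m V g" "x \<in> U" "i < n"
  shows "partial i (\<lambda>x. g (F x)) x = (\<Sum>j<m. partial j g (F x) * partial i (\<lambda>x. F x j) x)"
proof (rule chain_rule_partial(2)[OF assms(1,2) _ assms(4) _ assms(6,7)])
  show "C_on (Suc 0) m V g" using assms(5) unfolding smooth_on_def by (rule spec)
  show "C_on (Suc 0) n U (\<lambda>x. F x j)" if "j < m" for j
    using assms(3)[OF that] unfolding smooth_on_def by (rule spec)
qed

lemma partial_coordinate: "partial i (\<lambda>x. x j) x = (if i = j then 1 else 0)"
  by (auto simp: partial_def)

lemma partial_mult:
  assumes "smooth_on n U f" "smooth_on n U g" "x \<in> U" "i < n"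
  shows "partial i (\<lambda>x. f x * g x) x = partial i f x * g x + f x * partial i g x"
proof -
  have "((\<lambda>t. f (x(i := t)) * g (x(i := t))) has_real_derivative
      partial i f x * g (x(i := x i)) + partial i g x * f (x(i := x i))) (at (x i))"
    by (intro DERIV_mult line_has_derivative[where r = 0 and n = n and U = U])
      (use assms in \<open>auto simp: smooth_on_def simp del: C_on.simps\<close>)
  then show ?thesis unfolding partial_def[of i "\<lambda>x. f x * g x"]
    by (simp add: DERIV_imp_deriv mult.commute)
qed

lemma partial_sum:
  assumes "\<And>a. a \<in> A \<Longrightarrow> smooth_on n U (f a)" "x \<in> U" "i < n"
  shows "partial i (\<lambda>x. \<Sum>a\<in>A. f a x) x = (\<Sum>a\<in>A. partial i (f a) x)"
proof -
  have "((\<lambda>t. \<Sum>a\<in>A. f a (x(i := t))) has_real_derivative (\<Sum>a\<in>A. partial i (f a) x)) (at (x i))"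
    by (intro DERIV_sum line_has_derivative[where r = 0 and n = n and U = U])
      (use assms in \<open>auto simp: smooth_on_def simp del: C_on.simps\<close>)
  then show ?thesis unfolding partial_def[of i "\<lambda>x. \<Sum>a\<in>A. f a x"] by (rule DERIV_imp_deriv)
qed

text \<open>The way in which smoothness of transitions yields openness of sets and continuity of coordinate
  maps.\<close>

lemma smooth_preimage_open:
  assumes U: "openin (Euclidean_space n) U" and V: "openin (Euclidean_space m) V"
    and F: "\<And>j. j < m \<Longrightarrow> smooth_on n U (\<lambda>x. F x j)" "F ` U \<subseteq> rspace m"
  shows "openin (Euclidean_space n) {x \<in> U. F x \<in> V}"
proof -
  have "continuous_on U F"
    by (rule continuous_on_into_rspace[of m, OF smooth_on_continuous[OF F(1)] F(2)])
  obtain T where T: "open T" "V = rspace m \<inter> T"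
    using V unfolding Euclidean_space_eq_top_of_set openin_open by auto
  have "openin (top_of_set U) (U \<inter> F -` T)"
    using \<open>continuous_on U F\<close> T(1) by (simp add: continuous_openin_preimage_gen)
  moreover have "U \<inter> F -` T = {x \<in> U. F x \<in> V}" using F(2) T(2) by auto
  ultimately show ?thesis using U unfolding Euclidean_space_eq_top_of_set by (metis openin_trans)
qed

section \<open>Charts\<close>

text \<open>A homeomorphism onto its image is an injective map under which the open subsets of both sides
  correspond. In this form, charts are easy to restrict and to transport.\<close>

lemma is_chart_iff:
  "is_chart X n c \<longleftrightarrow> openin X (fst c) \<and> inj_on (snd c) (fst c) \<and> snd c ` fst c \<subseteq> rspace n \<and>
     (\<forall>W. W \<subseteq> fst c \<longrightarrow> openin X W = openin (Euclidean_space n) (snd c ` W))"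
  (is "?L \<longleftrightarrow> ?R")
proof
  assume L: ?L
  then have o: "openin X (fst c)" "openin (Euclidean_space n) (snd c ` fst c)"
    and h: "homeomorphic_map (subtopology X (fst c)) (subtopology (Euclidean_space n) (snd c ` fst c)) (snd c)"
    by (auto simp: is_chart_def)
  have t: "topspace (subtopology X (fst c)) = fst c"
    using openin_subset[OF o(1)] by (simp add: Int_absorb1)
  have "inj_on (snd c) (fst c)"
    using homeomorphic_imp_injective_map[OF h] t by simp
  moreover have "openin X W = openin (Euclidean_space n) (snd c ` W)" if "W \<subseteq> fst c" for W
    using homeomorphic_map_openness[OF h, of W] that openin_subset[OF o(1)] openin_open_subtopology[OF o(1)]
      openin_open_subtopology[OF o(2)] by (auto simp: t image_mono)
  ultimately show ?R using o openin_Euclidean_subset by auto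
next
  assume R: ?R
  have o: "openin X (fst c)" "openin (Euclidean_space n) (snd c ` fst c)" using R by auto
  have t: "topspace (subtopology X (fst c)) = fst c"
    "topspace (subtopology (Euclidean_space n) (snd c ` fst c)) = snd c ` fst c"
    using openin_subset[OF o(1)] openin_subset[OF o(2)] by (simp_all add: Int_absorb1)
  have "homeomorphic_map (subtopology X (fst c)) (subtopology (Euclidean_space n) (snd c ` fst c)) (snd c)"
  proof (rule bijective_open_imp_homeomorphic_map)
    have *: "snd c ` {p \<in> fst c. snd c p \<in> V} = V" if "V \<subseteq> snd c ` fst c" for V
      using that by auto
    show "continuous_map (subtopology X (fst c)) (subtopology (Euclidean_space n) (snd c ` fst c)) (snd c)"
      unfolding continuous_map_def t openin_open_subtopology[OF o(1)] openin_open_subtopology[OF o(2)]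
      using R * by auto
    show "open_map (subtopology X (fst c)) (subtopology (Euclidean_space n) (snd c ` fst c)) (snd c)"
      unfolding open_map_def openin_open_subtopology[OF o(1)] openin_open_subtopology[OF o(2)]
      using R by (auto simp: image_mono)
  qed (use R t in auto)
  then show ?L using o by (simp add: is_chart_def)
qed

lemma chart_open: "is_chart X n c \<Longrightarrow> openin X (fst c)"
  and chart_inj: "is_chart X n c \<Longrightarrow> inj_on (snd c) (fst c)"
  and chart_image_subset: "is_chart X n c \<Longrightarrow> snd c ` fst c \<subseteq> rspace n"
  and chart_openness: "is_chart X n c \<Longrightarrow> W \<subseteq> fst c \<Longrightarrow> openin X W = openin (Euclidean_space n) (snd c ` W)"
  by (auto simp: is_chart_iff)

lemma chart_image_open: "is_chart X n c \<Longrightarrow> openin (Euclidean_space n) (snd c ` fst c)"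
  by (simp add: is_chart_def)

lemma chart_in_topspace: "is_chart X n c \<Longrightarrow> p \<in> fst c \<Longrightarrow> p \<in> topspace X"
  using chart_open openin_subset by blast

lemma chart_inv_left: "inj_on (snd c) (fst c) \<Longrightarrow> p \<in> fst c \<Longrightarrow> chart_inv c (snd c p) = p"
  by (simp add: chart_inv_def)

lemma chart_inv_right: "x \<in> snd c ` fst c \<Longrightarrow> snd c (chart_inv c x) = x"
  "x \<in> snd c ` fst c \<Longrightarrow> chart_inv c x \<in> fst c"
  by (simp_all add: chart_inv_def f_inv_into_f inv_into_into)

text \<open>The coordinate map of a chart takes arbitrary values outside the domain, so a chart is not
  determined by what it does on its domain; its inverse on the image is.\<close>

lemma chart_inv_restrict:
  assumes "inj_on (snd c) (fst c)" "fst c' \<subseteq> fst c" "\<And>p. p \<in> fst c' \<Longrightarrow> snd c' p = snd c p" "x \<in> snd c' ` fst c'"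
  shows "chart_inv c' x = chart_inv c x"
proof -
  obtain p where p: "p \<in> fst c'" "x = snd c' p" using assms(4) by auto
  have "inj_on (snd c') (fst c')" using assms(1-3) unfolding inj_on_def by (metis subsetD)
  then show ?thesis using p assms chart_inv_left by (metis subsetD)
qed

text \<open>Smoothness of the representative of \<open>F\<close> in two charts. The set \<open>W\<close> is
  kept explicit because a composite is only controlled where all the charts involved are defined.\<close>

definition smooth_rep :: "nat \<Rightarrow> nat \<Rightarrow> 'a chart \<Rightarrow> 'b chart \<Rightarrow> ('a \<Rightarrow> 'b) \<Rightarrow> 'a set \<Rightarrow> bool" where
  "smooth_rep n m c d F W \<longleftrightarrow> (\<forall>j<m. smooth_on n (snd c ` W) (\<lambda>x. snd d (F (chart_inv c x)) j))"

lemma compatible_iff_smooth_rep: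
  "compatible n c d \<longleftrightarrow> smooth_rep n n c d (\<lambda>p. p) (fst c \<inter> fst d) \<and> smooth_rep n n d c (\<lambda>p. p) (fst d \<inter> fst c)"
  by (simp add: compatible_def smooth_transition_def smooth_rep_def Int_commute)

lemma smooth_map_iff_smooth_rep:
  "smooth_map M N F \<longleftrightarrow> continuous_map (mfd_top M) (mfd_top N) F \<and>
     (\<forall>c\<in>mfd_charts M. \<forall>d\<in>mfd_charts N. smooth_rep (mfd_dim M) (mfd_dim N) c d F {p \<in> fst c. F p \<in> fst d})"
  by (simp add: smooth_map_def smooth_rep_def)

lemma smooth_rep_subset: "smooth_rep n m c d F W \<Longrightarrow> W' \<subseteq> W \<Longrightarrow> smooth_rep n m c d F W'"
  unfolding smooth_rep_def by (auto intro: smooth_on_subset)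

lemma smooth_rep_local:
  assumes "is_chart X n c" "W \<subseteq> fst c"
    "\<And>p. p \<in> W \<Longrightarrow> \<exists>W'. openin X W' \<and> p \<in> W' \<and> W' \<subseteq> fst c \<and> smooth_rep n m c d F W'"
  shows "smooth_rep n m c d F W"
  unfolding smooth_rep_def
proof (intro allI impI smooth_on_local)
  show "snd c ` W \<subseteq> rspace n" using chart_image_subset[OF assms(1)] assms(2) by auto
  fix j x assume j: "j < m" and "x \<in> snd c ` W"
  then obtain p where p: "p \<in> W" "x = snd c p" by auto
  from assms(3)[OF p(1)] obtain W' where W': "openin X W'" "p \<in> W'" "W' \<subseteq> fst c" "smooth_rep n m c d F W'"
    by auto
  show "\<exists>V. openin (Euclidean_space n) V \<and> x \<in> V \<and> smooth_on n V (\<lambda>x. snd d (F (chart_inv c x)) j)"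
    by (rule exI[of _ "snd c ` W'"]) (use W' p(2) j chart_openness[OF assms(1)] in \<open>auto simp: smooth_rep_def\<close>)
qed

lemma rep_compose_eq:
  assumes "is_chart X n c" "is_chart Y m d" "W \<subseteq> fst c" "F ` W \<subseteq> W'" "W' \<subseteq> fst d" "x \<in> snd c ` W"
  shows "G (chart_inv d (snd d (F (chart_inv c x)))) = G (F (chart_inv c x))"
    "snd d (F (chart_inv c x)) \<in> snd d ` W'"
proof -
  obtain p where p: "p \<in> W" "x = snd c p" using assms(6) by auto
  then have 1: "chart_inv c x = p" using chart_inv_left[OF chart_inj[OF assms(1)]] assms(3) by blast
  have 2: "F p \<in> W'" using p assms(4) by blast
  then show "snd d (F (chart_inv c x)) \<in> snd d ` W'" using 1 by simp
  show "G (chart_inv d (snd d (F (chart_inv c x)))) = G (F (chart_inv c x))"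
    using 1 2 chart_inv_left[OF chart_inj[OF assms(2)]] assms(5) by (metis subsetD)
qed

lemma smooth_rep_compose:
  assumes c: "is_chart X n c" and d: "is_chart Y m d"
    and W: "openin X W" "W \<subseteq> fst c" and W': "openin Y W'" "W' \<subseteq> fst d"
    and F: "smooth_rep n m c d F W" "F ` W \<subseteq> W'" and G: "smooth_rep m l d e G W'"
  shows "smooth_rep n l c e (\<lambda>p. G (F p)) W"
  unfolding smooth_rep_def
proof (intro allI impI)
  fix k assume k: "k < l"
  have o: "openin (Euclidean_space n) (snd c ` W)" "openin (Euclidean_space m) (snd d ` W')"
    using chart_openness[OF c W(2)] chart_openness[OF d W'(2)] W(1) W'(1) by auto
  have "smooth_on n (snd c ` W) (\<lambda>x. snd e (G (chart_inv d (snd d (F (chart_inv c x))))) k)"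
    by (rule smooth_on_compose[OF o])
      (use F G k rep_compose_eq(2)[OF c d W(2) F(2) W'(2)] in \<open>auto simp: smooth_rep_def\<close>)
  then show "smooth_on n (snd c ` W) (\<lambda>x. snd e (G (F (chart_inv c x))) k)"
    by (rule smooth_on_cong[OF o(1), rotated]) (simp only: rep_compose_eq(1)[OF c d W(2) F(2) W'(2), where G = G])
qed

lemma jacobian_compose:
  assumes c: "is_chart X n c" and d: "is_chart Y m d"
    and W: "openin X W" "W \<subseteq> fst c" and W': "openin Y W'" "W' \<subseteq> fst d"
    and F: "smooth_rep n m c d F W" "F ` W \<subseteq> W'" and G: "smooth_rep m l d e G W'"
    and p: "p \<in> W" and "i < n" "k < l"
  shows "jacobian (\<lambda>p. G (F p)) c e p k i = (\<Sum>j<m. jacobian G d e (F p) k j * jacobian F c d p j i)"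
proof -
  have o: "openin (Euclidean_space n) (snd c ` W)" "openin (Euclidean_space m) (snd d ` W')"
    using chart_openness[OF c W(2)] chart_openness[OF d W'(2)] W(1) W'(1) by auto
  have px: "snd c p \<in> snd c ` W" "chart_inv c (snd c p) = p"
    using p W(2) chart_inv_left[OF chart_inj[OF c]] by auto
  have "jacobian (\<lambda>p. G (F p)) c e p k i =
      partial i (\<lambda>x. snd e (G (chart_inv d (snd d (F (chart_inv c x))))) k) (snd c p)"
    unfolding jacobian_def
    by (rule partial_cong[OF o(1) px(1) \<open>i < n\<close>]) (simp only: rep_compose_eq(1)[OF c d W(2) F(2) W'(2), where G = G])
  also have "\<dots> = (\<Sum>j<m. partial j (\<lambda>y. snd e (G (chart_inv d y)) k) (snd d (F (chart_inv c (snd c p)))) *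
      partial i (\<lambda>x. snd d (F (chart_inv c x)) j) (snd c p))"
    by (rule smooth_on_chain_rule[OF o, where F = "\<lambda>x. snd d (F (chart_inv c x))"])
      (use F G assms(11,12) px(1) rep_compose_eq(2)[OF c d W(2) F(2) W'(2)] in \<open>auto simp: smooth_rep_def\<close>)
  finally show ?thesis unfolding jacobian_def px(2) .
qed

text \<open>In matched charts, \<open>h\<close> is the identity map. This is a relation between charts, not an
  operation, because it leaves the values outside the domains open.\<close>

definition matched :: "('a \<Rightarrow> 'b) \<Rightarrow> 'a chart \<Rightarrow> 'b chart \<Rightarrow> bool" where
  "matched h c d \<longleftrightarrow> inj_on h (fst c) \<and> h ` fst c = fst d \<and> (\<forall>p\<in>fst c. snd d (h p) = snd c p)"

lemma matched_image: "matched h c d \<Longrightarrow> W \<subseteq> fst c \<Longrightarrow> snd d ` h ` W = snd c ` W"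
  by (auto simp: matched_def image_image intro!: image_cong)

lemma matched_inj:
  assumes "matched h c d" "inj_on (snd c) (fst c)"
  shows "inj_on (snd d) (fst d)"
proof (rule inj_onI)
  have d: "fst d = h ` fst c" and *: "\<And>p. p \<in> fst c \<Longrightarrow> snd d (h p) = snd c p"
    using assms(1) by (auto simp: matched_def)
  fix q q' assume q: "q \<in> fst d" "q' \<in> fst d" "snd d q = snd d q'"
  obtain p p' where p: "p \<in> fst c" "q = h p" "p' \<in> fst c" "q' = h p'"
    using q(1,2) unfolding d by auto
  then have "snd c p = snd c p'" using q(3) * by simp
  then show "q = q'" using p inj_onD[OF assms(2)] by auto
qed

lemma matched_chart_inv:
  assumes "matched h c d" "inj_on (snd c) (fst c)" "x \<in> snd c ` fst c"
  shows "h (chart_inv c x) = chart_inv d x"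
proof -
  obtain p where p: "p \<in> fst c" "x = snd c p" using assms(3) by auto
  then have "h p \<in> fst d" "snd d (h p) = x" using assms(1) by (auto simp: matched_def)
  then show ?thesis
    using chart_inv_left[OF matched_inj[OF assms(1,2)], of "h p"] chart_inv_left[OF assms(2) p(1)] p(2) by simp
qed

lemma matched_rep:
  assumes "matched h c d" "inj_on (snd c) (fst c)" "x \<in> snd c ` fst c"
  shows "snd d (h (chart_inv c x)) = x"
  using chart_inv_right[OF assms(3)] assms(1) by (simp add: matched_def)

lemma matched_smooth_rep:
  assumes "is_chart X n c" "matched h c d"
  shows "smooth_rep n n c d h (fst c)"
  unfolding smooth_rep_def
proof (intro allI impI)
  fix j assume "j < n"
  show "smooth_on n (snd c ` fst c) (\<lambda>x. snd d (h (chart_inv c x)) j)"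
    by (rule smooth_on_cong[OF chart_image_open[OF assms(1)] _ smooth_on_coordinate[of _ _ j]])
      (simp add: matched_rep[OF assms(2) chart_inj[OF assms(1)]])
qed

lemma matched_jacobian:
  assumes "is_chart X n c" "matched h c d" "p \<in> fst c" "i < n"
  shows "jacobian h c d p j i = (if i = j then 1 else 0)"
proof -
  have "jacobian h c d p j i = partial i (\<lambda>x. x j) (snd c p)"
    unfolding jacobian_def
    by (rule partial_cong[OF chart_image_open[OF assms(1)]])
      (use assms matched_rep[OF assms(2) chart_inj[OF assms(1)]] in auto)
  then show ?thesis by (simp add: partial_coordinate)
qed

lemma matched_id: "matched (\<lambda>p. p) c c"
  by (simp add: matched_def)

lemma matched_inverse:
  assumes "matched h c d" "\<And>p. p \<in> fst c \<Longrightarrow> g (h p) = p"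
  shows "matched g d c"
proof -
  have d: "fst d = h ` fst c" and *: "\<And>p. p \<in> fst c \<Longrightarrow> snd d (h p) = snd c p"
    using assms(1) by (auto simp: matched_def)
  have "inj_on g (fst d)" unfolding d by (rule inj_onI) (use assms(2) in auto)
  moreover have "g ` fst d = fst c" unfolding d image_image by (simp add: assms(2))
  moreover have "snd c (g q) = snd d q" if "q \<in> fst d" for q
  proof -
    obtain p where "p \<in> fst c" "q = h p" using \<open>q \<in> fst d\<close> unfolding d by (rule imageE)
    then show ?thesis using * assms(2) by simp
  qed
  ultimately show ?thesis by (simp add: matched_def)
qed

lemma matched_smooth_transition:
  assumes m: "matched h c c'" "matched h d d'" and inj: "inj_on h (fst c \<union> fst d)"
    and c: "inj_on (snd c) (fst c)" and o: "openin (Euclidean_space n) (snd c ` (fst c \<inter> fst d))"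
  shows "smooth_transition n c d \<longleftrightarrow> smooth_transition n c' d'"
proof -
  have "h ` (fst c \<inter> fst d) = fst c' \<inter> fst d'"
    using m inj_on_image_Int[OF inj, of "fst c" "fst d"] by (simp add: matched_def)
  then have s: "snd c' ` (fst c' \<inter> fst d') = snd c ` (fst c \<inter> fst d)"
    using matched_image[OF m(1), of "fst c \<inter> fst d"] by simp
  have "snd d (chart_inv c x) j = snd d' (chart_inv c' x) j" if x: "x \<in> snd c ` (fst c \<inter> fst d)" for x j
  proof -
    obtain p where p: "p \<in> fst c" "p \<in> fst d" "x = snd c p" using x by auto
    then have "chart_inv c x = p" using chart_inv_left[OF c] by simp
    moreover have "chart_inv c' x = h p"
      using matched_chart_inv[OF m(1) c, of x] p \<open>chart_inv c x = p\<close> by simp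
    ultimately show ?thesis using p m(2) unfolding matched_def by simp
  qed
  then have "smooth_on n (snd c ` (fst c \<inter> fst d)) (\<lambda>x. snd d (chart_inv c x) j) \<longleftrightarrow>
      smooth_on n (snd c ` (fst c \<inter> fst d)) (\<lambda>x. snd d' (chart_inv c' x) j)" for j
    using smooth_on_cong[OF o, of "\<lambda>x. snd d (chart_inv c x) j" "\<lambda>x. snd d' (chart_inv c' x) j"]
      smooth_on_cong[OF o, of "\<lambda>x. snd d' (chart_inv c' x) j" "\<lambda>x. snd d (chart_inv c x) j"] by auto
  then show ?thesis unfolding smooth_transition_def s by simp
qed

text \<open>Transitions between charts on one side have the same coordinate expression as those between the
  matched charts on the other side. Injectivity on the union of the domains makes the overlaps correspond.\<close>

lemma matched_compatible:
  assumes m: "matched h c c'" "matched h d d'" and inj: "inj_on h (fst c \<union> fst d)"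
    and i: "inj_on (snd c) (fst c)" "inj_on (snd d) (fst d)"
    and o: "openin (Euclidean_space n) (snd c ` (fst c \<inter> fst d))"
      "openin (Euclidean_space n) (snd d ` (fst c \<inter> fst d))"
  shows "compatible n c d \<longleftrightarrow> compatible n c' d'"
  unfolding compatible_def
  using matched_smooth_transition[OF m inj i(1) o(1)]
    matched_smooth_transition[OF m(2,1) _ i(2)] inj o by (simp add: Un_commute Int_commute)

section \<open>Atlases and manifolds\<close>

definition compatible_atlas :: "'a topology \<Rightarrow> nat \<Rightarrow> 'a chart set \<Rightarrow> bool" where
  "compatible_atlas X n A \<longleftrightarrow> (\<forall>c\<in>A. is_chart X n c) \<and> (\<forall>c\<in>A. \<forall>d\<in>A. compatible n c d) \<and>
     (\<Union>c\<in>A. fst c) = topspace X"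

text \<open>Around each point of the overlap, factor the transition through a chart of the atlas.\<close>

lemma compatible_trans:
  assumes A: "compatible_atlas X n A" and c: "is_chart X n c" "\<And>a. a \<in> A \<Longrightarrow> compatible n c a"
    and d: "is_chart X n d" "\<And>a. a \<in> A \<Longrightarrow> compatible n d a"
  shows "compatible n c d"
proof -
  have "smooth_rep n n c d (\<lambda>p. p) (fst c \<inter> fst d)"
    if c: "is_chart X n c" "\<And>a. a \<in> A \<Longrightarrow> compatible n c a"
      and d: "is_chart X n d" "\<And>a. a \<in> A \<Longrightarrow> compatible n d a" for c d
  proof (rule smooth_rep_local[OF c(1)])
    fix p assume p: "p \<in> fst c \<inter> fst d"
    then have "p \<in> topspace X" using chart_in_topspace[OF c(1)] by simp
    then have "p \<in> (\<Union>a\<in>A. fst a)" using A unfolding compatible_atlas_def by simp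
    then obtain a where a: "a \<in> A" "p \<in> fst a" by auto
    then have "is_chart X n a" using A unfolding compatible_atlas_def by simp
    note a = a this
    let ?W = "fst c \<inter> fst d \<inter> fst a"
    have W: "openin X ?W" using chart_open c(1) d(1) a(3) by blast
    have 1: "smooth_rep n n c a (\<lambda>p. p) ?W"
      using c(2)[OF a(1)] unfolding compatible_iff_smooth_rep by (auto intro: smooth_rep_subset)
    have 2: "smooth_rep n n a d (\<lambda>p. p) ?W"
      using d(2)[OF a(1)] unfolding compatible_iff_smooth_rep by (auto intro: smooth_rep_subset)
    have "smooth_rep n n c d (\<lambda>p. p) ?W"
      by (rule smooth_rep_compose[OF c(1) a(3) W _ W _ 1 _ 2]) auto
    then show "\<exists>W'. openin X W' \<and> p \<in> W' \<and> W' \<subseteq> fst c \<and> smooth_rep n n c d (\<lambda>p. p) W'"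
      by (intro exI[of _ ?W]) (use W p a in auto)
  qed simp
  from this[OF c d] this[OF d c] show ?thesis unfolding compatible_iff_smooth_rep by simp
qed

text \<open>A smooth manifold, except that its topology may fail to be Hausdorff or second countable. The
  total spaces of the bundles below are used in this generality.\<close>

definition atlas_manifold :: "'a mfd \<Rightarrow> bool" where
  "atlas_manifold M \<longleftrightarrow> compatible_atlas (mfd_top M) (mfd_dim M) (mfd_charts M) \<and>
     (\<forall>c. is_chart (mfd_top M) (mfd_dim M) c \<longrightarrow> (\<forall>a\<in>mfd_charts M. compatible (mfd_dim M) c a) \<longrightarrow> c \<in> mfd_charts M)"

lemma smooth_manifold_iff:
  "smooth_manifold M \<longleftrightarrow> Hausdorff_space (mfd_top M) \<and> second_countable (mfd_top M) \<and> atlas_manifold M"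
proof -
  have *: "A = {c. P c \<and> (\<forall>a\<in>A. Q c a)} \<longleftrightarrow>
      ((\<forall>c\<in>A. P c) \<and> (\<forall>c\<in>A. \<forall>d\<in>A. Q c d)) \<and> (\<forall>c. P c \<longrightarrow> (\<forall>a\<in>A. Q c a) \<longrightarrow> c \<in> A)"
    for A :: "'a chart set" and P Q by blast
  show ?thesis
    unfolding smooth_manifold_def atlas_manifold_def compatible_atlas_def
      *[of "mfd_charts M" "is_chart (mfd_top M) (mfd_dim M)" "compatible (mfd_dim M)"]
    by (simp only: conj_ac)
qed

lemma smooth_manifold_imp_atlas_manifold: "smooth_manifold M \<Longrightarrow> atlas_manifold M"
  unfolding smooth_manifold_iff by (elim conjE)

lemma mfd_atlas: "atlas_manifold M \<Longrightarrow> compatible_atlas (mfd_top M) (mfd_dim M) (mfd_charts M)"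
  unfolding atlas_manifold_def by (rule conjunct1)

lemma mfd_is_chart: "atlas_manifold M \<Longrightarrow> c \<in> mfd_charts M \<Longrightarrow> is_chart (mfd_top M) (mfd_dim M) c"
  by (rule bspec[OF conjunct1[OF mfd_atlas[unfolded compatible_atlas_def]]])

lemma mfd_compatible:
  assumes "atlas_manifold M" "c \<in> mfd_charts M" "d \<in> mfd_charts M"
  shows "compatible (mfd_dim M) c d"
proof -
  have "\<forall>d\<in>mfd_charts M. compatible (mfd_dim M) c d"
    using conjunct1[OF conjunct2[OF mfd_atlas[OF assms(1), unfolded compatible_atlas_def]]] assms(2) by (rule bspec)
  then show ?thesis using assms(3) by (rule bspec)
qed

lemma mfd_cover: "atlas_manifold M \<Longrightarrow> (\<Union>c\<in>mfd_charts M. fst c) = carrier M"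
  by (rule conjunct2[OF conjunct2[OF mfd_atlas[unfolded compatible_atlas_def]]])

lemma mfd_maximal:
  assumes "atlas_manifold M" "is_chart (mfd_top M) (mfd_dim M) c"
    "\<And>a. a \<in> mfd_charts M \<Longrightarrow> compatible (mfd_dim M) c a"
  shows "c \<in> mfd_charts M"
proof -
  have "\<forall>a\<in>mfd_charts M. compatible (mfd_dim M) c a" by (rule ballI) (rule assms(3))
  then show ?thesis using assms(1,2) unfolding atlas_manifold_def by (elim conjE allE[of _ c] impE)
qed

lemma charts_at_exists:
  assumes "atlas_manifold M" "p \<in> carrier M"
  obtains c where "c \<in> charts_at M p"
proof -
  have "p \<in> (\<Union>c\<in>mfd_charts M. fst c)" using assms(2) by (simp only: mfd_cover[OF assms(1)])
  then obtain c where "c \<in> mfd_charts M" "p \<in> fst c" by (rule UN_E)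
  then show thesis by (intro that) (simp add: charts_at_def)
qed

lemma mfd_chart_in_carrier:
  assumes "atlas_manifold M" "c \<in> mfd_charts M" "p \<in> fst c"
  shows "p \<in> carrier M"
  unfolding mfd_cover[OF assms(1), symmetric] using assms(2,3) by (rule UN_I)

lemma mfd_transition_smooth:
  assumes "atlas_manifold M" "c \<in> mfd_charts M" "d \<in> mfd_charts M"
  shows "smooth_rep (mfd_dim M) (mfd_dim M) c d (\<lambda>p. p) (fst c \<inter> fst d)"
  using mfd_compatible[OF assms] unfolding compatible_iff_smooth_rep by (rule conjunct1)

lemma smooth_rep_restrict:
  assumes c: "is_chart X n c" and c': "fst c' \<subseteq> fst c" "snd c' = snd c"
    and W: "openin X W" "W \<subseteq> fst c'" and F: "smooth_rep n m c d F W"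
  shows "smooth_rep n m c' d F W"
  unfolding smooth_rep_def
proof (intro allI impI)
  fix j assume j: "j < m"
  have o: "openin (Euclidean_space n) (snd c ` W)"
    by (rule iffD1[OF chart_openness[OF c] W(1)]) (use W(2) c'(1) in auto)
  have "smooth_on n (snd c ` W) (\<lambda>x. snd d (F (chart_inv c x)) j)"
    using F j unfolding smooth_rep_def by simp
  then have "smooth_on n (snd c ` W) (\<lambda>x. snd d (F (chart_inv c' x)) j)"
  proof (rule smooth_on_cong[OF o, rotated])
    fix x assume "x \<in> snd c ` W"
    then have "x \<in> snd c' ` fst c'" using W(2) c'(2) by auto
    then show "snd d (F (chart_inv c x)) j = snd d (F (chart_inv c' x)) j"
      using chart_inv_restrict[OF chart_inj[OF c] c'(1)] c'(2) by simp
  qed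
  then show "smooth_on n (snd c' ` W) (\<lambda>x. snd d (F (chart_inv c' x)) j)" by (simp only: c'(2))
qed

text \<open>The transitions of a restricted chart are restrictions of transitions, so maximality of the atlas
  applies.\<close>

lemma restrict_chart:
  assumes M: "atlas_manifold M" and c: "c \<in> mfd_charts M" and U: "openin (mfd_top M) U"
  shows "(fst c \<inter> U, snd c) \<in> mfd_charts M"
proof (rule mfd_maximal[OF M])
  define c' where "c' = (fst c \<inter> U, snd c)"
  have c': "fst c' = fst c \<inter> U" "snd c' = snd c" by (simp_all add: c'_def)
  note ic = mfd_is_chart[OF M c]
  have oc': "openin (mfd_top M) (fst c')" unfolding c' by (intro openin_Int chart_open[OF ic] U)
  show "is_chart (mfd_top M) (mfd_dim M) (fst c \<inter> U, snd c)"
    unfolding c'_def[symmetric] is_chart_iff c'(2)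
  proof (intro conjI allI impI oc')
    show "inj_on (snd c) (fst c')" using chart_inj[OF ic] by (rule inj_on_subset) (simp add: c')
    show "snd c ` fst c' \<subseteq> rspace (mfd_dim M)" using chart_image_subset[OF ic] c' by auto
    show "openin (mfd_top M) W = openin (Euclidean_space (mfd_dim M)) (snd c ` W)" if "W \<subseteq> fst c'" for W
      by (rule chart_openness[OF ic]) (use that c' in auto)
  qed
  fix a assume a: "a \<in> mfd_charts M"
  have W: "openin (mfd_top M) (fst c' \<inter> fst a)"
    by (intro openin_Int oc' chart_open[OF mfd_is_chart[OF M a]])
  have "smooth_rep (mfd_dim M) (mfd_dim M) c a (\<lambda>p. p) (fst c' \<inter> fst a)"
    by (rule smooth_rep_subset[OF mfd_transition_smooth[OF M c a]]) (auto simp: c')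
  then have 1: "smooth_rep (mfd_dim M) (mfd_dim M) c' a (\<lambda>p. p) (fst c' \<inter> fst a)"
    by (rule smooth_rep_restrict[OF ic _ _ W, rotated -1]) (auto simp: c')
  have "smooth_rep (mfd_dim M) (mfd_dim M) a c (\<lambda>p. p) (fst a \<inter> fst c')"
    by (rule smooth_rep_subset[OF mfd_transition_smooth[OF M a c]]) (auto simp: c')
  then have 2: "smooth_rep (mfd_dim M) (mfd_dim M) a c' (\<lambda>p. p) (fst a \<inter> fst c')"
    unfolding smooth_rep_def c'(2) .
  show "compatible (mfd_dim M) (fst c \<inter> U, snd c) a"
    unfolding c'_def[symmetric] compatible_iff_smooth_rep using 1 2 by (rule conjI)
qed

lemma mfd_generated_simps [simp]:
  "mfd_top (mfd_generated X n A) = X" "mfd_dim (mfd_generated X n A) = n"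
  by (simp_all add: mfd_generated_def)

lemma in_mfd_generated_charts:
  "c \<in> mfd_charts (mfd_generated X n A) \<longleftrightarrow> is_chart X n c \<and> (\<forall>a\<in>A. compatible n c a)"
  by (simp add: mfd_generated_def)

lemma mfd_generated_superset:
  "compatible_atlas X n A \<Longrightarrow> A \<subseteq> mfd_charts (mfd_generated X n A)"
  by (auto simp: in_mfd_generated_charts compatible_atlas_def)

lemma mfd_generated_atlas_manifold:
  assumes "compatible_atlas X n A"
  shows "atlas_manifold (mfd_generated X n A)"
proof -
  have cov: "(\<Union>c\<in>mfd_charts (mfd_generated X n A). fst c) = topspace X"
  proof
    show "(\<Union>c\<in>mfd_charts (mfd_generated X n A). fst c) \<subseteq> topspace X"
      using chart_in_topspace by (fastforce simp: in_mfd_generated_charts)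
    show "topspace X \<subseteq> (\<Union>c\<in>mfd_charts (mfd_generated X n A). fst c)"
      using mfd_generated_superset[OF assms] assms by (force simp: compatible_atlas_def)
  qed
  show ?thesis
    unfolding atlas_manifold_def compatible_atlas_def mfd_generated_simps cov
    using compatible_trans[OF assms] mfd_generated_superset[OF assms]
    by (auto simp: in_mfd_generated_charts)
qed

lemma smooth_rep_preimage_open:
  assumes c: "is_chart X n c" and d: "is_chart Y m d" and W: "openin X W" "W \<subseteq> fst c"
    and F: "F ` W \<subseteq> fst d" "smooth_rep n m c d F W" and V: "openin Y V"
  shows "openin X {p \<in> W. F p \<in> V}"
proof -
  have o: "openin (Euclidean_space n) (snd c ` W)" using chart_openness[OF c W(2)] W(1) by simp
  have "openin (Euclidean_space m) (snd d ` (V \<inter> fst d))"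
    using chart_openness[OF d, of "V \<inter> fst d"] V chart_open[OF d] by auto
  then have "openin (Euclidean_space n)
      {x \<in> snd c ` W. snd d (F (chart_inv c x)) \<in> snd d ` (V \<inter> fst d)}"
  proof (rule smooth_preimage_open[OF o])
    show "smooth_on n (snd c ` W) (\<lambda>x. snd d (F (chart_inv c x)) j)" if "j < m" for j
      using F(2) that by (simp add: smooth_rep_def)
    show "(\<lambda>x. snd d (F (chart_inv c x))) ` snd c ` W \<subseteq> rspace m"
      using rep_compose_eq(2)[OF c d W(2) F(1) subset_refl] chart_image_subset[OF d] by blast
  qed
  moreover have "{x \<in> snd c ` W. snd d (F (chart_inv c x)) \<in> snd d ` (V \<inter> fst d)} = snd c ` {p \<in> W. F p \<in> V}"
  proof -
    have "snd d (F (chart_inv c (snd c p))) \<in> snd d ` (V \<inter> fst d) \<longleftrightarrow> F p \<in> V" if "p \<in> W" for p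
    proof -
      have "p \<in> fst c" "F p \<in> fst d" using that W(2) F(1) by auto
      then show ?thesis using chart_inv_left[OF chart_inj[OF c]] chart_inj[OF d]
        by (auto simp: inj_on_def)
    qed
    then show ?thesis by auto
  qed
  ultimately show ?thesis using chart_openness[OF c, of "{p \<in> W. F p \<in> V}"] W(2) by auto
qed

text \<open>One good pair of charts around each point is enough: any other pair differs from it by
  transitions, and a smooth representative is continuous, hence so is the map.\<close>

lemma smooth_mapI:
  assumes M: "atlas_manifold M" and N: "atlas_manifold N"
    and loc: "\<And>p. p \<in> carrier M \<Longrightarrow> \<exists>c\<in>charts_at M p. \<exists>d\<in>mfd_charts N.
      F ` fst c \<subseteq> fst d \<and> smooth_rep (mfd_dim M) (mfd_dim N) c d F (fst c)"
  shows "smooth_map M N F"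
proof -
  have loc': "\<exists>c d. c \<in> mfd_charts M \<and> p \<in> fst c \<and> d \<in> mfd_charts N \<and> F ` fst c \<subseteq> fst d \<and>
      smooth_rep (mfd_dim M) (mfd_dim N) c d F (fst c)" if "p \<in> carrier M" for p
    using loc[OF that] unfolding charts_at_def by (elim bexE conjE) (intro exI conjI, simp_all)
  have cont: "continuous_map (mfd_top M) (mfd_top N) F"
    unfolding continuous_map_def
  proof (intro conjI allI impI)
    show "F \<in> carrier M \<rightarrow> carrier N"
    proof
      fix p assume "p \<in> carrier M"
      from loc'[OF this] obtain c d where d: "c \<in> mfd_charts M" "p \<in> fst c" "d \<in> mfd_charts N"
        "F ` fst c \<subseteq> fst d" "smooth_rep (mfd_dim M) (mfd_dim N) c d F (fst c)"
        by (elim exE conjE)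
      show "F p \<in> carrier N" by (rule mfd_chart_in_carrier[OF N d(3)]) (use d in auto)
    qed
    fix V assume V: "openin (mfd_top N) V"
    show "openin (mfd_top M) {p \<in> carrier M. F p \<in> V}"
    proof (subst openin_subopen, intro ballI)
      fix p assume p: "p \<in> {p \<in> carrier M. F p \<in> V}"
      then have "p \<in> carrier M" by simp
      from loc'[OF this] obtain c d where cd: "c \<in> mfd_charts M" "p \<in> fst c" "d \<in> mfd_charts N"
        "F ` fst c \<subseteq> fst d" "smooth_rep (mfd_dim M) (mfd_dim N) c d F (fst c)" by (elim exE conjE)
      have "openin (mfd_top M) {p \<in> fst c. F p \<in> V}"
        using smooth_rep_preimage_open[OF mfd_is_chart[OF M cd(1)] mfd_is_chart[OF N cd(3)]
          chart_open[OF mfd_is_chart[OF M cd(1)]] subset_refl cd(4,5) V] .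
      then show "\<exists>T. openin (mfd_top M) T \<and> p \<in> T \<and> T \<subseteq> {p \<in> carrier M. F p \<in> V}"
        using p cd mfd_chart_in_carrier[OF M cd(1)] by (intro exI[of _ "{p \<in> fst c. F p \<in> V}"]) auto
    qed
  qed
  have "smooth_rep (mfd_dim M) (mfd_dim N) c d F {p \<in> fst c. F p \<in> fst d}"
    if c: "c \<in> mfd_charts M" and d: "d \<in> mfd_charts N" for c d
  proof (rule smooth_rep_local[OF mfd_is_chart[OF M c]])
    fix p assume p: "p \<in> {p \<in> fst c. F p \<in> fst d}"
    then have "p \<in> carrier M" using mfd_chart_in_carrier[OF M c] by simp
    from loc'[OF this] obtain c' d' where cd: "c' \<in> mfd_charts M" "p \<in> fst c'" "d' \<in> mfd_charts N"
      "F ` fst c' \<subseteq> fst d'" "smooth_rep (mfd_dim M) (mfd_dim N) c' d' F (fst c')" by (elim exE conjE)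
    note ch = mfd_is_chart[OF M c] mfd_is_chart[OF N d] mfd_is_chart[OF M cd(1)] mfd_is_chart[OF N cd(3)]
    define W where "W = fst c \<inter> {p \<in> fst c'. F p \<in> fst d \<inter> fst d'}"
    have V: "openin (mfd_top N) (fst d \<inter> fst d')" by (intro openin_Int chart_open[OF ch(2)] chart_open[OF ch(4)])
    have W: "openin (mfd_top M) W" unfolding W_def
      by (intro openin_Int chart_open[OF ch(1)]
          smooth_rep_preimage_open[OF ch(3,4) chart_open[OF ch(3)] subset_refl cd(4,5) V])
    have 1: "smooth_rep (mfd_dim M) (mfd_dim M) c c' (\<lambda>p. p) W"
      by (rule smooth_rep_subset[OF mfd_transition_smooth[OF M c cd(1)]]) (auto simp: W_def)
    have 2: "smooth_rep (mfd_dim M) (mfd_dim N) c' d' F W"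
      by (rule smooth_rep_subset[OF cd(5)]) (auto simp: W_def)
    have 3: "smooth_rep (mfd_dim N) (mfd_dim N) d' d (\<lambda>p. p) (fst d \<inter> fst d')"
      by (rule smooth_rep_subset[OF mfd_transition_smooth[OF N cd(3) d]]) auto
    have 4: "smooth_rep (mfd_dim M) (mfd_dim N) c d' (\<lambda>p. F p) W"
      by (rule smooth_rep_compose[OF ch(1,3) W _ W _ 1 _ 2]) (auto simp: W_def)
    have "smooth_rep (mfd_dim M) (mfd_dim N) c d (\<lambda>p. F p) W"
      by (rule smooth_rep_compose[OF ch(1,4) W _ V _ 4 _ 3]) (auto simp: W_def)
    then show "\<exists>W'. openin (mfd_top M) W' \<and> p \<in> W' \<and> W' \<subseteq> fst c \<and>
        smooth_rep (mfd_dim M) (mfd_dim N) c d F W'"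
      by (intro exI[of _ W]) (use W p cd(2,4) in \<open>auto simp: W_def\<close>)
  qed auto
  then show ?thesis using cont by (simp add: smooth_map_iff_smooth_rep)
qed

lemma smooth_map_smooth_rep:
  "smooth_map M N F \<Longrightarrow> c \<in> mfd_charts M \<Longrightarrow> d \<in> mfd_charts N \<Longrightarrow>
    smooth_rep (mfd_dim M) (mfd_dim N) c d F {p \<in> fst c. F p \<in> fst d}"
  by (simp add: smooth_map_iff_smooth_rep)

lemma smooth_map_chart_open:
  assumes "smooth_map M N F" "atlas_manifold M" "atlas_manifold N" "c \<in> mfd_charts M" "d \<in> mfd_charts N"
  shows "openin (mfd_top M) {p \<in> fst c. F p \<in> fst d}"
proof -
  have "openin (mfd_top M) {p \<in> carrier M. F p \<in> fst d}"
    using assms chart_open[OF mfd_is_chart[OF assms(3,5)]]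
    by (auto simp: smooth_map_def continuous_map_def)
  then have "openin (mfd_top M) (fst c \<inter> {p \<in> carrier M. F p \<in> fst d})"
    using chart_open[OF mfd_is_chart[OF assms(2,4)]] by blast
  moreover have "fst c \<inter> {p \<in> carrier M. F p \<in> fst d} = {p \<in> fst c. F p \<in> fst d}"
    using mfd_chart_in_carrier[OF assms(2,4)] by blast
  ultimately show ?thesis by simp
qed

lemma smooth_map_in_carrier: "smooth_map M N F \<Longrightarrow> p \<in> carrier M \<Longrightarrow> F p \<in> carrier N"
  unfolding smooth_map_def continuous_map_def by auto

text \<open>In matched charts both \<open>h\<close> and its inverse are represented by the identity.\<close>

lemma diffeomorphismI:
  assumes M: "atlas_manifold M" and N: "atlas_manifold N" and dim: "mfd_dim N = mfd_dim M"
    and bij: "bij_betw h (carrier M) (carrier N)"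
    and loc: "\<And>p. p \<in> carrier M \<Longrightarrow> \<exists>c\<in>charts_at M p. \<exists>d\<in>mfd_charts N. matched h c d"
  shows "diffeomorphism M N h"
proof -
  let ?g = "inv_into (carrier M) h"
  have gh: "?g (h p) = p" if "p \<in> carrier M" for p
    using that bij by (simp add: bij_betw_def)
  have 1: "smooth_map M N h"
  proof (rule smooth_mapI[OF M N])
    fix p assume "p \<in> carrier M"
    from loc[OF this] obtain c d where cd: "c \<in> charts_at M p" "d \<in> mfd_charts N" "matched h c d" by auto
    then have "c \<in> mfd_charts M" by (simp add: charts_at_def)
    then have "smooth_rep (mfd_dim M) (mfd_dim N) c d h (fst c)"
      using matched_smooth_rep[OF mfd_is_chart[OF M] cd(3)] dim by simp
    then show "\<exists>c\<in>charts_at M p. \<exists>d\<in>mfd_charts N.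
      h ` fst c \<subseteq> fst d \<and> smooth_rep (mfd_dim M) (mfd_dim N) c d h (fst c)"
      using cd unfolding matched_def by (intro bexI[of _ c] bexI[of _ d]) auto
  qed
  have 2: "smooth_map N M ?g"
  proof (rule smooth_mapI[OF N M])
    fix q assume "q \<in> carrier N"
    then obtain p where p: "p \<in> carrier M" "q = h p" using bij by (auto simp: bij_betw_def)
    from loc[OF p(1)] obtain c d where cd: "c \<in> charts_at M p" "d \<in> mfd_charts N" "matched h c d" by auto
    then have c: "c \<in> mfd_charts M" "p \<in> fst c" by (simp_all add: charts_at_def)
    have m: "matched ?g d c"
      by (rule matched_inverse[OF cd(3)]) (use gh mfd_chart_in_carrier[OF M c(1)] in auto)
    then have "smooth_rep (mfd_dim N) (mfd_dim M) d c ?g (fst d)"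
      using matched_smooth_rep[OF mfd_is_chart[OF N cd(2)] m] dim by simp
    moreover have "d \<in> charts_at N q"
      using cd c p unfolding matched_def charts_at_def by auto
    ultimately show "\<exists>c\<in>charts_at N q. \<exists>d\<in>mfd_charts M.
      ?g ` fst c \<subseteq> fst d \<and> smooth_rep (mfd_dim N) (mfd_dim M) c d ?g (fst c)"
      using c(1) m unfolding matched_def by (intro bexI[of _ d] bexI[of _ c]) auto
  qed
  show ?thesis using bij 1 2 by (simp add: diffeomorphism_def)
qed

section \<open>Tangent spaces\<close>

lemma charts_atD: "c \<in> charts_at M p \<Longrightarrow> c \<in> mfd_charts M" "c \<in> charts_at M p \<Longrightarrow> p \<in> fst c"
  by (simp_all add: charts_at_def)

lemma charts_atI: "c \<in> mfd_charts M \<Longrightarrow> p \<in> fst c \<Longrightarrow> c \<in> charts_at M p"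
  by (simp add: charts_at_def)

lemma jacobian_self:
  assumes "atlas_manifold M" "c \<in> charts_at M p" "i < mfd_dim M"
  shows "jacobian (\<lambda>q. q) c c p j i = (if i = j then 1 else 0)"
  using matched_jacobian[OF mfd_is_chart[OF assms(1) charts_atD(1)[OF assms(2)]] matched_id charts_atD(2)[OF assms(2)] assms(3)] .

text \<open>The transformation laws of Jacobians under a change of the chart in the target and in the source.
  They are what makes tangent vectors and tangent maps independent of charts.\<close>

lemma jacobian_target:
  assumes M: "atlas_manifold M" and N: "atlas_manifold N" and F: "smooth_map M N F"
    and c: "c \<in> charts_at M p" and d: "d \<in> charts_at N (F p)" "d' \<in> charts_at N (F p)"
    and ik: "i < mfd_dim M" "k < mfd_dim N"
  shows "jacobian F c d' p k i = (\<Sum>j<mfd_dim N. jacobian (\<lambda>q. q) d d' (F p) k j * jacobian F c d p j i)"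
proof -
  note ch = mfd_is_chart[OF M charts_atD(1)[OF c]] mfd_is_chart[OF N charts_atD(1)[OF d(1)]]
  let ?W = "{q \<in> fst c. F q \<in> fst d} \<inter> {q \<in> fst c. F q \<in> fst d'}"
  have W: "openin (mfd_top M) ?W"
    by (intro openin_Int smooth_map_chart_open[OF F M N] charts_atD[OF c] charts_atD[OF d(1)] charts_atD[OF d(2)])
  have W': "openin (mfd_top N) (fst d \<inter> fst d')"
    by (intro openin_Int chart_open[OF mfd_is_chart[OF N]] charts_atD[OF d(1)] charts_atD[OF d(2)])
  have 1: "smooth_rep (mfd_dim M) (mfd_dim N) c d F ?W"
    by (rule smooth_rep_subset[OF smooth_map_smooth_rep[OF F charts_atD(1)[OF c] charts_atD(1)[OF d(1)]]]) simp
  have 2: "smooth_rep (mfd_dim N) (mfd_dim N) d d' (\<lambda>q. q) (fst d \<inter> fst d')"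
    by (rule mfd_transition_smooth[OF N charts_atD(1)[OF d(1)] charts_atD(1)[OF d(2)]])
  show ?thesis
    by (rule jacobian_compose[OF ch W _ W' _ 1 _ 2 _ ik])
      (use charts_atD(2)[OF c] charts_atD(2)[OF d(1)] charts_atD(2)[OF d(2)] in auto)
qed

lemma jacobian_source:
  assumes M: "atlas_manifold M" and N: "atlas_manifold N" and F: "smooth_map M N F"
    and c: "c \<in> charts_at M p" "c' \<in> charts_at M p" and d: "d \<in> charts_at N (F p)"
    and ik: "i < mfd_dim M" "k < mfd_dim N"
  shows "jacobian F c' d p k i = (\<Sum>j<mfd_dim M. jacobian F c d p k j * jacobian (\<lambda>q. q) c' c p j i)"
proof -
  note ch = mfd_is_chart[OF M charts_atD(1)[OF c(2)]] mfd_is_chart[OF M charts_atD(1)[OF c(1)]]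
  let ?W = "fst c' \<inter> {q \<in> fst c. F q \<in> fst d}"
  have W: "openin (mfd_top M) ?W"
    by (intro openin_Int smooth_map_chart_open[OF F M N] charts_atD[OF c(1)] charts_atD[OF d] chart_open[OF ch(1)])
  have 1: "smooth_rep (mfd_dim M) (mfd_dim M) c' c (\<lambda>q. q) ?W"
    by (rule smooth_rep_subset[OF mfd_transition_smooth[OF M charts_atD(1)[OF c(2)] charts_atD(1)[OF c(1)]]]) auto
  have 2: "smooth_rep (mfd_dim M) (mfd_dim N) c d F ?W"
    by (rule smooth_rep_subset[OF smooth_map_smooth_rep[OF F charts_atD(1)[OF c(1)] charts_atD(1)[OF d]]]) simp
  show ?thesis
    by (rule jacobian_compose[OF ch W _ W _ 1 _ 2 _ ik])
      (use charts_atD(2)[OF c(1)] charts_atD(2)[OF c(2)] charts_atD(2)[OF d] in \<open>auto\<close>)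
qed

lemma smooth_map_id: "atlas_manifold M \<Longrightarrow> smooth_map M M (\<lambda>q. q)"
  unfolding smooth_map_iff_smooth_rep
  using mfd_transition_smooth[of M] by (simp add: Int_def del: split_paired_All)

lemma jacobian_cocycle:
  assumes "atlas_manifold M" "c \<in> charts_at M p" "d \<in> charts_at M p" "e \<in> charts_at M p"
    "i < mfd_dim M" "k < mfd_dim M"
  shows "jacobian (\<lambda>q. q) c e p k i = (\<Sum>j<mfd_dim M. jacobian (\<lambda>q. q) d e p k j * jacobian (\<lambda>q. q) c d p j i)"
  by (rule jacobian_target[OF assms(1) assms(1) smooth_map_id[OF assms(1)] assms(2-6)])

text \<open>The tangent vector at \<open>p\<close> that has coordinates \<open>a\<close> in the chart
  \<open>c\<close>.\<close>

definition chart_vector :: "'a mfd \<Rightarrow> 'a chart \<Rightarrow> 'a \<Rightarrow> (nat \<Rightarrow> real) \<Rightarrow> 'a tvec" where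
  "chart_vector M c p a = (\<lambda>d j. if d \<in> charts_at M p \<and> j < mfd_dim M
     then \<Sum>i<mfd_dim M. jacobian (\<lambda>q. q) c d p j i * a i else 0)"

lemma tangent_spaceD:
  assumes "v \<in> tangent_space M p" "c \<in> charts_at M p" "d \<in> charts_at M p" "j < mfd_dim M"
  shows "v d j = (\<Sum>i<mfd_dim M. jacobian (\<lambda>q. q) c d p j i * v c i)"
  using assms unfolding tangent_space_def by blast

lemma tangent_space_outside:
  "v \<in> tangent_space M p \<Longrightarrow> c \<notin> charts_at M p \<or> j \<ge> mfd_dim M \<Longrightarrow> v c j = 0"
  unfolding tangent_space_def by blast

lemma tangent_space_eqI:
  assumes "u \<in> tangent_space M p" "v \<in> tangent_space M p" "c \<in> charts_at M p"
    "\<And>i. i < mfd_dim M \<Longrightarrow> u c i = v c i"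
  shows "u = v"
proof (intro ext)
  fix d j
  show "u d j = v d j"
  proof (cases "d \<in> charts_at M p \<and> j < mfd_dim M")
    case True
    then show ?thesis
      using tangent_spaceD[OF assms(1,3), of d j] tangent_spaceD[OF assms(2,3), of d j] assms(4) by simp
  next
    case False
    then show ?thesis using assms(1,2)[THEN tangent_space_outside, of d j] by auto
  qed
qed

text \<open>The transformation law between two charts is the cocycle property of Jacobians.\<close>

lemma chart_vector_in_tangent_space:
  assumes M: "atlas_manifold M" and c: "c \<in> charts_at M p"
  shows "chart_vector M c p a \<in> tangent_space M p"
  unfolding tangent_space_def mem_Collect_eq
proof (intro conjI ballI allI impI)
  fix d e j assume d: "d \<in> charts_at M p" and e: "e \<in> charts_at M p" and j: "j < mfd_dim M"
  have "(\<Sum>i<mfd_dim M. jacobian (\<lambda>q. q) d e p j i * (\<Sum>k<mfd_dim M. jacobian (\<lambda>q. q) c d p i k * a k))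
      = (\<Sum>k<mfd_dim M. (\<Sum>i<mfd_dim M. jacobian (\<lambda>q. q) d e p j i * jacobian (\<lambda>q. q) c d p i k) * a k)"
    unfolding sum_distrib_left sum_distrib_right by (subst sum.swap) (simp add: mult.assoc)
  also have "\<dots> = (\<Sum>k<mfd_dim M. jacobian (\<lambda>q. q) c e p j k * a k)"
    by (intro sum.cong refl) (simp add: jacobian_cocycle[OF M c d e _ j])
  finally show "chart_vector M c p a e j = (\<Sum>i<mfd_dim M. jacobian (\<lambda>q. q) d e p j i * chart_vector M c p a d i)"
    using d e j by (simp add: chart_vector_def)
qed (auto simp: chart_vector_def)

lemma chart_vector_coordinate:
  assumes "atlas_manifold M" "c \<in> charts_at M p" "i < mfd_dim M"
  shows "chart_vector M c p a c i = a i"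
proof -
  have "chart_vector M c p a c i = (\<Sum>k<mfd_dim M. jacobian (\<lambda>q. q) c c p i k * a k)"
    using assms by (simp add: chart_vector_def)
  also have "\<dots> = (\<Sum>k<mfd_dim M. if k = i then a k else 0)"
    by (intro sum.cong refl) (simp add: jacobian_self[OF assms(1,2)])
  finally show ?thesis using assms(3) by simp
qed

lemma coord_vector_eq_chart_vector:
  assumes "i < mfd_dim M"
  shows "coord_vector M c p i = chart_vector M c p (\<lambda>k. if k = i then 1 else 0)"
proof (intro ext)
  fix d j
  have "(\<Sum>k<mfd_dim M. jacobian (\<lambda>q. q) c d p j k * (if k = i then 1 else 0)) =
      (\<Sum>k<mfd_dim M. if k = i then jacobian (\<lambda>q. q) c d p j i else 0)"
    by (intro sum.cong) auto
  then show "coord_vector M c p i d j = chart_vector M c p (\<lambda>k. if k = i then 1 else 0) d j"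
    using assms by (simp add: coord_vector_def chart_vector_def)
qed

lemma coord_vector_in_tangent_space:
  "atlas_manifold M \<Longrightarrow> c \<in> charts_at M p \<Longrightarrow> i < mfd_dim M \<Longrightarrow> coord_vector M c p i \<in> tangent_space M p"
  by (simp add: coord_vector_eq_chart_vector chart_vector_in_tangent_space)

lemma coord_vector_coordinate:
  "atlas_manifold M \<Longrightarrow> c \<in> charts_at M p \<Longrightarrow> i < mfd_dim M \<Longrightarrow> j < mfd_dim M \<Longrightarrow>
    coord_vector M c p i c j = (if j = i then 1 else 0)"
  by (simp add: coord_vector_eq_chart_vector chart_vector_coordinate)

lemma tangent_space_lincomb:
  assumes "u \<in> tangent_space M p" "v \<in> tangent_space M p"
  shows "(\<lambda>c i. a * u c i + b * v c i) \<in> tangent_space M p"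
  unfolding tangent_space_def mem_Collect_eq
proof (intro conjI ballI allI impI)
  fix c d j assume cd: "c \<in> charts_at M p" "d \<in> charts_at M p" "j < mfd_dim M"
  show "a * u d j + b * v d j = (\<Sum>i<mfd_dim M. jacobian (\<lambda>q. q) c d p j i * (a * u c i + b * v c i))"
    unfolding tangent_spaceD[OF assms(1) cd] tangent_spaceD[OF assms(2) cd]
    by (simp add: sum_distrib_left sum.distrib[symmetric] algebra_simps)
qed (use assms[THEN tangent_space_outside] in simp)

lemma zero_in_tangent_space: "(\<lambda>c i. 0) \<in> tangent_space M p"
  by (simp add: tangent_space_def)

lemma tangent_space_sum:
  assumes "finite A" "\<And>i. i \<in> A \<Longrightarrow> w i \<in> tangent_space M p"
  shows "(\<lambda>c j. \<Sum>i\<in>A. a i * w i c j) \<in> tangent_space M p"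
  using assms
proof (induction A rule: finite_induct)
  case empty
  then show ?case by (simp add: zero_in_tangent_space)
next
  case (insert x A)
  then show ?case using tangent_space_lincomb[of "w x" M p "\<lambda>c j. \<Sum>i\<in>A. a i * w i c j" "a x" 1] by simp
qed

lemma cotangent_linear:
  assumes "\<theta> \<in> cotangent_space M p" "u \<in> tangent_space M p" "v \<in> tangent_space M p"
  shows "\<theta> (\<lambda>c i. a * u c i + b * v c i) = a * \<theta> u + b * \<theta> v"
  using assms unfolding cotangent_space_def by simp

lemma cotangent_outside: "\<theta> \<in> cotangent_space M p \<Longrightarrow> u \<notin> tangent_space M p \<Longrightarrow> \<theta> u = 0"
  unfolding cotangent_space_def by simp

lemma cotangent_sum:
  assumes \<theta>: "\<theta> \<in> cotangent_space M p" and "finite A" "\<And>i. i \<in> A \<Longrightarrow> w i \<in> tangent_space M p"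
  shows "\<theta> (\<lambda>c j. \<Sum>i\<in>A. a i * w i c j) = (\<Sum>i\<in>A. a i * \<theta> (w i))"
  using assms(2,3)
proof (induction A rule: finite_induct)
  case empty
  have "\<theta> (\<lambda>c j. 0 * (0::real) + 0 * 0) = 0 * \<theta> (\<lambda>c j. 0) + 0 * \<theta> (\<lambda>c j. 0)"
    by (rule cotangent_linear[OF \<theta> zero_in_tangent_space zero_in_tangent_space])
  then show ?case by simp
next
  case (insert x A)
  have "\<theta> (\<lambda>c j. a x * w x c j + 1 * (\<Sum>i\<in>A. a i * w i c j)) = a x * \<theta> (w x) + 1 * \<theta> (\<lambda>c j. \<Sum>i\<in>A. a i * w i c j)"
    by (rule cotangent_linear[OF \<theta>]) (use insert tangent_space_sum[of A w M p a] in auto)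
  then show ?case using insert by simp
qed

lemma tangent_vector_expansion:
  assumes M: "atlas_manifold M" and c: "c \<in> charts_at M p" and v: "v \<in> tangent_space M p"
  shows "v = (\<lambda>d j. \<Sum>i<mfd_dim M. v c i * coord_vector M c p i d j)"
proof (rule tangent_space_eqI[OF v _ c])
  show "(\<lambda>d j. \<Sum>i<mfd_dim M. v c i * coord_vector M c p i d j) \<in> tangent_space M p"
    by (rule tangent_space_sum) (use coord_vector_in_tangent_space[OF M c] in auto)
  fix j assume j: "j < mfd_dim M"
  have "(\<Sum>i<mfd_dim M. v c i * coord_vector M c p i c j) = (\<Sum>i<mfd_dim M. if i = j then v c j else 0)"
    by (intro sum.cong refl) (use j in \<open>simp add: coord_vector_coordinate[OF M c]\<close>)
  then show "v c j = (\<Sum>i<mfd_dim M. v c i * coord_vector M c p i c j)" using j by simp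
qed

lemma cotangent_expansion:
  assumes M: "atlas_manifold M" and c: "c \<in> charts_at M p" and v: "v \<in> tangent_space M p"
    and \<theta>: "\<theta> \<in> cotangent_space M p"
  shows "\<theta> v = (\<Sum>i<mfd_dim M. v c i * \<theta> (coord_vector M c p i))"
proof -
  have "\<theta> v = \<theta> (\<lambda>d j. \<Sum>i<mfd_dim M. v c i * coord_vector M c p i d j)"
    using tangent_vector_expansion[OF M c v] by (rule arg_cong)
  also have "\<dots> = (\<Sum>i<mfd_dim M. v c i * \<theta> (coord_vector M c p i))"
    by (rule cotangent_sum[OF \<theta>]) (use coord_vector_in_tangent_space[OF M c] in auto)
  finally show ?thesis .
qed

lemma cotangent_eqI:
  assumes M: "atlas_manifold M" and c: "c \<in> charts_at M p"
    and \<theta>: "\<theta> \<in> cotangent_space M p" "\<eta> \<in> cotangent_space M p"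
    and eq: "\<And>i. i < mfd_dim M \<Longrightarrow> \<theta> (coord_vector M c p i) = \<eta> (coord_vector M c p i)"
  shows "\<theta> = \<eta>"
proof
  fix v
  show "\<theta> v = \<eta> v"
  proof (cases "v \<in> tangent_space M p")
    case True
    then show ?thesis
      unfolding cotangent_expansion[OF M c True \<theta>(1)] cotangent_expansion[OF M c True \<theta>(2)] by (simp add: eq)
  next
    case False
    then show ?thesis using \<theta>[THEN cotangent_outside] by simp
  qed
qed

section \<open>Tangent maps\<close>

text \<open>The description that defines the tangent map has exactly one solution. A vector built from one
  pair of charts solves it in every pair, by the transformation laws; a second solution would have the same
  coordinates in one chart.\<close>

lemma tangent_map_properties:
  assumes M: "atlas_manifold M" and N: "atlas_manifold N" and F: "smooth_map M N F"
    and p: "p \<in> carrier M" and v: "v \<in> tangent_space M p"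
  shows "tangent_map M N F p v \<in> tangent_space N (F p) \<and>
    (\<forall>c\<in>charts_at M p. \<forall>d\<in>charts_at N (F p). \<forall>j<mfd_dim N.
       tangent_map M N F p v d j = (\<Sum>i<mfd_dim M. jacobian F c d p j i * v c i))"
proof -
  obtain c0 where c0: "c0 \<in> charts_at M p" by (rule charts_at_exists[OF M p])
  obtain d0 where d0: "d0 \<in> charts_at N (F p)"
    by (rule charts_at_exists[OF N smooth_map_in_carrier[OF F p]])
  define w where "w = chart_vector N d0 (F p) (\<lambda>j. \<Sum>i<mfd_dim M. jacobian F c0 d0 p j i * v c0 i)"
  have w: "w \<in> tangent_space N (F p)"
    unfolding w_def by (rule chart_vector_in_tangent_space[OF N d0])
  have w_eq: "w d k = (\<Sum>i<mfd_dim M. jacobian F c d p k i * v c i)"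
    if c: "c \<in> charts_at M p" and d: "d \<in> charts_at N (F p)" and k: "k < mfd_dim N" for c d k
  proof -
    have 1: "(\<Sum>i<mfd_dim M. jacobian F c0 d0 p j i * v c0 i) = (\<Sum>i<mfd_dim M. jacobian F c d0 p j i * v c i)"
      if j: "j < mfd_dim N" for j
    proof -
      have "(\<Sum>i<mfd_dim M. jacobian F c0 d0 p j i * v c0 i) =
          (\<Sum>i<mfd_dim M. jacobian F c0 d0 p j i * (\<Sum>l<mfd_dim M. jacobian (\<lambda>q. q) c c0 p i l * v c l))"
        by (intro sum.cong refl arg_cong2[where f = "(*)"] tangent_spaceD[OF v c c0]) simp
      also have "\<dots> = (\<Sum>l<mfd_dim M. (\<Sum>i<mfd_dim M. jacobian F c0 d0 p j i * jacobian (\<lambda>q. q) c c0 p i l) * v c l)"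
        unfolding sum_distrib_left sum_distrib_right by (subst sum.swap) (simp add: mult.assoc)
      also have "\<dots> = (\<Sum>l<mfd_dim M. jacobian F c d0 p j l * v c l)"
        by (intro sum.cong refl) (simp add: jacobian_source[OF M N F c0 c d0 _ j])
      finally show ?thesis .
    qed
    have "w d k = (\<Sum>j<mfd_dim N. jacobian (\<lambda>q. q) d0 d (F p) k j * (\<Sum>i<mfd_dim M. jacobian F c d0 p j i * v c i))"
      using d k by (simp add: w_def chart_vector_def 1)
    also have "\<dots> = (\<Sum>i<mfd_dim M. (\<Sum>j<mfd_dim N. jacobian (\<lambda>q. q) d0 d (F p) k j * jacobian F c d0 p j i) * v c i)"
      unfolding sum_distrib_left sum_distrib_right by (subst sum.swap) (simp add: mult.assoc)
    also have "\<dots> = (\<Sum>i<mfd_dim M. jacobian F c d p k i * v c i)"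
      by (intro sum.cong refl) (simp add: jacobian_target[OF M N F c d0 d _ k])
    finally show ?thesis .
  qed
  show ?thesis
    unfolding tangent_map_def
  proof (rule theI[of _ w])
    show "w \<in> tangent_space N (F p) \<and> (\<forall>c\<in>charts_at M p. \<forall>d\<in>charts_at N (F p). \<forall>j<mfd_dim N.
       w d j = (\<Sum>i<mfd_dim M. jacobian F c d p j i * v c i))"
      using w w_eq by (intro conjI ballI allI impI)
    fix w' assume w': "w' \<in> tangent_space N (F p) \<and> (\<forall>c\<in>charts_at M p. \<forall>d\<in>charts_at N (F p). \<forall>j<mfd_dim N.
       w' d j = (\<Sum>i<mfd_dim M. jacobian F c d p j i * v c i))"
    show "w' = w"
      by (rule tangent_space_eqI[OF _ w d0]) (use w' w_eq[OF c0 d0] c0 d0 in simp_all)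
  qed
qed

lemma tangent_map_in_tangent_space:
  "atlas_manifold M \<Longrightarrow> atlas_manifold N \<Longrightarrow> smooth_map M N F \<Longrightarrow> p \<in> carrier M \<Longrightarrow>
    v \<in> tangent_space M p \<Longrightarrow> tangent_map M N F p v \<in> tangent_space N (F p)"
  by (rule conjunct1[OF tangent_map_properties])

lemma tangent_map_coordinate:
  assumes "atlas_manifold M" "atlas_manifold N" "smooth_map M N F" "p \<in> carrier M" "v \<in> tangent_space M p"
    "c \<in> charts_at M p" "d \<in> charts_at N (F p)" "j < mfd_dim N"
  shows "tangent_map M N F p v d j = (\<Sum>i<mfd_dim M. jacobian F c d p j i * v c i)"
  using conjunct2[OF tangent_map_properties[OF assms(1-5)]] assms(6-8) by simp

lemma tangent_map_linear:
  assumes M: "atlas_manifold M" and N: "atlas_manifold N" and F: "smooth_map M N F"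
    and p: "p \<in> carrier M" and u: "u \<in> tangent_space M p" and v: "v \<in> tangent_space M p"
  shows "tangent_map M N F p (\<lambda>c i. a * u c i + b * v c i) =
    (\<lambda>d j. a * tangent_map M N F p u d j + b * tangent_map M N F p v d j)"
proof -
  obtain c where c: "c \<in> charts_at M p" by (rule charts_at_exists[OF M p])
  obtain d where d: "d \<in> charts_at N (F p)"
    by (rule charts_at_exists[OF N smooth_map_in_carrier[OF F p]])
  note uv = tangent_space_lincomb[OF u v]
  show ?thesis
  proof (rule tangent_space_eqI[OF _ _ d])
    fix j assume j: "j < mfd_dim N"
    show "tangent_map M N F p (\<lambda>c i. a * u c i + b * v c i) d j =
        a * tangent_map M N F p u d j + b * tangent_map M N F p v d j"
      unfolding tangent_map_coordinate[OF M N F p u c d j] tangent_map_coordinate[OF M N F p v c d j]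
        tangent_map_coordinate[OF M N F p uv c d j]
      by (simp add: sum_distrib_left sum.distrib[symmetric] algebra_simps)
  qed (intro tangent_space_lincomb tangent_map_in_tangent_space[OF M N F p] u v)+
qed

lemma tangent_map_matched:
  assumes "atlas_manifold M" "atlas_manifold N" "smooth_map M N h" "mfd_dim N = mfd_dim M" "p \<in> carrier M"
    "v \<in> tangent_space M p" "c \<in> charts_at M p" "d \<in> charts_at N (h p)" "matched h c d" "j < mfd_dim M"
  shows "tangent_map M N h p v d j = v c j"
proof -
  have "tangent_map M N h p v d j = (\<Sum>i<mfd_dim M. jacobian h c d p j i * v c i)"
    using tangent_map_coordinate[OF assms(1-3,5-8)] assms(4,10) by simp
  also have "\<dots> = (\<Sum>i<mfd_dim M. if i = j then v c j else 0)"
    by (intro sum.cong refl)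
      (simp add: matched_jacobian[OF mfd_is_chart[OF assms(1) charts_atD(1)[OF assms(7)]] assms(9) charts_atD(2)[OF assms(7)]])
  finally show ?thesis using assms(10) by simp
qed

section \<open>The exterior derivative in a chart\<close>

text \<open>The next two identities evaluate the two parts of the coordinate expression of an exterior
  derivative after a change of coordinates with Jacobian \<open>Y\<close>: the second derivatives of the
  transition are symmetric and cancel, and the remaining part transforms like a two-form.\<close>

lemma contract_symmetric:
  fixes S :: "nat \<Rightarrow> nat \<Rightarrow> real"
  assumes "\<And>i j. i < n \<Longrightarrow> j < n \<Longrightarrow> S i j = S j i"
  shows "(\<Sum>i<n. \<Sum>j<n. S i j * (u i * v j - u j * v i)) = 0"
proof -
  have "(\<Sum>i<n. \<Sum>j<n. S i j * (u j * v i)) = (\<Sum>i<n. \<Sum>j<n. S i j * (u i * v j))"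
    by (subst sum.swap) (intro sum.cong refl, simp add: assms)
  then show ?thesis by (simp add: right_diff_distrib sum_subtractf)
qed

lemma contract_transform:
  fixes H :: "nat \<Rightarrow> nat \<Rightarrow> real"
  shows "(\<Sum>i<n. \<Sum>j<n. (\<Sum>b<m. (\<Sum>a<m. H a b * Y a i) * Y b j) * (u i * v j - u j * v i)) =
    (\<Sum>a<m. \<Sum>b<m. H a b * ((\<Sum>i<n. Y a i * u i) * (\<Sum>i<n. Y b i * v i) - (\<Sum>i<n. Y b i * u i) * (\<Sum>i<n. Y a i * v i)))"
proof -
  have *: "(\<Sum>i<n. \<Sum>j<n. (\<Sum>b<m. (\<Sum>a<m. H a b * Y a i) * Y b j) * (u i * v j)) =
    (\<Sum>a<m. \<Sum>b<m. H a b * ((\<Sum>i<n. Y a i * u i) * (\<Sum>i<n. Y b i * v i)))" for u v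
  proof -
    have "(\<Sum>i<n. \<Sum>j<n. (\<Sum>b<m. (\<Sum>a<m. H a b * Y a i) * Y b j) * (u i * v j)) =
      (\<Sum>i<n. \<Sum>j<n. \<Sum>b<m. \<Sum>a<m. H a b * Y a i * Y b j * (u i * v j))"
      by (simp add: sum_distrib_right)
    also have "\<dots> = (\<Sum>i<n. \<Sum>b<m. \<Sum>j<n. \<Sum>a<m. H a b * Y a i * Y b j * (u i * v j))"
      by (intro sum.cong refl sum.swap)
    also have "\<dots> = (\<Sum>b<m. \<Sum>i<n. \<Sum>j<n. \<Sum>a<m. H a b * Y a i * Y b j * (u i * v j))"
      by (rule sum.swap)
    also have "\<dots> = (\<Sum>b<m. \<Sum>i<n. \<Sum>a<m. \<Sum>j<n. H a b * Y a i * Y b j * (u i * v j))"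
      by (intro sum.cong refl sum.swap)
    also have "\<dots> = (\<Sum>b<m. \<Sum>a<m. \<Sum>i<n. \<Sum>j<n. H a b * Y a i * Y b j * (u i * v j))"
      by (intro sum.cong refl sum.swap)
    also have "\<dots> = (\<Sum>a<m. \<Sum>b<m. \<Sum>i<n. \<Sum>j<n. H a b * Y a i * Y b j * (u i * v j))"
      by (rule sum.swap)
    also have "\<dots> = (\<Sum>a<m. \<Sum>b<m. H a b * ((\<Sum>i<n. Y a i * u i) * (\<Sum>i<n. Y b i * v i)))"
    proof (rule sum.cong[OF refl], rule sum.cong[OF refl])
      fix a b
      have "(\<Sum>i<n. Y a i * u i) * (\<Sum>j<n. Y b j * v j) = (\<Sum>i<n. \<Sum>j<n. (Y a i * u i) * (Y b j * v j))"
        by (rule sum_product)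
      then show "(\<Sum>i<n. \<Sum>j<n. H a b * Y a i * Y b j * (u i * v j)) =
          H a b * ((\<Sum>i<n. Y a i * u i) * (\<Sum>i<n. Y b i * v i))"
        by (simp add: sum_distrib_left mult_ac)
    qed
    finally show ?thesis .
  qed
  have "(\<Sum>i<n. \<Sum>j<n. (\<Sum>b<m. (\<Sum>a<m. H a b * Y a i) * Y b j) * (u i * v j - u j * v i)) =
      (\<Sum>i<n. \<Sum>j<n. (\<Sum>b<m. (\<Sum>a<m. H a b * Y a i) * Y b j) * (u i * v j)) -
      (\<Sum>i<n. \<Sum>j<n. (\<Sum>b<m. (\<Sum>a<m. H a b * Y a i) * Y b j) * (v i * u j))"
    by (simp only: right_diff_distrib sum_subtractf mult.commute[of "u _" "v _"])
  also have "\<dots> = (\<Sum>a<m. \<Sum>b<m. H a b * ((\<Sum>i<n. Y a i * u i) * (\<Sum>i<n. Y b i * v i))) -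
      (\<Sum>a<m. \<Sum>b<m. H a b * ((\<Sum>i<n. Y a i * v i) * (\<Sum>i<n. Y b i * u i)))"
    unfolding * ..
  finally show ?thesis
    by (simp add: right_diff_distrib sum_subtractf mult.commute)
qed

lemma one_formsD:
  assumes "\<theta> \<in> one_forms M"
  shows "p \<in> carrier M \<Longrightarrow> \<theta> p \<in> cotangent_space M p"
    "p \<notin> carrier M \<Longrightarrow> \<theta> p = (\<lambda>u. 0)"
    "c \<in> mfd_charts M \<Longrightarrow> i < mfd_dim M \<Longrightarrow> smooth_on (mfd_dim M) (snd c ` fst c) (coeff1 M \<theta> c i)"
  using assms unfolding one_forms_def by blast+

lemma coeff1_transform:
  assumes M: "atlas_manifold M" and \<theta>: "\<theta> \<in> one_forms M"
    and c: "c \<in> mfd_charts M" and d: "d \<in> mfd_charts M"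
    and x: "x \<in> snd c ` (fst c \<inter> fst d)" and j: "j < mfd_dim M"
  shows "coeff1 M \<theta> c j x = (\<Sum>b<mfd_dim M. coeff1 M \<theta> d b (snd d (chart_inv c x)) *
    partial j (\<lambda>x. snd d (chart_inv c x) b) x)"
proof -
  obtain p where p: "p \<in> fst c" "p \<in> fst d" "x = snd c p" using x by auto
  have inv: "chart_inv c x = p" "chart_inv d (snd d p) = p"
    using p chart_inv_left[OF chart_inj[OF mfd_is_chart[OF M c]]] chart_inv_left[OF chart_inj[OF mfd_is_chart[OF M d]]]
    by auto
  note at = charts_atI[OF c p(1)] charts_atI[OF d p(2)]
  have "\<theta> p (coord_vector M c p j) = (\<Sum>b<mfd_dim M. coord_vector M c p j d b * \<theta> p (coord_vector M d p b))"
    by (rule cotangent_expansion[OF M at(2) coord_vector_in_tangent_space[OF M at(1) j]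
          one_formsD(1)[OF \<theta> mfd_chart_in_carrier[OF M c p(1)]]])
  also have "\<dots> = (\<Sum>b<mfd_dim M. \<theta> p (coord_vector M d p b) * jacobian (\<lambda>q. q) c d p b j)"
    by (intro sum.cong refl) (use at in \<open>simp add: coord_vector_def\<close>)
  finally show ?thesis by (simp add: coeff1_def inv jacobian_def p(3)[symmetric] Let_def)
qed

text \<open>The coordinate expression from which \<open>ext_deriv\<close> is defined.\<close>

abbreviation chart_deriv :: "'a mfd \<Rightarrow> 'a form1 \<Rightarrow> 'a chart \<Rightarrow> 'a \<Rightarrow> 'a tvec \<Rightarrow> 'a tvec \<Rightarrow> real" where
  "chart_deriv M \<theta> c p u v \<equiv> (\<Sum>i<mfd_dim M. \<Sum>j<mfd_dim M.
     partial i (coeff1 M \<theta> c j) (snd c p) * (u c i * v c j - u c j * v c i))"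

text \<open>Differentiating the transformation law of the coefficients gives two terms: one contains the
  derivatives of the new coefficients, and the other the second derivatives of the transition, which disappear
  by antisymmetry.\<close>

lemma chart_deriv_independent:
  assumes M: "atlas_manifold M" and \<theta>: "\<theta> \<in> one_forms M"
    and c: "c \<in> charts_at M p" and d: "d \<in> charts_at M p"
    and u: "u \<in> tangent_space M p" and v: "v \<in> tangent_space M p"
  shows "chart_deriv M \<theta> c p u v = chart_deriv M \<theta> d p u v"
proof -
  let ?n = "mfd_dim M" and ?x = "snd c p"
  define y where "y b = (\<lambda>x. snd d (chart_inv c x) b)" for b
  define G where "G b = coeff1 M \<theta> d b" for b
  note cM = charts_atD(1)[OF c] and dM = charts_atD(1)[OF d]
  note ic = mfd_is_chart[OF M cM] and id = mfd_is_chart[OF M dM]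
  let ?U = "snd c ` (fst c \<inter> fst d)" and ?V = "snd d ` (fst c \<inter> fst d)"
  have W: "openin (mfd_top M) (fst c \<inter> fst d)" by (intro openin_Int chart_open[OF ic] chart_open[OF id])
  have U: "openin (Euclidean_space ?n) ?U" "openin (Euclidean_space ?n) ?V"
    by (rule iffD1[OF chart_openness[OF ic] W], simp) (rule iffD1[OF chart_openness[OF id] W], simp)
  have x: "?x \<in> ?U" "chart_inv c ?x = p"
    using charts_atD(2)[OF c] charts_atD(2)[OF d] chart_inv_left[OF chart_inj[OF ic]] by auto
  have ys: "smooth_on ?n ?U (y b)" if "b < ?n" for b
    using mfd_transition_smooth[OF M cM dM] that unfolding smooth_rep_def y_def by simp
  have Gs: "smooth_on ?n ?V (G b)" if "b < ?n" for b
    unfolding G_def by (rule smooth_on_subset[OF one_formsD(3)[OF \<theta> dM that]]) auto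
  have im: "(\<lambda>x. snd d (chart_inv c x)) ` ?U \<subseteq> ?V"
    using chart_inv_left[OF chart_inj[OF ic]] by auto
  have Gy: "smooth_on ?n ?U (\<lambda>x. G b (snd d (chart_inv c x)))" if "b < ?n" for b
    by (rule smooth_on_compose[OF U _ im Gs[OF that]]) (use ys in \<open>simp add: y_def\<close>)
  have Gd: "partial i (\<lambda>x. G b (snd d (chart_inv c x))) ?x = (\<Sum>a<?n. partial a (G b) (snd d p) * partial i (y a) ?x)"
    if "b < ?n" "i < ?n" for b i
    using smooth_on_chain_rule[OF U _ im Gs[OF that(1)] x(1) that(2)] ys by (simp add: y_def x(2))
  have sym: "partial i (partial j (y b)) ?x = partial j (partial i (y b)) ?x" if "i < ?n" "j < ?n" "b < ?n" for i j b
    by (rule partial_commute[OF U(1) _ that(1,2) x(1)]) (use ys[OF that(3)] in \<open>simp add: smooth_on_def del: C_on.simps\<close>)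
  have D: "partial i (coeff1 M \<theta> c j) ?x = (\<Sum>b<?n. (\<Sum>a<?n. partial a (G b) (snd d p) * partial i (y a) ?x) * partial j (y b) ?x)
      + (\<Sum>b<?n. G b (snd d p) * partial i (partial j (y b)) ?x)" if i: "i < ?n" and j: "j < ?n" for i j
  proof -
    have "partial i (coeff1 M \<theta> c j) ?x = partial i (\<lambda>x. \<Sum>b<?n. G b (snd d (chart_inv c x)) * partial j (y b) x) ?x"
      by (rule partial_cong[OF U(1) x(1) i])
        (simp only: coeff1_transform[OF M \<theta> cM dM _ j] G_def y_def)
    also have "\<dots> = (\<Sum>b<?n. partial i (\<lambda>x. G b (snd d (chart_inv c x)) * partial j (y b) x) ?x)"
      by (rule partial_sum[OF _ x(1) i]) (use Gy ys j in \<open>auto intro!: smooth_on_mult[OF U(1)] smooth_on_partial\<close>)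
    also have "\<dots> = (\<Sum>b<?n. (\<Sum>a<?n. partial a (G b) (snd d p) * partial i (y a) ?x) * partial j (y b) ?x
        + G b (snd d p) * partial i (partial j (y b)) ?x)"
    proof (intro sum.cong refl)
      fix b assume "b \<in> {..<?n}"
      then have b: "b < ?n" by simp
      show "partial i (\<lambda>x. G b (snd d (chart_inv c x)) * partial j (y b) x) ?x =
        (\<Sum>a<?n. partial a (G b) (snd d p) * partial i (y a) ?x) * partial j (y b) ?x
        + G b (snd d p) * partial i (partial j (y b)) ?x"
        using partial_mult[OF Gy[OF b] smooth_on_partial[OF ys[OF b] j] x(1) i] Gd[OF b i] by (simp add: x(2))
    qed
    finally show ?thesis by (simp add: sum.distrib)
  qed
  have "chart_deriv M \<theta> c p u v =
      (\<Sum>i<?n. \<Sum>j<?n. (\<Sum>b<?n. (\<Sum>a<?n. partial a (G b) (snd d p) * partial i (y a) ?x) * partial j (y b) ?x) *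
        (u c i * v c j - u c j * v c i)) +
      (\<Sum>i<?n. \<Sum>j<?n. (\<Sum>b<?n. G b (snd d p) * partial i (partial j (y b)) ?x) * (u c i * v c j - u c j * v c i))"
    by (simp add: D distrib_right sum.distrib)
  also have "(\<Sum>i<?n. \<Sum>j<?n. (\<Sum>b<?n. G b (snd d p) * partial i (partial j (y b)) ?x) * (u c i * v c j - u c j * v c i)) = 0"
    by (rule contract_symmetric) (intro sum.cong refl, simp add: sym)
  also have "(\<Sum>i<?n. \<Sum>j<?n. (\<Sum>b<?n. (\<Sum>a<?n. partial a (G b) (snd d p) * partial i (y a) ?x) * partial j (y b) ?x) *
        (u c i * v c j - u c j * v c i)) =
      (\<Sum>a<?n. \<Sum>b<?n. partial a (G b) (snd d p) *
        ((\<Sum>i<?n. partial i (y a) ?x * u c i) * (\<Sum>i<?n. partial i (y b) ?x * v c i) -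
         (\<Sum>i<?n. partial i (y b) ?x * u c i) * (\<Sum>i<?n. partial i (y a) ?x * v c i)))"
    by (rule contract_transform)
  also have "\<dots> = chart_deriv M \<theta> d p u v"
  proof -
    have "w d a = (\<Sum>i<?n. partial i (y a) ?x * w c i)" if "w \<in> tangent_space M p" "a < ?n" for w a
      using tangent_spaceD[OF that(1) c d that(2)] by (simp add: jacobian_def y_def)
    then show ?thesis using u v by (simp add: G_def)
  qed
  finally show ?thesis by simp
qed

lemma ext_deriv_in_chart:
  assumes M: "atlas_manifold M" and \<theta>: "\<theta> \<in> one_forms M" and p: "p \<in> carrier M" and c: "c \<in> charts_at M p"
    and u: "u \<in> tangent_space M p" and v: "v \<in> tangent_space M p"
  shows "ext_deriv M \<theta> p u v = chart_deriv M \<theta> c p u v"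
proof -
  have "ext_deriv M \<theta> p u v = (THE w. \<forall>c\<in>charts_at M p. w = chart_deriv M \<theta> c p u v)"
    using p u v by (simp add: ext_deriv_def)
  also have "\<dots> = chart_deriv M \<theta> c p u v"
  proof (rule the_equality)
    show "\<forall>d\<in>charts_at M p. chart_deriv M \<theta> c p u v = chart_deriv M \<theta> d p u v"
      using chart_deriv_independent[OF M \<theta> c _ u v] by (rule ballI)
    show "w = chart_deriv M \<theta> c p u v" if "\<forall>c\<in>charts_at M p. w = chart_deriv M \<theta> c p u v" for w
      using that c by (rule bspec)
  qed
  finally show ?thesis .
qed

section \<open>Transport of forms along a diffeomorphism\<close>

text \<open>A diffeomorphism together with its inverse; the formulation is symmetric in the two manifolds.\<close>

definition mfd_iso :: "'a mfd \<Rightarrow> 'b mfd \<Rightarrow> ('a \<Rightarrow> 'b) \<Rightarrow> ('b \<Rightarrow> 'a) \<Rightarrow> bool" where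
  "mfd_iso M N h g \<longleftrightarrow> atlas_manifold M \<and> atlas_manifold N \<and> mfd_dim N = mfd_dim M \<and>
     smooth_map M N h \<and> smooth_map N M g \<and>
     (\<forall>p\<in>carrier M. g (h p) = p) \<and> (\<forall>q\<in>carrier N. h (g q) = q)"

lemma mfd_iso_sym: "mfd_iso M N h g \<Longrightarrow> mfd_iso N M g h"
  by (simp add: mfd_iso_def)

lemma mfd_isoD:
  assumes "mfd_iso M N h g"
  shows "atlas_manifold M" "atlas_manifold N" "mfd_dim N = mfd_dim M" "smooth_map M N h" "smooth_map N M g"
    "p \<in> carrier M \<Longrightarrow> g (h p) = p" "q \<in> carrier N \<Longrightarrow> h (g q) = q"
    "p \<in> carrier M \<Longrightarrow> h p \<in> carrier N"
  using assms smooth_map_in_carrier[of M N h] by (simp_all add: mfd_iso_def)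

lemma diffeomorphism_imp_mfd_iso:
  assumes "atlas_manifold M" "atlas_manifold N" "mfd_dim N = mfd_dim M" "diffeomorphism M N h"
  shows "mfd_iso M N h (inv_into (carrier M) h)"
  using assms by (simp add: mfd_iso_def diffeomorphism_def bij_betw_def f_inv_into_f)

lemma smooth_map_preimage_open:
  "smooth_map M N F \<Longrightarrow> openin (mfd_top N) V \<Longrightarrow> openin (mfd_top M) {p \<in> carrier M. F p \<in> V}"
  by (simp add: smooth_map_def continuous_map_def)

text \<open>The chart \<open>c\<close> composed with \<open>g\<close> belongs to the maximal atlas of
  \<open>N\<close>, as its transitions are representatives of \<open>h\<close> and of \<open>g\<close>.
  Questions about a diffeomorphism can therefore be settled in charts in which it is the identity.\<close>

lemma mfd_iso_matched_chart:
  assumes iso: "mfd_iso M N h g" and c: "c \<in> mfd_charts M"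
  shows "\<exists>d\<in>mfd_charts N. matched h c d"
proof -
  note M = mfd_isoD(1)[OF iso] and N = mfd_isoD(2)[OF iso] and dim = mfd_isoD(3)[OF iso]
    and h = mfd_isoD(4)[OF iso] and g = mfd_isoD(5)[OF iso]
  note ic = mfd_is_chart[OF M c]
  define d where "d = (h ` fst c, \<lambda>q. snd c (g q))"
  have d: "fst d = h ` fst c" "snd d = (\<lambda>q. snd c (g q))" by (simp_all add: d_def)
  have cM: "p \<in> carrier M" if "p \<in> fst c" for p using mfd_chart_in_carrier[OF M c that] .
  have gh: "g (h p) = p" if "p \<in> fst c" for p using mfd_isoD(6)[OF iso cM[OF that]] .
  have m: "matched h c d"
    unfolding matched_def d using gh by (auto intro: inj_on_inverseI)
  have fd: "fst d = {q \<in> carrier N. g q \<in> fst c}"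
  proof
    show "fst d \<subseteq> {q \<in> carrier N. g q \<in> fst c}"
      using gh cM mfd_isoD(8)[OF iso] unfolding d by auto
    show "{q \<in> carrier N. g q \<in> fst c} \<subseteq> fst d"
    proof
      fix q assume q: "q \<in> {q \<in> carrier N. g q \<in> fst c}"
      then have "q = h (g q)" using mfd_isoD(7)[OF iso, of q] by simp
      then show "q \<in> fst d" unfolding d(1) by (rule image_eqI) (use q in simp)
    qed
  qed
  have od: "openin (mfd_top N) (fst d)"
    unfolding fd by (rule smooth_map_preimage_open[OF g chart_open[OF ic]])
  have id: "is_chart (mfd_top N) (mfd_dim N) d"
    unfolding is_chart_iff
  proof (intro conjI allI impI od)
    show "inj_on (snd d) (fst d)" by (rule matched_inj[OF m chart_inj[OF ic]])
    show "snd d ` fst d \<subseteq> rspace (mfd_dim N)"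
      using chart_image_subset[OF ic] gh unfolding d dim by auto
    fix W assume W: "W \<subseteq> fst d"
    have gW: "g ` W \<subseteq> fst c" using W fd by auto
    have "openin (mfd_top N) W = openin (mfd_top M) (g ` W)"
    proof
      assume "openin (mfd_top N) W"
      from smooth_map_preimage_open[OF h this]
      have "openin (mfd_top M) {p \<in> carrier M. h p \<in> W}" .
      moreover have "{p \<in> carrier M. h p \<in> W} = g ` W"
      proof
        show "{p \<in> carrier M. h p \<in> W} \<subseteq> g ` W"
        proof
          fix p assume p: "p \<in> {p \<in> carrier M. h p \<in> W}"
          then have "p = g (h p)" using mfd_isoD(6)[OF iso, of p] by simp
          then show "p \<in> g ` W" by (rule image_eqI) (use p in simp)
        qed
        show "g ` W \<subseteq> {p \<in> carrier M. h p \<in> W}"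
        proof
          fix p assume "p \<in> g ` W"
          then obtain q where q: "q \<in> W" "p = g q" by (rule imageE)
          then have "q \<in> carrier N" "p \<in> fst c" using W gW unfolding fd by auto
          then show "p \<in> {p \<in> carrier M. h p \<in> W}"
            using q mfd_isoD(7)[OF iso, of q] cM[of p] by simp
        qed
      qed
      ultimately show "openin (mfd_top M) (g ` W)" by simp
    next
      assume "openin (mfd_top M) (g ` W)"
      from smooth_map_preimage_open[OF g this]
      have "openin (mfd_top N) {q \<in> carrier N. g q \<in> g ` W}" .
      moreover have "{q \<in> carrier N. g q \<in> g ` W} = W"
      proof -
        have "q \<in> W" if "q \<in> carrier N" "q' \<in> W" "g q = g q'" for q q'
        proof -
          have "q' \<in> carrier N" using that(2) W fd by auto
          have "h (g q) = h (g q')" using that(3) by (rule arg_cong)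
          then have "q = q'"
            unfolding mfd_isoD(7)[OF iso that(1)] mfd_isoD(7)[OF iso \<open>q' \<in> carrier N\<close>] .
          then show ?thesis using that(2) by (simp only:)
        qed
        then show ?thesis using W fd by auto
      qed
      ultimately show "openin (mfd_top N) W" by simp
    qed
    then show "openin (mfd_top N) W = openin (Euclidean_space (mfd_dim N)) (snd d ` W)"
      using chart_openness[OF ic gW] by (simp add: d dim image_image)
  qed
  have "d \<in> mfd_charts N"
  proof (rule mfd_maximal[OF N id])
    fix a assume a: "a \<in> mfd_charts N"
    have op: "openin (mfd_top M) {p \<in> fst c. h p \<in> fst a}" by (rule smooth_map_chart_open[OF h M N c a])
    have o: "openin (Euclidean_space (mfd_dim M)) (snd c ` {p \<in> fst c. h p \<in> fst a})"
      by (rule iffD1[OF chart_openness[OF ic] op]) simp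
    have s: "snd d ` (fst d \<inter> fst a) = snd c ` {p \<in> fst c. h p \<in> fst a}"
    proof -
      have "fst d \<inter> fst a = h ` {p \<in> fst c. h p \<in> fst a}" unfolding d(1) by auto
      then show ?thesis using matched_image[OF m, of "{p \<in> fst c. h p \<in> fst a}"] by simp
    qed
    have "smooth_rep (mfd_dim N) (mfd_dim N) d a (\<lambda>p. p) (fst d \<inter> fst a)"
      unfolding smooth_rep_def s unfolding dim
    proof (intro allI impI)
      fix j assume j: "j < mfd_dim M"
      have "smooth_on (mfd_dim M) (snd c ` {p \<in> fst c. h p \<in> fst a}) (\<lambda>x. snd a (h (chart_inv c x)) j)"
        using smooth_map_smooth_rep[OF h c a] j dim by (simp add: smooth_rep_def)
      then show "smooth_on (mfd_dim M) (snd c ` {p \<in> fst c. h p \<in> fst a}) (\<lambda>x. snd a (chart_inv d x) j)"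
      proof (rule smooth_on_cong[OF o, rotated])
        fix x assume "x \<in> snd c ` {p \<in> fst c. h p \<in> fst a}"
        then have "x \<in> snd c ` fst c" by auto
        then show "snd a (h (chart_inv c x)) j = snd a (chart_inv d x) j"
          by (simp only: matched_chart_inv[OF m chart_inj[OF ic]])
      qed
    qed
    moreover have "smooth_rep (mfd_dim N) (mfd_dim N) a d (\<lambda>p. p) (fst a \<inter> fst d)"
    proof -
      have "fst a \<inter> fst d = {q \<in> fst a. g q \<in> fst c}"
        unfolding fd using mfd_chart_in_carrier[OF N a] by auto
      then show ?thesis using smooth_map_smooth_rep[OF g a c] dim by (simp add: smooth_rep_def d)
    qed
    ultimately show "compatible (mfd_dim N) d a" by (simp add: compatible_iff_smooth_rep)
  qed
  then show ?thesis using m by (rule bexI[rotated])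
qed

lemma matched_charts_at:
  assumes "matched h c d" "d \<in> mfd_charts N" "c \<in> charts_at M p"
  shows "d \<in> charts_at N (h p)"
  using assms(1) charts_atD(2)[OF assms(3)] by (intro charts_atI[OF assms(2)]) (auto simp: matched_def)

lemma mfd_iso_matched_chart_at:
  assumes "mfd_iso M N h g" "p \<in> carrier M"
  obtains c d where "c \<in> charts_at M p" "d \<in> charts_at N (h p)" "matched h c d"
proof -
  obtain c where c: "c \<in> charts_at M p" by (rule charts_at_exists[OF mfd_isoD(1)[OF assms(1)] assms(2)])
  from mfd_iso_matched_chart[OF assms(1) charts_atD(1)[OF c]] obtain d where "d \<in> mfd_charts N" "matched h c d"
    by (elim bexE)
  then show thesis using c matched_charts_at by (intro that)
qed

lemma mfd_iso_tangent_map_in: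
  assumes "mfd_iso M N h g" "p \<in> carrier M" "v \<in> tangent_space M p"
  shows "tangent_map M N h p v \<in> tangent_space N (h p)"
  by (rule tangent_map_in_tangent_space[OF mfd_isoD(1,2,4)[OF assms(1)] assms(2,3)])

lemma mfd_iso_tangent_map_coordinate:
  assumes "mfd_iso M N h g" "p \<in> carrier M" "v \<in> tangent_space M p"
    "c \<in> charts_at M p" "d \<in> charts_at N (h p)" "matched h c d" "j < mfd_dim M"
  shows "tangent_map M N h p v d j = v c j"
  by (rule tangent_map_matched[OF mfd_isoD(1,2,4,3)[OF assms(1)] assms(2-7)])

text \<open>In matched charts the two tangent maps leave the coordinates of a vector unchanged.\<close>

lemma mfd_iso_tangent_map_inverse:
  assumes iso: "mfd_iso M N h g" and p: "p \<in> carrier M" and v: "v \<in> tangent_space M p"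
  shows "tangent_map N M g (h p) (tangent_map M N h p v) = v"
proof -
  obtain c d where c: "c \<in> charts_at M p" and d: "d \<in> charts_at N (h p)" and m: "matched h c d"
    by (rule mfd_iso_matched_chart_at[OF iso p])
  note iso' = mfd_iso_sym[OF iso]
  have gh: "g (h p) = p" by (rule mfd_isoD(6)[OF iso p])
  have m': "matched g d c"
    by (rule matched_inverse[OF m])
      (rule mfd_isoD(6)[OF iso mfd_chart_in_carrier[OF mfd_isoD(1)[OF iso] charts_atD(1)[OF c]]])
  have hp: "h p \<in> carrier N" by (rule mfd_isoD(8)[OF iso p])
  note Tv = mfd_iso_tangent_map_in[OF iso p v]
  show ?thesis
  proof (rule tangent_space_eqI[OF _ v c])
    show "tangent_map N M g (h p) (tangent_map M N h p v) \<in> tangent_space M p"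
      using mfd_iso_tangent_map_in[OF iso' hp Tv] by (simp only: gh)
    fix i assume i: "i < mfd_dim M"
    have "tangent_map N M g (h p) (tangent_map M N h p v) c i = tangent_map M N h p v d i"
      by (rule mfd_iso_tangent_map_coordinate[OF iso' hp Tv d _ m'])
        (use c gh i mfd_isoD(3)[OF iso] in simp_all)
    then show "tangent_map N M g (h p) (tangent_map M N h p v) c i = v c i"
      using mfd_iso_tangent_map_coordinate[OF iso p v c d m i] by simp
  qed
qed

lemma mfd_iso_tangent_map_coord_vector:
  assumes iso: "mfd_iso M N h g" and p: "p \<in> carrier M"
    and c: "c \<in> charts_at M p" and d: "d \<in> charts_at N (h p)" and m: "matched h c d" and i: "i < mfd_dim M"
  shows "tangent_map M N h p (coord_vector M c p i) = coord_vector N d (h p) i"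
proof -
  note M = mfd_isoD(1)[OF iso] and N = mfd_isoD(2)[OF iso] and dim = mfd_isoD(3)[OF iso]
  note cv = coord_vector_in_tangent_space[OF M c i]
  have i': "i < mfd_dim N" using i dim by simp
  show ?thesis
  proof (rule tangent_space_eqI[OF mfd_iso_tangent_map_in[OF iso p cv] coord_vector_in_tangent_space[OF N d i'] d])
    fix j assume j: "j < mfd_dim N"
    then have j': "j < mfd_dim M" using dim by simp
    show "tangent_map M N h p (coord_vector M c p i) d j = coord_vector N d (h p) i d j"
      unfolding mfd_iso_tangent_map_coordinate[OF iso p cv c d m j']
        coord_vector_coordinate[OF N d i' j] coord_vector_coordinate[OF M c i j'] ..
  qed
qed

definition pullback1 :: "'a mfd \<Rightarrow> 'b mfd \<Rightarrow> ('a \<Rightarrow> 'b) \<Rightarrow> 'b form1 \<Rightarrow> 'a form1" where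
  "pullback1 M N F \<theta> p v =
     (if p \<in> carrier M \<and> v \<in> tangent_space M p then \<theta> (F p) (tangent_map M N F p v) else 0)"

lemma two_formsD:
  assumes "\<omega> \<in> two_forms M"
  shows "p \<in> carrier M \<Longrightarrow> u \<in> tangent_space M p \<Longrightarrow> \<omega> p u \<in> cotangent_space M p"
    "p \<in> carrier M \<Longrightarrow> u \<in> tangent_space M p \<Longrightarrow> (\<lambda>v. \<omega> p v u) \<in> cotangent_space M p"
    "p \<in> carrier M \<Longrightarrow> u \<in> tangent_space M p \<Longrightarrow> \<omega> p u u = 0"
    "p \<notin> carrier M \<or> u \<notin> tangent_space M p \<Longrightarrow> \<omega> p u v = 0"
    "c \<in> mfd_charts M \<Longrightarrow> i < mfd_dim M \<Longrightarrow> j < mfd_dim M \<Longrightarrow>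
      smooth_on (mfd_dim M) (snd c ` fst c) (coeff2 M \<omega> c i j)"
    "\<exists>r. \<forall>p\<in>carrier M. rank_at M \<omega> p = r"
  using assms unfolding two_forms_def mem_Collect_eq by (elim conjE, simp del: split_paired_All)+

lemma cotangent_pullback:
  assumes iso: "mfd_iso M N h g" and p: "p \<in> carrier M" and \<theta>: "\<theta> \<in> cotangent_space N (h p)"
  shows "(\<lambda>v. if v \<in> tangent_space M p then \<theta> (tangent_map M N h p v) else 0) \<in> cotangent_space M p"
  unfolding cotangent_space_def mem_Collect_eq
proof (intro conjI ballI allI impI)
  fix u v a b assume uv: "u \<in> tangent_space M p" "v \<in> tangent_space M p"
  show "(if (\<lambda>c i. a * u c i + b * v c i) \<in> tangent_space M p
      then \<theta> (tangent_map M N h p (\<lambda>c i. a * u c i + b * v c i)) else 0) =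
    a * (if u \<in> tangent_space M p then \<theta> (tangent_map M N h p u) else 0) +
    b * (if v \<in> tangent_space M p then \<theta> (tangent_map M N h p v) else 0)"
    using uv tangent_space_lincomb[OF uv]
      cotangent_linear[OF \<theta> mfd_iso_tangent_map_in[OF iso p uv(1)] mfd_iso_tangent_map_in[OF iso p uv(2)]]
    by (simp add: tangent_map_linear[OF mfd_isoD(1,2,4)[OF iso] p uv])
qed simp

text \<open>The tangent map of \<open>h\<close> takes the coordinate vectors of \<open>c\<close> to those of
  \<open>d\<close>, so smoothness and exterior derivatives of pullbacks can be read off from the coefficients.\<close>

lemma pullback1_coeff:
  assumes iso: "mfd_iso M N h g" and c: "c \<in> mfd_charts M" and d: "d \<in> mfd_charts N" and m: "matched h c d"
    and i: "i < mfd_dim M" and x: "x \<in> snd c ` fst c"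
  shows "coeff1 M (pullback1 M N h \<theta>) c i x = coeff1 N \<theta> d i x"
proof -
  note M = mfd_isoD(1)[OF iso]
  have p: "chart_inv c x \<in> fst c" by (rule chart_inv_right(2)[OF x])
  note ca = charts_atI[OF c p]
  note pc = mfd_chart_in_carrier[OF M c p]
  note da = matched_charts_at[OF m d ca]
  show ?thesis
    by (simp add: coeff1_def Let_def pullback1_def pc coord_vector_in_tangent_space[OF M ca i]
        mfd_iso_tangent_map_coord_vector[OF iso pc ca da m i]
        matched_chart_inv[OF m chart_inj[OF mfd_is_chart[OF M c]] x])
qed

lemma pullback_coeff:
  assumes iso: "mfd_iso M N h g" and c: "c \<in> mfd_charts M" and d: "d \<in> mfd_charts N" and m: "matched h c d"
    and i: "i < mfd_dim M" and j: "j < mfd_dim M" and x: "x \<in> snd c ` fst c"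
  shows "coeff2 M (pullback M N h \<omega>) c i j x = coeff2 N \<omega> d i j x"
proof -
  note M = mfd_isoD(1)[OF iso]
  have p: "chart_inv c x \<in> fst c" by (rule chart_inv_right(2)[OF x])
  note ca = charts_atI[OF c p]
  note pc = mfd_chart_in_carrier[OF M c p]
  note da = matched_charts_at[OF m d ca]
  show ?thesis
    by (simp add: coeff2_def Let_def pullback_def pc coord_vector_in_tangent_space[OF M ca i]
        coord_vector_in_tangent_space[OF M ca j]
        mfd_iso_tangent_map_coord_vector[OF iso pc ca da m i] mfd_iso_tangent_map_coord_vector[OF iso pc ca da m j]
        matched_chart_inv[OF m chart_inj[OF mfd_is_chart[OF M c]] x])
qed

lemma matched_image_eq: "matched h c d \<Longrightarrow> snd d ` fst d = snd c ` fst c"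
  using matched_image[of h c d "fst c"] by (simp add: matched_def)

lemma pullback1_one_form:
  assumes iso: "mfd_iso M N h g" and \<theta>: "\<theta> \<in> one_forms N"
  shows "pullback1 M N h \<theta> \<in> one_forms M"
  unfolding one_forms_def mem_Collect_eq
proof (intro conjI ballI allI impI)
  fix p assume p: "p \<in> carrier M"
  have "pullback1 M N h \<theta> p = (\<lambda>v. if v \<in> tangent_space M p then \<theta> (h p) (tangent_map M N h p v) else 0)"
    using p by (simp add: pullback1_def fun_eq_iff)
  then show "pullback1 M N h \<theta> p \<in> cotangent_space M p"
    using cotangent_pullback[OF iso p one_formsD(1)[OF \<theta> mfd_isoD(8)[OF iso p]]] by simp
next
  fix c i assume c: "c \<in> mfd_charts M" and i: "i < mfd_dim M"
  from mfd_iso_matched_chart[OF iso c] obtain d where d: "d \<in> mfd_charts N" and m: "matched h c d" by (elim bexE)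
  have i': "i < mfd_dim N" using i mfd_isoD(3)[OF iso] by simp
  have "smooth_on (mfd_dim M) (snd c ` fst c) (coeff1 N \<theta> d i)"
    using one_formsD(3)[OF \<theta> d i'] matched_image_eq[OF m] mfd_isoD(3)[OF iso] by simp
  then show "smooth_on (mfd_dim M) (snd c ` fst c) (coeff1 M (pullback1 M N h \<theta>) c i)"
    by (rule smooth_on_cong[OF chart_image_open[OF mfd_is_chart[OF mfd_isoD(1)[OF iso] c]], rotated])
      (rule pullback1_coeff[OF iso c d m i, symmetric])
qed (simp add: pullback1_def fun_eq_iff)

text \<open>The tangent map is a bijection of tangent spaces, so the families of vectors whose images under
  the form are independent correspond to each other.\<close>

lemma pullback_rank:
  assumes iso: "mfd_iso M N h g" and p: "p \<in> carrier M"
  shows "rank_at M (pullback M N h \<omega>) p = rank_at N \<omega> (h p)"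
proof -
  let ?T = "tangent_map M N h p" and ?S = "tangent_map N M g (h p)"
  have hp: "h p \<in> carrier N" and gh: "g (h p) = p" using mfd_isoD(6,8)[OF iso p] by auto
  have T: "?T v \<in> tangent_space N (h p)" if "v \<in> tangent_space M p" for v
    by (rule mfd_iso_tangent_map_in[OF iso p that])
  have S: "?S v \<in> tangent_space M p" "?T (?S v) = v" if "v \<in> tangent_space N (h p)" for v
    using mfd_iso_tangent_map_in[OF mfd_iso_sym[OF iso] hp that]
      mfd_iso_tangent_map_inverse[OF mfd_iso_sym[OF iso] hp that] by (simp_all add: gh)
  have all: "(\<forall>v\<in>tangent_space M p. P (?T v)) \<longleftrightarrow> (\<forall>v\<in>tangent_space N (h p). P v)" for P
  proof
    assume P: "\<forall>v\<in>tangent_space M p. P (?T v)"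
    show "\<forall>v\<in>tangent_space N (h p). P v"
    proof
      fix v assume "v \<in> tangent_space N (h p)"
      from S[OF this] P show "P v" by metis
    qed
  qed (use T in auto)
  have pb: "(\<forall>v\<in>tangent_space M p. (\<Sum>i<r. a i * pullback M N h \<omega> p (u i) v) = 0) \<longleftrightarrow>
      (\<forall>v\<in>tangent_space N (h p). (\<Sum>i<r. a i * \<omega> (h p) (?T (u i)) v) = 0)"
    if "\<forall>i<r. u i \<in> tangent_space M p" for u :: "nat \<Rightarrow> 'a tvec" and a :: "nat \<Rightarrow> real" and r :: nat
    unfolding all[of "\<lambda>v. (\<Sum>i<r. a i * \<omega> (h p) (?T (u i)) v) = 0", symmetric]
    using that p by (simp add: pullback_def)
  have "(\<exists>u :: nat \<Rightarrow> 'a tvec. (\<forall>i<r. u i \<in> tangent_space M p) \<and>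
     (\<forall>a :: nat \<Rightarrow> real. (\<forall>v\<in>tangent_space M p. (\<Sum>i<r. a i * pullback M N h \<omega> p (u i) v) = 0) \<longrightarrow> (\<forall>i<r. a i = 0))) \<longleftrightarrow>
    (\<exists>u :: nat \<Rightarrow> 'b tvec. (\<forall>i<r. u i \<in> tangent_space N (h p)) \<and>
     (\<forall>a :: nat \<Rightarrow> real. (\<forall>v\<in>tangent_space N (h p). (\<Sum>i<r. a i * \<omega> (h p) (u i) v) = 0) \<longrightarrow> (\<forall>i<r. a i = 0)))"
    (is "?L \<longleftrightarrow> ?R") for r :: nat
  proof
    assume ?L
    then obtain u :: "nat \<Rightarrow> 'a tvec" where u: "\<forall>i<r. u i \<in> tangent_space M p"
      "\<forall>a :: nat \<Rightarrow> real. (\<forall>v\<in>tangent_space M p. (\<Sum>i<r. a i * pullback M N h \<omega> p (u i) v) = 0) \<longrightarrow> (\<forall>i<r. a i = 0)"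
      by (elim exE conjE)
    show ?R
      by (rule exI[of _ "\<lambda>i. ?T (u i)"]) (use u T in \<open>simp add: pb[OF u(1)]\<close>)
  next
    assume ?R
    then obtain u :: "nat \<Rightarrow> 'b tvec" where u: "\<forall>i<r. u i \<in> tangent_space N (h p)"
      "\<forall>a :: nat \<Rightarrow> real. (\<forall>v\<in>tangent_space N (h p). (\<Sum>i<r. a i * \<omega> (h p) (u i) v) = 0) \<longrightarrow> (\<forall>i<r. a i = 0)"
      by (elim exE conjE)
    have Su: "\<forall>i<r. ?S (u i) \<in> tangent_space M p" using u(1) S(1) by simp
    have "(\<Sum>i<r. a i * \<omega> (h p) (?T (?S (u i))) v) = (\<Sum>i<r. a i * \<omega> (h p) (u i) v)" for a v
      by (intro sum.cong refl) (use u(1) S(2) in simp)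
    then show ?L
      by (intro exI[of _ "\<lambda>i. ?S (u i)"]) (use u Su in \<open>simp add: pb[OF Su]\<close>)
  qed
  then show ?thesis unfolding rank_at_def by simp
qed

lemma pullback_two_form:
  assumes iso: "mfd_iso M N h g" and \<omega>: "\<omega> \<in> two_forms N"
  shows "pullback M N h \<omega> \<in> two_forms M"
  unfolding two_forms_def mem_Collect_eq
proof (intro conjI ballI allI impI)
  fix p u assume p: "p \<in> carrier M" and u: "u \<in> tangent_space M p"
  note hp = mfd_isoD(8)[OF iso p] and Tu = mfd_iso_tangent_map_in[OF iso p u]
  have "pullback M N h \<omega> p u = (\<lambda>v. if v \<in> tangent_space M p then \<omega> (h p) (tangent_map M N h p u) (tangent_map M N h p v) else 0)"
    using p u by (simp add: pullback_def fun_eq_iff)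
  then show "pullback M N h \<omega> p u \<in> cotangent_space M p"
    using cotangent_pullback[OF iso p two_formsD(1)[OF \<omega> hp Tu]] by simp
  have "(\<lambda>v. pullback M N h \<omega> p v u) = (\<lambda>v. if v \<in> tangent_space M p then \<omega> (h p) (tangent_map M N h p v) (tangent_map M N h p u) else 0)"
    using p u by (simp add: pullback_def fun_eq_iff)
  then show "(\<lambda>v. pullback M N h \<omega> p v u) \<in> cotangent_space M p"
    using cotangent_pullback[OF iso p two_formsD(2)[OF \<omega> hp Tu]] by simp
  show "pullback M N h \<omega> p u u = 0"
    using two_formsD(3)[OF \<omega> hp Tu] by (simp add: pullback_def)
next
  fix c i j assume c: "c \<in> mfd_charts M" and i: "i < mfd_dim M" and j: "j < mfd_dim M"
  from mfd_iso_matched_chart[OF iso c] obtain d where d: "d \<in> mfd_charts N" and m: "matched h c d" by (elim bexE)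
  have ij: "i < mfd_dim N" "j < mfd_dim N" using i j mfd_isoD(3)[OF iso] by simp_all
  have "smooth_on (mfd_dim M) (snd c ` fst c) (coeff2 N \<omega> d i j)"
    using two_formsD(5)[OF \<omega> d ij] matched_image_eq[OF m] mfd_isoD(3)[OF iso] by simp
  then show "smooth_on (mfd_dim M) (snd c ` fst c) (coeff2 M (pullback M N h \<omega>) c i j)"
    by (rule smooth_on_cong[OF chart_image_open[OF mfd_is_chart[OF mfd_isoD(1)[OF iso] c]], rotated])
      (rule pullback_coeff[OF iso c d m i j, symmetric])
next
  obtain r where "\<forall>q\<in>carrier N. rank_at N \<omega> q = r" using two_formsD(6)[OF \<omega>] by (elim exE)
  then show "\<exists>r. \<forall>p\<in>carrier M. rank_at M (pullback M N h \<omega>) p = r"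
    using pullback_rank[OF iso] mfd_isoD(8)[OF iso] by (intro exI[of _ r]) simp
qed (auto simp: pullback_def)

text \<open>In matched charts both sides have the same coordinate expression.\<close>

lemma pullback_ext_deriv:
  assumes iso: "mfd_iso M N h g" and \<theta>: "\<theta> \<in> one_forms N"
  shows "pullback M N h (ext_deriv N \<theta>) = ext_deriv M (pullback1 M N h \<theta>)"
proof (intro ext)
  fix p u v
  show "pullback M N h (ext_deriv N \<theta>) p u v = ext_deriv M (pullback1 M N h \<theta>) p u v"
  proof (cases "p \<in> carrier M \<and> u \<in> tangent_space M p \<and> v \<in> tangent_space M p")
    case False
    then show ?thesis unfolding pullback_def ext_deriv_def by auto
  next
    case True
    then have p: "p \<in> carrier M" and u: "u \<in> tangent_space M p" and v: "v \<in> tangent_space M p" by auto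
    obtain c d where c: "c \<in> charts_at M p" and d: "d \<in> charts_at N (h p)" and m: "matched h c d"
      by (rule mfd_iso_matched_chart_at[OF iso p])
    note cM = charts_atD(1)[OF c] and dN = charts_atD(1)[OF d] and dim = mfd_isoD(3)[OF iso]
    have dp: "snd d (h p) = snd c p" using m charts_atD(2)[OF c] by (simp add: matched_def)
    have xc: "snd c p \<in> snd c ` fst c" using charts_atD(2)[OF c] by simp
    have pc: "partial i (coeff1 M (pullback1 M N h \<theta>) c j) (snd c p) = partial i (coeff1 N \<theta> d j) (snd c p)"
      if "i < mfd_dim M" "j < mfd_dim M" for i j
      by (rule partial_cong[OF chart_image_open[OF mfd_is_chart[OF mfd_isoD(1)[OF iso] cM]] xc that(1)])
        (rule pullback1_coeff[OF iso cM dN m that(2)])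
    have "pullback M N h (ext_deriv N \<theta>) p u v = ext_deriv N \<theta> (h p) (tangent_map M N h p u) (tangent_map M N h p v)"
      using True by (simp add: pullback_def)
    also have "\<dots> = chart_deriv N \<theta> d (h p) (tangent_map M N h p u) (tangent_map M N h p v)"
      by (rule ext_deriv_in_chart[OF mfd_isoD(2)[OF iso] \<theta> mfd_isoD(8)[OF iso p] d
            mfd_iso_tangent_map_in[OF iso p u] mfd_iso_tangent_map_in[OF iso p v]])
    also have "\<dots> = chart_deriv M (pullback1 M N h \<theta>) c p u v"
      unfolding dim dp
      by (intro sum.cong refl)
        (simp add: pc mfd_iso_tangent_map_coordinate[OF iso p u c d m] mfd_iso_tangent_map_coordinate[OF iso p v c d m])
    also have "\<dots> = ext_deriv M (pullback1 M N h \<theta>) p u v"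
      by (rule ext_deriv_in_chart[OF mfd_isoD(1)[OF iso] pullback1_one_form[OF iso \<theta>] p c u v, symmetric])
    finally show ?thesis .
  qed
qed

lemma pullback_exact:
  assumes iso: "mfd_iso M N h g" and \<omega>: "\<omega> \<in> exact_two_forms N"
  shows "pullback M N h \<omega> \<in> exact_two_forms M"
proof -
  from \<omega> obtain \<theta> where \<theta>: "\<omega> \<in> two_forms N" "\<theta> \<in> one_forms N" "\<omega> = ext_deriv N \<theta>"
    unfolding exact_two_forms_def by auto
  have "pullback M N h \<omega> = ext_deriv M (pullback1 M N h \<theta>)"
    unfolding \<theta>(3) by (rule pullback_ext_deriv[OF iso \<theta>(2)])
  then show ?thesis
    using pullback_two_form[OF iso \<theta>(1)] pullback1_one_form[OF iso \<theta>(2)]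
    unfolding exact_two_forms_def by auto
qed

lemma pullback_inverse:
  assumes iso: "mfd_iso M N h g" and \<omega>: "\<omega> \<in> two_forms M"
  shows "pullback M N h (pullback N M g \<omega>) = \<omega>"
proof (intro ext)
  fix p u v
  show "pullback M N h (pullback N M g \<omega>) p u v = \<omega> p u v"
  proof (cases "p \<in> carrier M \<and> u \<in> tangent_space M p \<and> v \<in> tangent_space M p")
    case False
    have "\<omega> p u v = 0"
    proof (cases "p \<in> carrier M \<and> u \<in> tangent_space M p")
      case True
      then show ?thesis using False cotangent_outside[OF two_formsD(1)[OF \<omega>]] by simp
    qed (use two_formsD(4)[OF \<omega>] in simp)
    then show ?thesis using False by (auto simp: pullback_def)
  next
    case True
    then have p: "p \<in> carrier M" and u: "u \<in> tangent_space M p" and v: "v \<in> tangent_space M p" by auto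
    show ?thesis
      using p u v mfd_isoD(6,8)[OF iso p]
      by (simp add: pullback_def mfd_iso_tangent_map_in[OF iso p] mfd_iso_tangent_map_inverse[OF iso p])
  qed
qed

section \<open>Bundles whose fibre is a point\<close>

lemma smooth_rep_empty: "smooth_rep n m c d F {}"
  unfolding smooth_rep_def by (auto intro: smooth_on_local)

lemma compatible_empty: "fst c = {} \<Longrightarrow> compatible n c d" "fst d = {} \<Longrightarrow> compatible n c d"
  by (simp_all add: compatible_iff_smooth_rep smooth_rep_empty)

lemma is_chart_empty: "fst c = {} \<Longrightarrow> is_chart X n c"
  by (simp add: is_chart_iff)

lemma is_chart_matched:
  assumes d: "is_chart Y n d" and m: "matched h c d" and c: "openin X (fst c)"
    and W: "\<And>W. W \<subseteq> fst c \<Longrightarrow> openin X W = openin Y (h ` W)"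
  shows "is_chart X n c"
  unfolding is_chart_iff
proof (intro conjI allI impI c)
  have eq: "snd d (h p) = snd c p" if "p \<in> fst c" for p using m that by (simp add: matched_def)
  have im: "fst d = h ` fst c" using m by (simp add: matched_def)
  show "inj_on (snd c) (fst c)"
  proof (rule inj_onI)
    fix p q assume pq: "p \<in> fst c" "q \<in> fst c" "snd c p = snd c q"
    then have "h p = h q" using inj_onD[OF chart_inj[OF d], of "h p" "h q"] eq im by simp
    then show "p = q" using pq m unfolding matched_def by (meson inj_onD)
  qed
  show "snd c ` fst c \<subseteq> rspace n" using chart_image_subset[OF d] matched_image_eq[OF m] by simp
  show "openin X V = openin (Euclidean_space n) (snd c ` V)" if "V \<subseteq> fst c" for V
    using W[OF that] chart_openness[OF d, of "h ` V"] that im matched_image[OF m that] by auto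
qed

text \<open>Products with a point. The projection to the other factor matches charts, because a chart of a
  point has no coordinates. The maximal atlas of the point also contains charts with empty domain; the charts
  that they give on the product are empty as well, and trivially compatible.\<close>

context
  fixes F :: "'f mfd" and z :: 'f and N :: "'a mfd"
  assumes F: "atlas_manifold F" "mfd_dim F = 0" "carrier F = {z}" and N: "atlas_manifold N"
begin

lemma prod_point_chart_matched:
  assumes "c \<in> mfd_charts N" "f \<in> charts_at F z"
  shows "matched fst (prod_chart (mfd_dim N) c f) c" "fst (prod_chart (mfd_dim N) c f) = fst c \<times> {z}"
proof -
  have f: "fst f = {z}"
  proof
    show "fst f \<subseteq> {z}"
    proof
      fix y assume "y \<in> fst f"
      from mfd_chart_in_carrier[OF F(1) charts_atD(1)[OF assms(2)] this] show "y \<in> {z}" by (simp only: F(3))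
    qed
  qed (use charts_atD(2)[OF assms(2)] in simp)
  then show 1: "fst (prod_chart (mfd_dim N) c f) = fst c \<times> {z}" by (simp add: prod_chart_def)
  have "snd f z \<in> rspace 0"
    using chart_image_subset[OF mfd_is_chart[OF F(1) charts_atD(1)[OF assms(2)]]] f F(2) by simp
  then have 2: "snd c p = snd (prod_chart (mfd_dim N) c f) (p, z)" if "p \<in> fst c" for p
    using chart_image_subset[OF mfd_is_chart[OF N assms(1)]] that
    by (auto simp: prod_chart_def fun_eq_iff in_rspace_iff image_subset_iff)
  show "matched fst (prod_chart (mfd_dim N) c f) c"
    unfolding matched_def 1 using 2 by (auto simp: inj_on_def)
qed

lemma prod_point_compatible_atlas:
  "compatible_atlas (prod_topology (mfd_top N) (mfd_top F)) (mfd_dim N)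
     {prod_chart (mfd_dim N) c f | c f. c \<in> mfd_charts N \<and> f \<in> mfd_charts F}"
  unfolding compatible_atlas_def
proof (intro conjI ballI)
  let ?X = "prod_topology (mfd_top N) (mfd_top F)" and ?n = "mfd_dim N"
  let ?A = "{prod_chart ?n c f | c f. c \<in> mfd_charts N \<and> f \<in> mfd_charts F}"
  have cases: "fst a = {} \<or> (\<exists>c f. c \<in> mfd_charts N \<and> f \<in> charts_at F z \<and> a = prod_chart ?n c f)"
    if "a \<in> ?A" for a
  proof -
    from \<open>a \<in> ?A\<close> obtain c f where cf: "c \<in> mfd_charts N" "f \<in> mfd_charts F" "a = prod_chart ?n c f"
      unfolding mem_Collect_eq by (elim exE conjE)
    show ?thesis
    proof (cases "z \<in> fst f")
      case True
      then show ?thesis using cf charts_atI[OF cf(2)] by blast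
    next
      case False
      then have "fst f = {}" using mfd_chart_in_carrier[OF F(1) cf(2)] F(3) by auto
      then show ?thesis using cf by (simp add: prod_chart_def)
    qed
  qed
  have z: "openin (mfd_top F) {z}" using F(3) openin_topspace[of "mfd_top F"] by simp
  have op: "openin ?X W = openin (mfd_top N) (fst ` W)" if "W \<subseteq> D \<times> {z}" for W D
  proof
    assume "openin ?X W"
    then show "openin (mfd_top N) (fst ` W)" using open_map_fst unfolding open_map_def by blast
  next
    assume "openin (mfd_top N) (fst ` W)"
    moreover have "W = fst ` W \<times> {z}" using that by force
    ultimately show "openin ?X W" using z openin_prod_Times_iff by metis
  qed
  show ch: "is_chart ?X ?n a" if a: "a \<in> ?A" for a
  proof (cases "fst a = {}")
    case False
    then obtain c f where cf: "c \<in> mfd_charts N" "f \<in> charts_at F z" "a = prod_chart ?n c f"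
      using cases[OF a] by (elim disjE exE conjE) simp
    note m = prod_point_chart_matched[OF cf(1,2), folded cf(3)]
    note ic = mfd_is_chart[OF N cf(1)]
    show ?thesis
    proof (rule is_chart_matched[OF ic m(1)])
      show "openin ?X (fst a)" unfolding m(2) openin_prod_Times_iff using chart_open[OF ic] z by simp
      show "openin ?X W = openin (mfd_top N) (fst ` W)" if "W \<subseteq> fst a" for W
        using that unfolding m(2) by (rule op)
    qed
  qed (rule is_chart_empty)
  show "compatible ?n a b" if a: "a \<in> ?A" and b: "b \<in> ?A" for a b
  proof (cases "fst a = {} \<or> fst b = {}")
    case True
    then show ?thesis using compatible_empty by (elim disjE)
  next
    case False
    obtain c f where cf: "c \<in> mfd_charts N" "f \<in> charts_at F z" "a = prod_chart ?n c f"
      using cases[OF a] False by (elim disjE exE conjE) simp_all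
    obtain d f' where df: "d \<in> mfd_charts N" "f' \<in> charts_at F z" "b = prod_chart ?n d f'"
      using cases[OF b] False by (elim disjE exE conjE) simp_all
    note ma = prod_point_chart_matched[OF cf(1,2), folded cf(3)]
    note mb = prod_point_chart_matched[OF df(1,2), folded df(3)]
    have o: "openin ?X (fst a \<inter> fst b)" using chart_open[OF ch[OF a]] chart_open[OF ch[OF b]] by (rule openin_Int)
    have "compatible ?n a b \<longleftrightarrow> compatible ?n c d"
    proof (rule matched_compatible[OF ma(1) mb(1) _ chart_inj[OF ch[OF a]] chart_inj[OF ch[OF b]]])
      show "inj_on fst (fst a \<union> fst b)" unfolding ma(2) mb(2) by (auto simp: inj_on_def)
      show "openin (Euclidean_space ?n) (snd a ` (fst a \<inter> fst b))"
        by (rule iffD1[OF chart_openness[OF ch[OF a]] o]) simp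
      show "openin (Euclidean_space ?n) (snd b ` (fst a \<inter> fst b))"
        by (rule iffD1[OF chart_openness[OF ch[OF b]] o]) simp
    qed
    then show ?thesis using mfd_compatible[OF N cf(1) df(1)] by simp
  qed
  show "(\<Union>a\<in>?A. fst a) = topspace ?X"
  proof
    show "(\<Union>a\<in>?A. fst a) \<subseteq> topspace ?X" using chart_in_topspace[OF ch] by blast
    show "topspace ?X \<subseteq> (\<Union>a\<in>?A. fst a)"
    proof
      fix x assume "x \<in> topspace ?X"
      then obtain p where p: "p \<in> carrier N" "x = (p, z)" using F(3) by auto
      obtain c where c: "c \<in> charts_at N p" by (rule charts_at_exists[OF N p(1)])
      obtain f where f: "f \<in> charts_at F z" by (rule charts_at_exists[OF F(1), of z]) (simp_all add: F(3))
      have "x \<in> fst (prod_chart ?n c f)"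
        unfolding prod_point_chart_matched(2)[OF charts_atD(1)[OF c] f] using charts_atD(2)[OF c] p(2) by simp
      moreover have "prod_chart ?n c f \<in> ?A" using charts_atD(1)[OF c] charts_atD(1)[OF f] by blast
      ultimately show "x \<in> (\<Union>a\<in>?A. fst a)" by (rule UN_I[rotated])
    qed
  qed
qed

lemma prod_point_atlas_manifold: "atlas_manifold (prod_mfd N F)"
  using mfd_generated_atlas_manifold[OF prod_point_compatible_atlas] by (simp add: prod_mfd_def F(2))

lemma prod_point_chart:
  assumes "c \<in> mfd_charts N" "f \<in> charts_at F z"
  shows "prod_chart (mfd_dim N) c f \<in> mfd_charts (prod_mfd N F)"
proof -
  have "prod_chart (mfd_dim N) c f \<in> {prod_chart (mfd_dim N) c f | c f. c \<in> mfd_charts N \<and> f \<in> mfd_charts F}"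
    using assms(1) charts_atD(1)[OF assms(2)] by blast
  then show ?thesis
    using subsetD[OF mfd_generated_superset[OF prod_point_compatible_atlas]] by (simp add: prod_mfd_def F(2))
qed

lemma prod_point_simps: "mfd_dim (prod_mfd N F) = mfd_dim N" "carrier (prod_mfd N F) = carrier N \<times> {z}"
  by (simp_all add: prod_mfd_def F(2,3))

end

lemma open_submfd_simps:
  "mfd_top (open_submfd M U) = subtopology (mfd_top M) U" "mfd_dim (open_submfd M U) = mfd_dim M"
  "c \<in> mfd_charts (open_submfd M U) \<longleftrightarrow> c \<in> mfd_charts M \<and> fst c \<subseteq> U"
  by (simp_all add: open_submfd_def)

text \<open>A chart inside \<open>U\<close> meets a chart \<open>a\<close> of \<open>M\<close> only inside
  \<open>U\<close>, so its compatibility with \<open>a\<close> follows from that with the restriction of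
  \<open>a\<close> to \<open>U\<close>.\<close>

lemma open_submfd_atlas_manifold:
  assumes M: "atlas_manifold M" and U: "openin (mfd_top M) U"
  shows "atlas_manifold (open_submfd M U)"
proof -
  have ic: "is_chart (subtopology (mfd_top M) U) n c \<longleftrightarrow> is_chart (mfd_top M) n c \<and> fst c \<subseteq> U" for c :: "'a chart" and n
  proof (cases "fst c \<subseteq> U")
    case True
    have *: "openin (subtopology (mfd_top M) U) W = openin (mfd_top M) W" if "W \<subseteq> fst c" for W
      using openin_open_subtopology[OF U, of W] True that by auto
    have "(\<forall>W. W \<subseteq> fst c \<longrightarrow> openin (subtopology (mfd_top M) U) W = openin (Euclidean_space n) (snd c ` W)) \<longleftrightarrow>
        (\<forall>W. W \<subseteq> fst c \<longrightarrow> openin (mfd_top M) W = openin (Euclidean_space n) (snd c ` W))"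
      using * by (simp cong: imp_cong)
    then show ?thesis using True unfolding is_chart_iff by (simp only: *[OF subset_refl] simp_thms)
  next
    case False
    then have "\<not> openin (subtopology (mfd_top M) U) (fst c)" using openin_open_subtopology[OF U] by simp
    then show ?thesis using False chart_open[of "subtopology (mfd_top M) U" n c] by blast
  qed
  have cov: "(\<Union>c\<in>mfd_charts (open_submfd M U). fst c) = topspace (subtopology (mfd_top M) U)"
  proof
    show "(\<Union>c\<in>mfd_charts (open_submfd M U). fst c) \<subseteq> topspace (subtopology (mfd_top M) U)"
    proof
      fix p assume "p \<in> (\<Union>c\<in>mfd_charts (open_submfd M U). fst c)"
      then obtain c where "c \<in> mfd_charts (open_submfd M U)" "p \<in> fst c" by (rule UN_E)
      then show "p \<in> topspace (subtopology (mfd_top M) U)"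
        using mfd_chart_in_carrier[OF M, of c p] by (auto simp: open_submfd_simps)
    qed
    show "topspace (subtopology (mfd_top M) U) \<subseteq> (\<Union>c\<in>mfd_charts (open_submfd M U). fst c)"
    proof
      fix p assume "p \<in> topspace (subtopology (mfd_top M) U)"
      then have p: "p \<in> carrier M" "p \<in> U" by auto
      obtain c where c: "c \<in> charts_at M p" by (rule charts_at_exists[OF M p(1)])
      show "p \<in> (\<Union>c\<in>mfd_charts (open_submfd M U). fst c)"
        by (rule UN_I[of "(fst c \<inter> U, snd c)"])
          (use restrict_chart[OF M charts_atD(1)[OF c] U] charts_atD(2)[OF c] p in \<open>simp_all add: open_submfd_simps\<close>)
    qed
  qed
  show ?thesis
    unfolding atlas_manifold_def compatible_atlas_def
  proof (intro conjI ballI allI impI)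
    fix c assume c: "is_chart (mfd_top (open_submfd M U)) (mfd_dim (open_submfd M U)) c"
      and comp: "\<forall>a\<in>mfd_charts (open_submfd M U). compatible (mfd_dim (open_submfd M U)) c a"
    have icM: "is_chart (mfd_top M) (mfd_dim M) c" and cU: "fst c \<subseteq> U"
      using c by (simp_all add: open_submfd_simps ic)
    have "compatible (mfd_dim M) c a" if a: "a \<in> mfd_charts M" for a
    proof -
      define a' where "a' = (fst a \<inter> U, snd a)"
      have a': "fst a' = fst a \<inter> U" "snd a' = snd a" by (simp_all add: a'_def)
      have a'M: "a' \<in> mfd_charts M" unfolding a'_def by (rule restrict_chart[OF M a U])
      then have cc: "compatible (mfd_dim M) c a'" using comp a' by (simp add: open_submfd_simps)
      have eq: "fst a \<inter> fst c = fst a' \<inter> fst c" "fst c \<inter> fst a = fst c \<inter> fst a'" using cU a' by auto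
      have W: "openin (mfd_top M) (fst a' \<inter> fst c)"
        by (intro openin_Int chart_open[OF icM] chart_open[OF mfd_is_chart[OF M a'M]])
      have inv: "chart_inv a' x = chart_inv a x" if "x \<in> snd a ` (fst a' \<inter> fst c)" for x
        by (rule chart_inv_restrict[OF chart_inj[OF mfd_is_chart[OF M a]]]) (use that a' in auto)
      have o: "openin (Euclidean_space (mfd_dim M)) (snd a ` (fst a' \<inter> fst c))"
        by (rule iffD1[OF chart_openness[OF mfd_is_chart[OF M a]] W]) (use a' in auto)
      have "smooth_rep (mfd_dim M) (mfd_dim M) c a (\<lambda>p. p) (fst c \<inter> fst a)"
        using cc unfolding eq by (simp add: compatible_iff_smooth_rep smooth_rep_def a'(2))
      moreover have "smooth_rep (mfd_dim M) (mfd_dim M) a c (\<lambda>p. p) (fst a \<inter> fst c)"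
        unfolding eq(1) smooth_rep_def
      proof (intro allI impI)
        fix j assume "j < mfd_dim M"
        then have "smooth_on (mfd_dim M) (snd a ` (fst a' \<inter> fst c)) (\<lambda>x. snd c (chart_inv a' x) j)"
          using cc by (simp add: compatible_iff_smooth_rep smooth_rep_def a'(2))
        then show "smooth_on (mfd_dim M) (snd a ` (fst a' \<inter> fst c)) (\<lambda>x. snd c (chart_inv a x) j)"
          by (rule smooth_on_cong[OF o, rotated]) (simp only: inv)
      qed
      ultimately show ?thesis by (simp add: compatible_iff_smooth_rep)
    qed
    from mfd_maximal[OF M icM this] show "c \<in> mfd_charts (open_submfd M U)"
      using cU by (simp add: open_submfd_simps)
  qed (use mfd_is_chart[OF M] mfd_compatible[OF M] cov in \<open>simp_all add: open_submfd_simps ic\<close>)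
qed

lemma matched_compose:
  assumes "matched h c d" "matched k d e"
  shows "matched (\<lambda>p. k (h p)) c e"
proof -
  have 1: "inj_on h (fst c)" "h ` fst c = fst d" "\<And>p. p \<in> fst c \<Longrightarrow> snd d (h p) = snd c p"
    and 2: "inj_on k (fst d)" "k ` fst d = fst e" "\<And>p. p \<in> fst d \<Longrightarrow> snd e (k p) = snd d p"
    using assms by (auto simp: matched_def)
  have "inj_on (k \<circ> h) (fst c)" using 1(1,2) 2(1) by (simp add: comp_inj_on)
  moreover have "(\<lambda>p. k (h p)) ` fst c = fst e" unfolding 1(2)[symmetric] 2(2)[symmetric] image_image ..
  moreover have "snd e (k (h p)) = snd c p" if "p \<in> fst c" for p
    using 1 2(3)[of "h p"] that by auto
  ultimately show ?thesis by (simp add: matched_def comp_def)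
qed

lemma matched_cong:
  assumes "matched h c d" "\<And>p. p \<in> fst c \<Longrightarrow> h p = k p"
  shows "matched k c d"
  using assms inj_on_cong[of "fst c" h k] image_cong[of "fst c" "fst c" h k] by (simp add: matched_def)

text \<open>Over a trivializing set \<open>U\<close>, the projection is a trivialization followed by
  \<open>fst\<close> on \<open>U \<times> {z}\<close>. Both maps are injective and match charts, so the
  projection is bijective and matches charts around every point.\<close>

lemma point_bundle_diffeomorphism:
  assumes E: "atlas_manifold E" and B: "atlas_manifold B" and dim: "mfd_dim E = mfd_dim B"
    and F: "atlas_manifold F" "mfd_dim F = 0" "carrier F = {z}"
    and fb: "fibre_bundle E B F pr"
  shows "diffeomorphism E B pr"
proof -
  have pr: "smooth_map E B pr" using fb by (simp add: fibre_bundle_def)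
  have triv: "\<exists>U \<Phi>. openin (mfd_top B) U \<and> b \<in> U \<and>
      diffeomorphism (open_submfd E {e \<in> carrier E. pr e \<in> U}) (prod_mfd (open_submfd B U) F) \<Phi> \<and>
      (\<forall>e\<in>carrier E. pr e \<in> U \<longrightarrow> fst (\<Phi> e) = pr e)" if "b \<in> carrier B" for b
    using fb that unfolding fibre_bundle_def by blast
  have loc: "(\<exists>e\<in>carrier E. pr e = b) \<and> (\<forall>e\<in>carrier E. \<forall>e'\<in>carrier E. pr e = b \<longrightarrow> pr e' = b \<longrightarrow> e = e') \<and>
      (\<forall>e\<in>carrier E. pr e = b \<longrightarrow> (\<exists>d\<in>charts_at E e. \<exists>c\<in>mfd_charts B. matched pr d c))"
    if b: "b \<in> carrier B" for b
  proof -
    from triv[OF b] obtain U \<Phi> where U: "openin (mfd_top B) U" "b \<in> U"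
      and \<Phi>: "diffeomorphism (open_submfd E {e \<in> carrier E. pr e \<in> U}) (prod_mfd (open_submfd B U) F) \<Phi>"
      and fst\<Phi>: "\<forall>e\<in>carrier E. pr e \<in> U \<longrightarrow> fst (\<Phi> e) = pr e" by (elim exE conjE)
    define V where "V = {e \<in> carrier E. pr e \<in> U}"
    let ?E = "open_submfd E V" and ?B = "open_submfd B U"
    have V: "openin (mfd_top E) V" unfolding V_def by (rule smooth_map_preimage_open[OF pr U(1)])
    have VE: "V \<subseteq> carrier E" unfolding V_def by auto
    note aE = open_submfd_atlas_manifold[OF E V] and aB = open_submfd_atlas_manifold[OF B U(1)]
    note aP = prod_point_atlas_manifold[OF F aB]
    define \<Psi> where "\<Psi> = inv_into (carrier ?E) \<Phi>"
    have iso: "mfd_iso ?E (prod_mfd ?B F) \<Phi> \<Psi>"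
      unfolding \<Psi>_def
      by (rule diffeomorphism_imp_mfd_iso[OF aE aP _ \<Phi>[folded V_def]])
        (simp add: prod_point_simps[OF F aB] open_submfd_simps dim)
    have cE: "carrier ?E = V" using VE by (auto simp: open_submfd_simps)
    have cP: "carrier (prod_mfd ?B F) = U \<times> {z}"
      using openin_subset[OF U(1)] by (auto simp: prod_point_simps[OF F aB] open_submfd_simps)
    have \<Phi>V: "\<Phi> e = (pr e, z)" if "e \<in> V" for e
    proof -
      have "\<Phi> e \<in> U \<times> {z}" using mfd_isoD(8)[OF iso] that cE cP by simp
      then show ?thesis using fst\<Phi> that unfolding V_def by (auto simp: prod_eq_iff)
    qed
    have \<Psi>V: "\<Psi> (\<Phi> e) = e" if "e \<in> V" for e using mfd_isoD(6)[OF iso] that cE by simp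
    have "\<Psi> (b, z) \<in> V" "\<Phi> (\<Psi> (b, z)) = (b, z)"
      using mfd_isoD(8)[OF mfd_iso_sym[OF iso], of "(b, z)"] mfd_isoD(7)[OF iso, of "(b, z)"] U(2) cE cP by simp_all
    then have 1: "\<exists>e\<in>carrier E. pr e = b"
      using \<Phi>V VE by (intro bexI[of _ "\<Psi> (b, z)"]) auto
    have 2: "e = e'" if "e \<in> carrier E" "e' \<in> carrier E" "pr e = b" "pr e' = b" for e e'
    proof -
      have "e \<in> V" "e' \<in> V" using that U(2) by (auto simp: V_def)
      then show ?thesis using \<Psi>V \<Phi>V that by metis
    qed
    have 3: "\<exists>d\<in>charts_at E e. \<exists>c\<in>mfd_charts B. matched pr d c" if e: "e \<in> carrier E" "pr e = b" for e
    proof -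
      have eV: "e \<in> V" using e U(2) by (simp add: V_def)
      have "b \<in> carrier ?B" using b U(2) by (simp add: open_submfd_simps)
      then obtain c where c: "c \<in> charts_at ?B b" by (rule charts_at_exists[OF aB])
      obtain f where f: "f \<in> charts_at F z" by (rule charts_at_exists[OF F(1), of z]) (simp_all add: F(3))
      let ?pc = "prod_chart (mfd_dim ?B) c f"
      note cB = charts_atD(1)[OF c]
      note m1 = prod_point_chart_matched[OF F aB cB f]
      from mfd_iso_matched_chart[OF mfd_iso_sym[OF iso] prod_point_chart[OF F aB cB f]]
      obtain d where d: "d \<in> mfd_charts ?E" and md: "matched \<Psi> ?pc d" by (elim bexE)
      have sub: "fst ?pc \<subseteq> U \<times> {z}"
        using cB unfolding m1(2) by (auto simp: open_submfd_simps)
      have m2: "matched \<Phi> d ?pc"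
        by (rule matched_inverse[OF md]) (use mfd_isoD(7)[OF iso] cP sub in blast)
      have dV: "fst d \<subseteq> V" using d by (simp add: open_submfd_simps)
      have m3: "matched pr d c"
        by (rule matched_cong[OF matched_compose[OF m2 m1(1)]]) (use \<Phi>V dV in auto)
      have "\<Phi> e \<in> fst ?pc" unfolding m1(2) \<Phi>V[OF eV] using charts_atD(2)[OF c] e(2) by simp
      then have "\<Psi> (\<Phi> e) \<in> fst d" using md unfolding matched_def by blast
      then have "d \<in> charts_at E e" using d \<Psi>V[OF eV] by (intro charts_atI) (simp_all add: open_submfd_simps)
      moreover have "c \<in> mfd_charts B" using cB by (simp add: open_submfd_simps)
      ultimately show ?thesis using m3 by (intro bexI[of _ d] bexI[of _ c])
    qed
    show ?thesis using 1 2 3 by (intro conjI ballI impI)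
  qed
  have prB: "pr e \<in> carrier B" if "e \<in> carrier E" for e using smooth_map_in_carrier[OF pr that] .
  show ?thesis
  proof (rule diffeomorphismI[OF E B dim[symmetric]])
    show "bij_betw pr (carrier E) (carrier B)"
      unfolding bij_betw_def
    proof
      show "inj_on pr (carrier E)"
      proof (rule inj_onI)
        fix e e' assume "e \<in> carrier E" "e' \<in> carrier E" "pr e = pr e'"
        with loc[OF prB[of e']] show "e = e'" by simp
      qed
      show "pr ` carrier E = carrier B"
      proof
        show "carrier B \<subseteq> pr ` carrier E"
        proof
          fix b assume "b \<in> carrier B"
          from loc[OF this] obtain e where "e \<in> carrier E" "pr e = b" by (elim conjE bexE)
          then show "b \<in> pr ` carrier E" by auto
        qed
      qed (use prB in auto)
    qed
    fix e assume e: "e \<in> carrier E"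
    from loc[OF prB[OF e]] e show "\<exists>d\<in>charts_at E e. \<exists>c\<in>mfd_charts B. matched pr d c"
      by (elim conjE) simp
  qed
qed

section \<open>From rank-zero bundles to forms on the base\<close>

text \<open>The projection of \<open>S\<close> to \<open>Q\<close> is a diffeomorphism. The forms on
  \<open>Q\<close> are the pullbacks along its inverse: they are exact because pullbacks preserve exactness,
  and pulling them back again gives the forms on \<open>S\<close>. Uniqueness holds because the pullback along
  the projection can be undone.\<close>

lemma two_forms_of_rank_zero_bundle:
  assumes Q: "atlas_manifold Q" and S: "rank_zero_exact_cfp Q k S \<omega>S"
  shows "\<exists>!\<omega>Q. \<omega>Q \<in> {1..k} \<rightarrow>\<^sub>E exact_two_forms Q \<and>
    (\<forall>\<alpha>\<in>{1..k}. pullback (foliated_mfd Q k 0 S) Q whitney_proj (\<omega>Q \<alpha>) = \<omega>S \<alpha>)"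
proof -
  let ?M = "foliated_mfd Q k 0 S"
  have "\<exists>F :: 'a wpoint mfd. canonical_foliated_presymplectic Q k F S \<omega>S \<and> mfd_dim F = 0 \<and> (\<exists>z. carrier F = {z})"
    and exact: "\<And>\<alpha>. \<alpha> \<in> {1..k} \<Longrightarrow> \<omega>S \<alpha> \<in> exact_two_forms ?M"
    using S unfolding rank_zero_exact_cfp_def by simp_all
  then obtain F :: "'a wpoint mfd" and z where cfp: "canonical_foliated_presymplectic Q k F S \<omega>S"
    and F: "mfd_dim F = 0" "carrier F = {z}" by (elim exE conjE)
  have aF: "atlas_manifold F" and aM: "atlas_manifold ?M" and fb: "fibre_bundle ?M Q F whitney_proj"
    using cfp F(1) unfolding canonical_foliated_presymplectic_def connected_manifold_def
    by (auto intro: smooth_manifold_imp_atlas_manifold)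
  have dim: "mfd_dim ?M = mfd_dim Q" by (simp add: foliated_mfd_def submfd_def)
  define g where "g = inv_into (carrier ?M) (whitney_proj :: 'a wpoint \<Rightarrow> 'a)"
  have iso: "mfd_iso ?M Q whitney_proj g"
    unfolding g_def
    by (rule diffeomorphism_imp_mfd_iso[OF aM Q dim[symmetric] point_bundle_diffeomorphism[OF aM Q dim aF F fb]])
  note iso' = mfd_iso_sym[OF iso]
  have two: "\<omega> \<in> two_forms N" if "\<omega> \<in> exact_two_forms N" for \<omega> and N :: "'b mfd"
    using that by (simp add: exact_two_forms_def)
  show ?thesis
  proof (rule ex1I[of _ "\<lambda>\<alpha>\<in>{1..k}. pullback Q ?M g (\<omega>S \<alpha>)"])
    show "(\<lambda>\<alpha>\<in>{1..k}. pullback Q ?M g (\<omega>S \<alpha>)) \<in> {1..k} \<rightarrow>\<^sub>E exact_two_forms Q \<and>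
      (\<forall>\<alpha>\<in>{1..k}. pullback ?M Q whitney_proj ((\<lambda>\<alpha>\<in>{1..k}. pullback Q ?M g (\<omega>S \<alpha>)) \<alpha>) = \<omega>S \<alpha>)"
      using pullback_exact[OF iso' exact] pullback_inverse[OF iso two[OF exact]] by simp
    fix \<omega>Q assume \<omega>Q: "\<omega>Q \<in> {1..k} \<rightarrow>\<^sub>E exact_two_forms Q \<and>
      (\<forall>\<alpha>\<in>{1..k}. pullback ?M Q whitney_proj (\<omega>Q \<alpha>) = \<omega>S \<alpha>)"
    show "\<omega>Q = (\<lambda>\<alpha>\<in>{1..k}. pullback Q ?M g (\<omega>S \<alpha>))"
    proof (rule PiE_ext)
      show "\<omega>Q \<in> {1..k} \<rightarrow>\<^sub>E exact_two_forms Q" using \<omega>Q by (rule conjunct1)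
      show "(\<lambda>\<alpha>\<in>{1..k}. pullback Q ?M g (\<omega>S \<alpha>)) \<in> {1..k} \<rightarrow>\<^sub>E exact_two_forms Q"
        using pullback_exact[OF iso' exact] by simp
      fix \<alpha> assume \<alpha>: "\<alpha> \<in> {1..k}"
      have "\<omega>Q \<alpha> \<in> exact_two_forms Q" using \<omega>Q \<alpha> by (blast intro: PiE_mem)
      from pullback_inverse[OF iso' two[OF this]]
      show "\<omega>Q \<alpha> = (\<lambda>\<alpha>\<in>{1..k}. pullback Q ?M g (\<omega>S \<alpha>)) \<alpha>"
        using \<omega>Q \<alpha> by simp
    qed
  qed
qed

section \<open>Atlas topologies and changes of coordinates\<close>

text \<open>Since the overlaps have open images, the chart domains are open in the atlas topology; since the
  transitions are continuous, openness of a subset of a chart domain can be tested in that chart alone.\<close>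

lemma atlas_topology_compatible_atlas:
  assumes inj: "\<And>c. c \<in> A \<Longrightarrow> inj_on (snd c) (fst c)"
    and im: "\<And>c. c \<in> A \<Longrightarrow> openin (Euclidean_space n) (snd c ` fst c)"
    and ov: "\<And>c d. c \<in> A \<Longrightarrow> d \<in> A \<Longrightarrow> openin (Euclidean_space n) (snd c ` (fst c \<inter> fst d))"
    and comp: "\<And>c d. c \<in> A \<Longrightarrow> d \<in> A \<Longrightarrow> compatible n c d"
  shows "compatible_atlas (atlas_topology n A) n A"
proof -
  define P where "P W \<longleftrightarrow> W \<subseteq> (\<Union>c\<in>A. fst c) \<and> (\<forall>c\<in>A. openin (Euclidean_space n) (snd c ` (W \<inter> fst c)))" for W
  have "istopology P"
    unfolding istopology_def
  proof (intro conjI allI impI)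
    fix S T assume S: "P S" and T: "P T"
    have "openin (Euclidean_space n) (snd c ` (S \<inter> T \<inter> fst c))" if c: "c \<in> A" for c
    proof -
      have "snd c ` ((S \<inter> fst c) \<inter> (T \<inter> fst c)) = snd c ` (S \<inter> fst c) \<inter> snd c ` (T \<inter> fst c)"
        by (rule inj_on_image_Int[OF inj[OF c]]) auto
      moreover have "(S \<inter> fst c) \<inter> (T \<inter> fst c) = S \<inter> T \<inter> fst c" by auto
      ultimately show ?thesis using S T c by (simp add: P_def openin_Int)
    qed
    then show "P (S \<inter> T)" using S by (auto simp: P_def)
  next
    fix K assume K: "\<forall>S\<in>K. P S"
    have "openin (Euclidean_space n) (snd c ` (\<Union>K \<inter> fst c))" if c: "c \<in> A" for c
    proof -
      have "snd c ` (\<Union>K \<inter> fst c) = (\<Union>S\<in>K. snd c ` (S \<inter> fst c))" by auto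
      moreover have "openin (Euclidean_space n) (\<Union>S\<in>K. snd c ` (S \<inter> fst c))"
        using K c by (intro openin_Union) (auto simp: P_def)
      ultimately show ?thesis by simp
    qed
    moreover have "\<Union>K \<subseteq> (\<Union>c\<in>A. fst c)" using K by (auto simp: P_def)
    ultimately show "P (\<Union>K)" by (simp add: P_def)
  qed
  then have open_iff: "openin (atlas_topology n A) W \<longleftrightarrow> P W" for W
    unfolding atlas_topology_def P_def by (simp add: topology_inverse')
  have sub: "fst c \<subseteq> (\<Union>c\<in>A. fst c)" if "c \<in> A" for c using that by auto
  have "P (\<Union>c\<in>A. fst c)"
    unfolding P_def
  proof (intro conjI ballI subset_refl)
    fix c assume c: "c \<in> A"
    have "(\<Union>c\<in>A. fst c) \<inter> fst c = fst c" using sub[OF c] by (rule Int_absorb1)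
    then show "openin (Euclidean_space n) (snd c ` ((\<Union>c\<in>A. fst c) \<inter> fst c))" using im[OF c] by simp
  qed
  then have "openin (atlas_topology n A) (\<Union>c\<in>A. fst c)" by (simp only: open_iff)
  then have top: "topspace (atlas_topology n A) = (\<Union>c\<in>A. fst c)"
    using openin_subset openin_topspace[of "atlas_topology n A"] unfolding open_iff[of "topspace _"] P_def
    by (intro subset_antisym) auto
  have ch: "is_chart (atlas_topology n A) n c" if c: "c \<in> A" for c
    unfolding is_chart_iff
  proof (intro conjI allI impI inj[OF c])
    have "P (fst c)" unfolding P_def using sub[OF c] ov[OF _ c] by (simp add: Int_commute)
    then show "openin (atlas_topology n A) (fst c)" by (simp only: open_iff)
    show r: "snd c ` fst c \<subseteq> rspace n" by (rule openin_Euclidean_subset[OF im[OF c]])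
    fix W assume W: "W \<subseteq> fst c"
    show "openin (atlas_topology n A) W = openin (Euclidean_space n) (snd c ` W)"
      unfolding open_iff
    proof
      assume "P W"
      then have "openin (Euclidean_space n) (snd c ` (W \<inter> fst c))" using c by (simp add: P_def)
      then show "openin (Euclidean_space n) (snd c ` W)" using W by (simp add: Int_absorb2)
    next
      assume V: "openin (Euclidean_space n) (snd c ` W)"
      have "openin (Euclidean_space n) (snd d ` (W \<inter> fst d))" if d: "d \<in> A" for d
      proof -
        let ?F = "\<lambda>x. snd c (chart_inv d x)" and ?U = "snd d ` (fst d \<inter> fst c)"
        have inv: "chart_inv d (snd d p) = p" if "p \<in> fst d" for p
          by (rule chart_inv_left[OF inj[OF d] that])
        have "openin (Euclidean_space n) {x \<in> ?U. ?F x \<in> snd c ` W}"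
        proof (rule smooth_preimage_open[OF ov[OF d c] V])
          show "smooth_on n ?U (\<lambda>x. ?F x j)" if "j < n" for j
            using comp[OF d c] that by (simp add: compatible_def smooth_transition_def)
          show "?F ` ?U \<subseteq> rspace n" using r inv by auto
        qed
        moreover have "{x \<in> ?U. ?F x \<in> snd c ` W} = snd d ` (W \<inter> fst d)"
        proof
          show "{x \<in> ?U. ?F x \<in> snd c ` W} \<subseteq> snd d ` (W \<inter> fst d)"
          proof
            fix x assume "x \<in> {x \<in> ?U. ?F x \<in> snd c ` W}"
            then obtain p p' where p: "x = snd d p" "p \<in> fst d" "p \<in> fst c" "p' \<in> W" "?F x = snd c p'" by auto
            then have "snd c p = snd c p'" using inv by simp
            then have "p = p'" by (rule inj_onD[OF inj[OF c]]) (use p W in auto)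
            then show "x \<in> snd d ` (W \<inter> fst d)" using p by simp
          qed
          show "snd d ` (W \<inter> fst d) \<subseteq> {x \<in> ?U. ?F x \<in> snd c ` W}"
          proof
            fix x assume "x \<in> snd d ` (W \<inter> fst d)"
            then obtain p where p: "p \<in> W" "p \<in> fst d" "x = snd d p" by auto
            then show "x \<in> {x \<in> ?U. ?F x \<in> snd c ` W}" using inv W by auto
          qed
        qed
        ultimately show ?thesis by simp
      qed
      then show "P W" using W sub[OF c] by (auto simp: P_def)
    qed
  qed
  show ?thesis using ch comp top by (simp add: compatible_atlas_def)
qed

text \<open>Composing a chart with a diffeomorphism of its image gives a chart of the same atlas: open subsets
  keep open images, and a new transition is an old one composed with the diffeomorphism or its inverse.\<close>

lemma chart_change:
  assumes c: "is_chart X n c" and c': "fst c' = fst c" "\<And>p. p \<in> fst c \<Longrightarrow> snd c' p = \<phi> (snd c p)"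
    and V: "V = snd c ` fst c"
    and inv: "\<And>x. x \<in> V \<Longrightarrow> \<phi> x \<in> V" "\<And>x. x \<in> V \<Longrightarrow> \<psi> x \<in> V"
      "\<And>x. x \<in> V \<Longrightarrow> \<psi> (\<phi> x) = x" "\<And>x. x \<in> V \<Longrightarrow> \<phi> (\<psi> x) = x"
    and smooth: "\<And>j. j < n \<Longrightarrow> smooth_on n V (\<lambda>x. \<phi> x j)" "\<And>j. j < n \<Longrightarrow> smooth_on n V (\<lambda>x. \<psi> x j)"
  shows "is_chart X n c'" "snd c' ` fst c' = V"
    "is_chart X n d \<Longrightarrow> compatible n c d \<Longrightarrow> compatible n c' d"
proof -
  have oV: "openin (Euclidean_space n) V" unfolding V by (rule chart_image_open[OF c])
  have Vr: "V \<subseteq> rspace n" by (rule openin_Euclidean_subset[OF oV])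
  have cV: "snd c p \<in> V" if "p \<in> fst c" for p using that by (simp add: V)
  show im: "snd c' ` fst c' = V"
  proof
    show "snd c' ` fst c' \<subseteq> V" using c' inv(1) cV by auto
    show "V \<subseteq> snd c' ` fst c'"
    proof
      fix x assume x: "x \<in> V"
      then obtain p where p: "p \<in> fst c" "\<psi> x = snd c p" using inv(2) V by blast
      then have "snd c' p = x" using c'(2)[OF p(1)] inv(4)[OF x] by simp
      then show "x \<in> snd c' ` fst c'" using p(1) c'(1) by auto
    qed
  qed
  have inj': "inj_on (snd c') (fst c')"
  proof (rule inj_onI)
    fix p q assume pq: "p \<in> fst c'" "q \<in> fst c'" "snd c' p = snd c' q"
    then have "\<psi> (\<phi> (snd c p)) = \<psi> (\<phi> (snd c q))" using c' by simp
    then have "snd c p = snd c q" using pq inv(3) cV c'(1) by simp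
    then show "p = q" using pq c'(1) inj_onD[OF chart_inj[OF c]] by simp
  qed
  show ch: "is_chart X n c'"
    unfolding is_chart_iff
  proof (intro conjI allI impI inj')
    show "openin X (fst c')" using chart_open[OF c] c'(1) by simp
    show "snd c' ` fst c' \<subseteq> rspace n" using im Vr by simp
    fix W assume W: "W \<subseteq> fst c'"
    let ?B = "snd c ` W"
    have BV: "?B \<subseteq> V" using W c'(1) cV by auto
    have eq: "snd c' ` W = \<phi> ` ?B" using W c' by (force simp: image_image)
    have "openin (Euclidean_space n) ?B = openin (Euclidean_space n) (\<phi> ` ?B)"
    proof
      assume B: "openin (Euclidean_space n) ?B"
      have "openin (Euclidean_space n) {x \<in> V. \<psi> x \<in> ?B}"
        by (rule smooth_preimage_open[OF oV B smooth(2)]) (use inv(2) Vr in auto)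
      moreover have "{x \<in> V. \<psi> x \<in> ?B} = \<phi> ` ?B"
      proof
        show "{x \<in> V. \<psi> x \<in> ?B} \<subseteq> \<phi> ` ?B"
        proof
          fix x assume x: "x \<in> {x \<in> V. \<psi> x \<in> ?B}"
          then have "x = \<phi> (\<psi> x)" using inv(4) by simp
          then show "x \<in> \<phi> ` ?B" by (rule image_eqI[of x \<phi> "\<psi> x"]) (use x in simp)
        qed
        show "\<phi> ` ?B \<subseteq> {x \<in> V. \<psi> x \<in> ?B}"
        proof
          fix x assume "x \<in> \<phi> ` ?B"
          then obtain y where y: "y \<in> ?B" "x = \<phi> y" by (rule imageE)
          then have "y \<in> V" using BV by blast
          then show "x \<in> {x \<in> V. \<psi> x \<in> ?B}" using y inv(1,3) by simp
        qed
      qed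
      ultimately show "openin (Euclidean_space n) (\<phi> ` ?B)" by simp
    next
      assume B: "openin (Euclidean_space n) (\<phi> ` ?B)"
      have "openin (Euclidean_space n) {x \<in> V. \<phi> x \<in> \<phi> ` ?B}"
        by (rule smooth_preimage_open[OF oV B smooth(1)]) (use inv(1) Vr in auto)
      moreover have "{x \<in> V. \<phi> x \<in> \<phi> ` ?B} = ?B"
      proof
        show "{x \<in> V. \<phi> x \<in> \<phi> ` ?B} \<subseteq> ?B"
        proof
          fix x assume "x \<in> {x \<in> V. \<phi> x \<in> \<phi> ` ?B}"
          then have x: "x \<in> V" "\<phi> x \<in> \<phi> ` ?B" by simp_all
          from x(2) obtain y where y: "\<phi> x = \<phi> y" "y \<in> ?B" by (rule imageE)
          have "\<psi> (\<phi> x) = \<psi> (\<phi> y)" using y(1) by (rule arg_cong)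
          then have "x = y" unfolding inv(3)[OF x(1)] inv(3)[OF subsetD[OF BV y(2)]] .
          then show "x \<in> ?B" using y(2) by (simp only:)
        qed
      qed (use BV in auto)
      ultimately show "openin (Euclidean_space n) ?B" by simp
    qed
    then show "openin X W = openin (Euclidean_space n) (snd c' ` W)"
      using chart_openness[OF c, of W] W c'(1) eq by simp
  qed
  have inv': "chart_inv c' x = chart_inv c (\<psi> x)" "snd c (chart_inv c' x) = \<psi> x" if x: "x \<in> V" for x
  proof -
    let ?p = "chart_inv c (\<psi> x)"
    have p: "?p \<in> fst c" "snd c ?p = \<psi> x" using chart_inv_right[of "\<psi> x" c] inv(2)[OF x] V by simp_all
    have "snd c' ?p = x" using c'(2)[OF p(1)] p(2) inv(4)[OF x] by simp
    then have "chart_inv c' x = ?p" using chart_inv_left[OF inj', of ?p] p(1) c'(1) by simp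
    then show "chart_inv c' x = chart_inv c (\<psi> x)" "snd c (chart_inv c' x) = \<psi> x" using p(2) by simp_all
  qed
  have s1: "smooth_rep n n c' c (\<lambda>p. p) (fst c)"
    unfolding smooth_rep_def
  proof (intro allI impI)
    fix j assume j: "j < n"
    have "smooth_on n V (\<lambda>x. snd c (chart_inv c' x) j)"
      by (rule smooth_on_cong[OF oV _ smooth(2)[OF j]]) (simp only: inv'(2))
    then show "smooth_on n (snd c' ` fst c) (\<lambda>x. snd c (chart_inv c' x) j)" using im c'(1) by simp
  qed
  have s2: "smooth_rep n n c c' (\<lambda>p. p) (fst c)"
    unfolding smooth_rep_def
  proof (intro allI impI)
    fix j assume j: "j < n"
    show "smooth_on n (snd c ` fst c) (\<lambda>x. snd c' (chart_inv c x) j)"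
      unfolding V[symmetric]
    proof (rule smooth_on_cong[OF oV _ smooth(1)[OF j]])
      fix x assume "x \<in> V"
      then show "\<phi> x j = snd c' (chart_inv c x) j"
        using c'(2)[OF chart_inv_right(2)[of x c]] chart_inv_right(1)[of x c] V by simp
    qed
  qed
  show "compatible n c' d" if d: "is_chart X n d" and cd: "compatible n c d"
  proof -
    have W: "openin X (fst c \<inter> fst d)" by (intro openin_Int chart_open[OF c] chart_open[OF d])
    have t1: "smooth_rep n n c d (\<lambda>p. p) (fst c \<inter> fst d)" and t2: "smooth_rep n n d c (\<lambda>p. p) (fst c \<inter> fst d)"
      using cd unfolding compatible_iff_smooth_rep by (simp_all add: Int_commute)
    have "smooth_rep n n c' d (\<lambda>p. p) (fst c \<inter> fst d)"
      by (rule smooth_rep_compose[OF ch c W _ W _ smooth_rep_subset[OF s1] _ t1]) (use c'(1) in auto)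
    moreover have "smooth_rep n n d c' (\<lambda>p. p) (fst c \<inter> fst d)"
      by (rule smooth_rep_compose[OF d c W _ W _ t2 _ smooth_rep_subset[OF s2]]) auto
    ultimately show ?thesis unfolding compatible_iff_smooth_rep c'(1) by (simp add: Int_commute)
  qed
qed

section \<open>Embedded submanifolds\<close>

lemma openin_Euclidean_Int_rspace:
  assumes "openin (Euclidean_space m) B" "n \<le> m"
  shows "openin (Euclidean_space n) (B \<inter> rspace n)"
proof -
  obtain T where T: "open T" "B = rspace m \<inter> T"
    using assms(1) unfolding Euclidean_space_eq_top_of_set openin_open by auto
  have "B \<inter> rspace n = rspace n \<inter> T" using T(2) assms(2) by (auto simp: in_rspace_iff)
  then show ?thesis using T(1) unfolding Euclidean_space_eq_top_of_set openin_open by auto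
qed

text \<open>A slice chart identifies \<open>S\<close> locally with the part of its image in R^n. This
  identifies the open sets, because R^n carries the subspace topology of the ambient space, and the
  transitions are restrictions of the ambient ones.\<close>

lemma slice_compatible_atlas:
  assumes N: "atlas_manifold N" and S: "embedded_submanifold N n S"
  shows "compatible_atlas (subtopology (mfd_top N) S) n {(fst c \<inter> S, snd c) | c. c \<in> slice_charts N n S}"
proof -
  let ?m = "mfd_dim N" and ?X = "subtopology (mfd_top N) S"
  let ?A = "{(fst c \<inter> S, snd c) | c. c \<in> slice_charts N n S}"
  have nm: "n \<le> ?m" and SN: "S \<subseteq> carrier N" and cov: "\<And>p. p \<in> S \<Longrightarrow> \<exists>c\<in>slice_charts N n S. p \<in> fst c"
    using S unfolding embedded_submanifold_def by simp_all
  have cN: "c \<in> mfd_charts N" and slice: "snd c ` (fst c \<inter> S) = snd c ` fst c \<inter> rspace n"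
    if "c \<in> slice_charts N n S" for c
    using that unfolding slice_charts_def rspace_def by auto
  have ch: "is_chart ?X n r" if c: "c \<in> slice_charts N n S" and r: "fst r = fst c \<inter> S" "snd r = snd c" for c r
    unfolding is_chart_iff r
  proof (intro conjI allI impI)
    note ic = mfd_is_chart[OF N cN[OF c]]
    show "openin ?X (fst c \<inter> S)" using chart_open[OF ic] by (auto simp: openin_subtopology)
    show "inj_on (snd c) (fst c \<inter> S)" by (rule inj_on_subset[OF chart_inj[OF ic]]) simp
    show "snd c ` (fst c \<inter> S) \<subseteq> rspace n" unfolding slice[OF c] by simp
    fix V assume V: "V \<subseteq> fst c \<inter> S"
    show "openin ?X V = openin (Euclidean_space n) (snd c ` V)"
    proof
      assume "openin ?X V"
      then obtain T where T: "openin (mfd_top N) T" "V = T \<inter> S" unfolding openin_subtopology by auto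
      have oT: "openin (mfd_top N) (T \<inter> fst c)" by (intro openin_Int T(1) chart_open[OF ic])
      have "snd c ` ((T \<inter> fst c) \<inter> (fst c \<inter> S)) = snd c ` (T \<inter> fst c) \<inter> snd c ` (fst c \<inter> S)"
        by (rule inj_on_image_Int[OF chart_inj[OF ic]]) auto
      moreover have "(T \<inter> fst c) \<inter> (fst c \<inter> S) = V" using T(2) V by auto
      ultimately have "snd c ` V = snd c ` (T \<inter> fst c) \<inter> rspace n" unfolding slice[OF c] by auto
      moreover have "openin (Euclidean_space ?m) (snd c ` (T \<inter> fst c))"
        by (rule iffD1[OF chart_openness[OF ic] oT]) simp
      ultimately show "openin (Euclidean_space n) (snd c ` V)"
        using openin_Euclidean_Int_rspace[OF _ nm] by simp
    next
      assume "openin (Euclidean_space n) (snd c ` V)"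
      then obtain T where T: "open T" "snd c ` V = rspace n \<inter> T"
        unfolding Euclidean_space_eq_top_of_set openin_open by auto
      define T' where "T' = {p \<in> fst c. snd c p \<in> T}"
      have "snd c ` T' = snd c ` fst c \<inter> (rspace ?m \<inter> T)"
        using chart_image_subset[OF ic] unfolding T'_def by auto
      moreover have "openin (Euclidean_space ?m) (rspace ?m \<inter> T)"
        using T(1) unfolding Euclidean_space_eq_top_of_set openin_open by auto
      ultimately have "openin (Euclidean_space ?m) (snd c ` T')" using chart_image_open[OF ic] by (simp add: openin_Int)
      then have "openin (mfd_top N) T'" by (intro iffD2[OF chart_openness[OF ic]]) (auto simp: T'_def)
      moreover have "V = T' \<inter> S"
      proof
        show "V \<subseteq> T' \<inter> S" using V T(2) unfolding T'_def by auto
        show "T' \<inter> S \<subseteq> V"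
        proof
          fix p assume p: "p \<in> T' \<inter> S"
          then have "snd c p \<in> snd c ` (fst c \<inter> S)" "snd c p \<in> T" by (auto simp: T'_def)
          then have "snd c p \<in> snd c ` V" unfolding slice[OF c] T(2) by auto
          then obtain p' where p': "p' \<in> V" "snd c p = snd c p'" by auto
          have "p = p'" by (rule inj_onD[OF chart_inj[OF ic] p'(2)]) (use p p' V in \<open>auto simp: T'_def\<close>)
          then show "p \<in> V" using p'(1) by simp
        qed
      qed
      ultimately show "openin ?X V" unfolding openin_subtopology by auto
    qed
  qed
  have sm: "smooth_rep n n r r' (\<lambda>p. p) (fst r \<inter> fst r')"
    if c: "c \<in> slice_charts N n S" and r: "fst r = fst c \<inter> S" "snd r = snd c"
      and c': "c' \<in> slice_charts N n S" and r': "fst r' = fst c' \<inter> S" "snd r' = snd c'" for c r c' r'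
    unfolding smooth_rep_def
  proof (intro allI impI)
    fix j assume j: "j < n"
    have o: "openin (Euclidean_space n) (snd r ` (fst r \<inter> fst r'))"
      by (rule iffD1[OF chart_openness[OF ch[OF c r]] openin_Int[OF chart_open[OF ch[OF c r]] chart_open[OF ch[OF c' r']]]]) simp
    have "smooth_on ?m (snd c ` (fst c \<inter> fst c')) (\<lambda>x. snd c' (chart_inv c x) j)"
      using mfd_transition_smooth[OF N cN[OF c] cN[OF c']] j nm by (simp add: smooth_rep_def)
    then have "smooth_on n (snd r ` (fst r \<inter> fst r')) (\<lambda>x. snd c' (chart_inv c x) j)"
      by (rule smooth_on_subset) (use nm r r' in auto)
    then show "smooth_on n (snd r ` (fst r \<inter> fst r')) (\<lambda>x. snd r' (chart_inv r x) j)"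
    proof (rule smooth_on_cong[OF o, rotated])
      fix x assume "x \<in> snd r ` (fst r \<inter> fst r')"
      then have "x \<in> snd r ` fst r" by auto
      then have "chart_inv r x = chart_inv c x"
        by (intro chart_inv_restrict[OF chart_inj[OF mfd_is_chart[OF N cN[OF c]]]]) (use r in auto)
      then show "snd c' (chart_inv c x) j = snd r' (chart_inv r x) j" using r'(2) by simp
    qed
  qed
  show ?thesis
    unfolding compatible_atlas_def
  proof (intro conjI ballI)
    fix r assume "r \<in> ?A"
    then obtain c where c: "c \<in> slice_charts N n S" "r = (fst c \<inter> S, snd c)"
      unfolding mem_Collect_eq by (elim exE conjE)
    then have r: "fst r = fst c \<inter> S" "snd r = snd c" by simp_all
    show "is_chart ?X n r" by (rule ch[OF c(1) r])
    fix r' assume "r' \<in> ?A"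
    then obtain c' where c': "c' \<in> slice_charts N n S" "r' = (fst c' \<inter> S, snd c')"
      unfolding mem_Collect_eq by (elim exE conjE)
    then have r': "fst r' = fst c' \<inter> S" "snd r' = snd c'" by simp_all
    show "compatible n r r'"
      unfolding compatible_iff_smooth_rep using sm[OF c(1) r c'(1) r'] sm[OF c'(1) r' c(1) r] by (rule conjI)
  next
    have "(\<Union>r\<in>?A. fst r) = S"
    proof
      show "S \<subseteq> (\<Union>r\<in>?A. fst r)"
      proof
        fix p assume p: "p \<in> S"
        from cov[OF p] obtain c where c: "c \<in> slice_charts N n S" "p \<in> fst c" by (elim bexE)
        show "p \<in> (\<Union>r\<in>?A. fst r)"
          by (rule UN_I[of "(fst c \<inter> S, snd c)"]) (use c p in \<open>auto simp del: split_paired_Ex\<close>)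
      qed
    qed auto
    then show "(\<Union>r\<in>?A. fst r) = topspace ?X" using SN by auto
  qed
qed

section \<open>Whitney sums of the cotangent bundle\<close>

text \<open>In an adapted chart, the coordinates of the base point and the position of the \<open>i\<close>-th
  coordinate of the covector number \<open>\<alpha>\<close>. The covectors are counted from 1.\<close>

definition base_part :: "nat \<Rightarrow> (nat \<Rightarrow> real) \<Rightarrow> nat \<Rightarrow> real" where
  "base_part n x = (\<lambda>i. if i < n then x i else 0)"

definition fibre_index :: "nat \<Rightarrow> nat \<Rightarrow> nat \<Rightarrow> nat" where
  "fibre_index n \<alpha> i = n + ((\<alpha> - 1) * n + i)"

lemma fibre_index_bounds:
  assumes "i < n" "\<alpha> \<in> {1..k}"
  shows "\<not> fibre_index n \<alpha> i < n" "fibre_index n \<alpha> i < n + k * n"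
proof -
  have "(\<alpha> - 1) * n + i < (\<alpha> - 1) * n + n" using assms by simp
  also have "\<dots> = \<alpha> * n" using assms by (cases \<alpha>) auto
  also have "\<dots> \<le> k * n" using assms by simp
  finally show "fibre_index n \<alpha> i < n + k * n" by (simp add: fibre_index_def)
qed (simp add: fibre_index_def)

lemma fibre_index_inverse:
  assumes "i < n" "1 \<le> \<alpha>"
  shows "(fibre_index n \<alpha> i - n) div n + 1 = \<alpha>" "(fibre_index n \<alpha> i - n) mod n = i"
proof -
  have "n \<noteq> 0" using assms by simp
  then show "(fibre_index n \<alpha> i - n) div n + 1 = \<alpha>" "(fibre_index n \<alpha> i - n) mod n = i"
    using assms by (simp_all add: fibre_index_def div_mult_self3)
qed

lemma fibre_index_cases:
  assumes "l < n + k * n" "\<not> l < n"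
  obtains \<alpha> i where "\<alpha> \<in> {1..k}" "i < n" "l = fibre_index n \<alpha> i"
proof -
  have n: "n > 0" using assms by (cases n) auto
  have "(l - n) div n < k" using assms by (intro less_mult_imp_div_less) simp
  moreover have "l = fibre_index n ((l - n) div n + 1) ((l - n) mod n)"
    using assms by (simp add: fibre_index_def)
  ultimately show thesis using n by (intro that[of "(l - n) div n + 1" "(l - n) mod n"]) auto
qed

lemma base_part_in_rspace: "base_part n x \<in> rspace n"
  by (simp add: base_part_def in_rspace_iff)

lemma smooth_on_base_part: "smooth_on m U (\<lambda>x. base_part n x j)"
  unfolding base_part_def by (cases "j < n") (simp_all add: smooth_on_coordinate smooth_on_const)

lemma openin_rspace: "openin (Euclidean_space n) (rspace n)"
  using openin_topspace[of "Euclidean_space n"] by (simp add: topspace_Euclidean_rspace)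

lemma base_part_preimage_open:
  assumes "openin (Euclidean_space n) V"
  shows "openin (Euclidean_space m) {x \<in> rspace m. base_part n x \<in> V}"
  by (rule smooth_preimage_open[OF openin_rspace assms]) (use smooth_on_base_part base_part_in_rspace in auto)

lemma whitney_chart_domain:
  "z \<in> fst (whitney_chart Q k c) \<longleftrightarrow> fst z \<in> fst c \<and> snd z \<in> {1..k} \<rightarrow>\<^sub>E cotangent_space Q (fst z)"
  by (cases z) (simp add: whitney_chart_def Let_def)

lemma whitney_chart_base: "i < mfd_dim Q \<Longrightarrow> snd (whitney_chart Q k c) z i = snd c (fst z) i"
  by (cases z) (simp add: whitney_chart_def Let_def)

lemma whitney_chart_fibre:
  assumes "i < mfd_dim Q" "\<alpha> \<in> {1..k}"
  shows "snd (whitney_chart Q k c) z (fibre_index (mfd_dim Q) \<alpha> i) = snd z \<alpha> (coord_vector Q c (fst z) i)"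
  using fibre_index_bounds[OF assms] fibre_index_inverse[OF assms(1), of \<alpha>] assms(2)
  by (cases z) (simp add: whitney_chart_def Let_def)

lemma whitney_chart_in_rspace:
  "snd (whitney_chart Q k c) z \<in> rspace (mfd_dim Q + k * mfd_dim Q)"
  by (cases z) (auto simp: whitney_chart_def Let_def in_rspace_iff)

text \<open>The covector at \<open>q\<close> that has components \<open>a\<close> in the chart
  \<open>c\<close>.\<close>

definition covector_of :: "'a mfd \<Rightarrow> 'a chart \<Rightarrow> 'a \<Rightarrow> (nat \<Rightarrow> real) \<Rightarrow> 'a tvec \<Rightarrow> real" where
  "covector_of Q c q a = (\<lambda>u. if u \<in> tangent_space Q q then \<Sum>i<mfd_dim Q. a i * u c i else 0)"

lemma covector_of_in_cotangent_space: "covector_of Q c q a \<in> cotangent_space Q q"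
  unfolding cotangent_space_def mem_Collect_eq
proof (intro conjI ballI allI impI)
  fix u v x y assume uv: "u \<in> tangent_space Q q" "v \<in> tangent_space Q q"
  show "covector_of Q c q a (\<lambda>c i. x * u c i + y * v c i) = x * covector_of Q c q a u + y * covector_of Q c q a v"
    using uv tangent_space_lincomb[OF uv]
    by (simp add: covector_of_def sum_distrib_left sum.distrib[symmetric] algebra_simps)
qed (simp add: covector_of_def)

lemma covector_of_coord_vector:
  assumes "atlas_manifold Q" "c \<in> charts_at Q q" "i < mfd_dim Q"
  shows "covector_of Q c q a (coord_vector Q c q i) = a i"
proof -
  have "covector_of Q c q a (coord_vector Q c q i) = (\<Sum>j<mfd_dim Q. a j * coord_vector Q c q i c j)"
    by (simp add: covector_of_def coord_vector_in_tangent_space[OF assms])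
  also have "\<dots> = (\<Sum>j<mfd_dim Q. if j = i then a i else 0)"
    by (intro sum.cong refl) (simp add: coord_vector_coordinate[OF assms])
  finally show ?thesis using assms(3) by simp
qed

lemma base_part_whitney_chart:
  assumes "atlas_manifold Q" "c \<in> mfd_charts Q" "fst z \<in> fst c"
  shows "base_part (mfd_dim Q) (snd (whitney_chart Q k c) z) = snd c (fst z)"
proof
  fix i
  have "snd c (fst z) \<in> rspace (mfd_dim Q)"
    using chart_image_subset[OF mfd_is_chart[OF assms(1,2)]] assms(3) by auto
  then show "base_part (mfd_dim Q) (snd (whitney_chart Q k c) z) i = snd c (fst z) i"
    by (simp add: base_part_def whitney_chart_base in_rspace_iff)
qed

lemma rspace_eqI:
  assumes "x \<in> rspace (n + k * n)" "y \<in> rspace (n + k * n)" "\<And>i. i < n \<Longrightarrow> x i = y i"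
    "\<And>\<alpha> i. \<alpha> \<in> {1..k} \<Longrightarrow> i < n \<Longrightarrow> x (fibre_index n \<alpha> i) = y (fibre_index n \<alpha> i)"
  shows "x = y"
proof
  fix l
  consider "l < n" | "\<not> l < n" "l < n + k * n" | "l \<ge> n + k * n" by linarith
  then show "x l = y l"
  proof cases
    case 2
    obtain \<alpha> i where "\<alpha> \<in> {1..k}" "i < n" "l = fibre_index n \<alpha> i" by (rule fibre_index_cases[OF 2(2,1)])
    then show ?thesis using assms(4) by simp
  qed (use assms in \<open>auto simp: in_rspace_iff\<close>)
qed

text \<open>An adapted chart turns the part of the bundle over \<open>V\<close> into a cylinder, since the
  covector coordinates are arbitrary. In particular, the images of domains and overlaps are open.\<close>

lemma whitney_chart_image:
  assumes Q: "atlas_manifold Q" and c: "c \<in> mfd_charts Q" and V: "V \<subseteq> fst c"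
  shows "snd (whitney_chart Q k c) ` {z \<in> fst (whitney_chart Q k c). fst z \<in> V} =
    {x \<in> rspace (mfd_dim Q + k * mfd_dim Q). base_part (mfd_dim Q) x \<in> snd c ` V}"
proof
  let ?n = "mfd_dim Q" and ?w = "whitney_chart Q k c"
  show "snd ?w ` {z \<in> fst ?w. fst z \<in> V} \<subseteq> {x \<in> rspace (?n + k * ?n). base_part ?n x \<in> snd c ` V}"
  proof
    fix x assume "x \<in> snd ?w ` {z \<in> fst ?w. fst z \<in> V}"
    then obtain z where z: "fst z \<in> V" "x = snd ?w z" by auto
    then show "x \<in> {x \<in> rspace (?n + k * ?n). base_part ?n x \<in> snd c ` V}"
      using base_part_whitney_chart[OF Q c, of z k] whitney_chart_in_rspace[of Q k c z] V by auto
  qed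
  show "{x \<in> rspace (?n + k * ?n). base_part ?n x \<in> snd c ` V} \<subseteq> snd ?w ` {z \<in> fst ?w. fst z \<in> V}"
  proof
    fix x assume "x \<in> {x \<in> rspace (?n + k * ?n). base_part ?n x \<in> snd c ` V}"
    then have x: "x \<in> rspace (?n + k * ?n)" "base_part ?n x \<in> snd c ` V" by simp_all
    obtain q where q: "q \<in> V" "base_part ?n x = snd c q" using x(2) by auto
    have qc: "c \<in> charts_at Q q" using c V q(1) by (auto intro: charts_atI)
    define p where "p = (\<lambda>\<alpha>\<in>{1..k}. covector_of Q c q (\<lambda>i. x (fibre_index ?n \<alpha> i)))"
    have z: "(q, p) \<in> fst ?w"
      using V q(1) by (auto simp: whitney_chart_domain p_def covector_of_in_cotangent_space)
    have "x = snd ?w (q, p)"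
    proof (rule rspace_eqI[OF x(1) whitney_chart_in_rspace])
      fix i assume i: "i < ?n"
      have "x i = base_part ?n x i" using i by (simp add: base_part_def)
      then show "x i = snd ?w (q, p) i" using i q(2) by (simp add: whitney_chart_base)
      fix \<alpha> assume "\<alpha> \<in> {1..k}"
      then show "x (fibre_index ?n \<alpha> i) = snd ?w (q, p) (fibre_index ?n \<alpha> i)"
        using i by (simp add: whitney_chart_fibre p_def covector_of_coord_vector[OF Q qc])
    qed
    then show "x \<in> snd ?w ` {z \<in> fst ?w. fst z \<in> V}" by (rule image_eqI) (use z q(1) in simp)
  qed
qed

text \<open>A covector is determined by its values on the coordinate vectors.\<close>

lemma whitney_chart_inj:
  assumes Q: "atlas_manifold Q" and c: "c \<in> mfd_charts Q"
  shows "inj_on (snd (whitney_chart Q k c)) (fst (whitney_chart Q k c))"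
proof (rule inj_onI)
  let ?n = "mfd_dim Q" and ?w = "whitney_chart Q k c"
  fix z z' assume z: "z \<in> fst ?w" and z': "z' \<in> fst ?w" and eq: "snd ?w z = snd ?w z'"
  have zc: "fst z \<in> fst c" "fst z' \<in> fst c" and
    p: "snd z \<in> {1..k} \<rightarrow>\<^sub>E cotangent_space Q (fst z)" "snd z' \<in> {1..k} \<rightarrow>\<^sub>E cotangent_space Q (fst z')"
    using z z' by (simp_all add: whitney_chart_domain)
  have "snd c (fst z) = snd c (fst z')"
    using base_part_whitney_chart[OF Q c zc(1), of k] base_part_whitney_chart[OF Q c zc(2), of k] eq by simp
  then have q: "fst z = fst z'" by (rule inj_onD[OF chart_inj[OF mfd_is_chart[OF Q c]] _ zc])
  have "snd z = snd z'"
  proof (rule PiE_ext[OF p(1)])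
    show "snd z' \<in> {1..k} \<rightarrow>\<^sub>E cotangent_space Q (fst z)" using p(2) q by simp
    fix \<alpha> assume \<alpha>: "\<alpha> \<in> {1..k}"
    show "snd z \<alpha> = snd z' \<alpha>"
    proof (rule cotangent_eqI[OF Q charts_atI[OF c zc(1)]])
      show "snd z \<alpha> \<in> cotangent_space Q (fst z)" by (rule PiE_mem[OF p(1) \<alpha>])
      show "snd z' \<alpha> \<in> cotangent_space Q (fst z)" unfolding q by (rule PiE_mem[OF p(2) \<alpha>])
      fix i assume i: "i < ?n"
      show "snd z \<alpha> (coord_vector Q c (fst z) i) = snd z' \<alpha> (coord_vector Q c (fst z) i)"
        using whitney_chart_fibre[OF i \<alpha>, of c z] whitney_chart_fibre[OF i \<alpha>, of c z'] eq q by simp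
    qed
  qed
  then show "z = z'" using q by (rule prod_eqI[rotated])
qed

lemma whitney_chart_Int:
  "fst (whitney_chart Q k c) \<inter> fst (whitney_chart Q k d) = {z \<in> fst (whitney_chart Q k c). fst z \<in> fst c \<inter> fst d}"
  unfolding set_eq_iff Int_iff mem_Collect_eq whitney_chart_domain by (simp only: conj_ac simp_thms)

lemma chart_Int_image_open:
  assumes Q: "atlas_manifold Q" and c: "c \<in> mfd_charts Q" and d: "d \<in> mfd_charts Q"
  shows "openin (Euclidean_space (mfd_dim Q)) (snd c ` (fst c \<inter> fst d))"
proof -
  have "openin (mfd_top Q) (fst c \<inter> fst d)"
    by (intro openin_Int chart_open[OF mfd_is_chart[OF Q c]] chart_open[OF mfd_is_chart[OF Q d]])
  then show ?thesis by (rule iffD1[OF chart_openness[OF mfd_is_chart[OF Q c]], rotated]) simp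
qed

lemma whitney_chart_overlap_open:
  assumes Q: "atlas_manifold Q" and c: "c \<in> mfd_charts Q" and d: "d \<in> mfd_charts Q"
  shows "openin (Euclidean_space (mfd_dim Q + k * mfd_dim Q))
    (snd (whitney_chart Q k c) ` (fst (whitney_chart Q k c) \<inter> fst (whitney_chart Q k d)))"
  unfolding whitney_chart_Int whitney_chart_image[OF Q c Int_lower1]
  by (rule base_part_preimage_open[OF chart_Int_image_open[OF Q c d]])

lemma whitney_chart_image_open:
  assumes Q: "atlas_manifold Q" and c: "c \<in> mfd_charts Q"
  shows "openin (Euclidean_space (mfd_dim Q + k * mfd_dim Q)) (snd (whitney_chart Q k c) ` fst (whitney_chart Q k c))"
  using whitney_chart_overlap_open[OF Q c c, of k] by simp

text \<open>Covector coordinates transform linearly. The matrix is the Jacobian of the inverse transition on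
  \<open>Q\<close>, taken at the base point, and thus a smooth function of the base coordinates.\<close>

lemma whitney_transition_smooth:
  assumes Q: "atlas_manifold Q" and c: "c \<in> mfd_charts Q" and d: "d \<in> mfd_charts Q"
  shows "smooth_transition (mfd_dim Q + k * mfd_dim Q) (whitney_chart Q k c) (whitney_chart Q k d)"
  unfolding smooth_transition_def
proof (intro allI impI)
  let ?n = "mfd_dim Q" and ?w = "whitney_chart Q k c" and ?w' = "whitney_chart Q k d"
  let ?m = "?n + k * ?n" and ?V = "snd c ` (fst c \<inter> fst d)" and ?V' = "snd d ` (fst c \<inter> fst d)"
  let ?U = "snd ?w ` (fst ?w \<inter> fst ?w')"
  note oU = whitney_chart_overlap_open[OF Q c d, of k]
  note oV = chart_Int_image_open[OF Q c d]
  have oV': "openin (Euclidean_space ?n) ?V'" using chart_Int_image_open[OF Q d c] by (simp add: Int_commute)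
  have bp: "base_part ?n ` ?U \<subseteq> ?V"
    unfolding whitney_chart_Int whitney_chart_image[OF Q c Int_lower1] by auto
  define A where "A x = snd d (chart_inv c (base_part ?n x))" for x
  have inv: "chart_inv ?w x \<in> fst ?w" "fst (chart_inv ?w x) \<in> fst c" "fst (chart_inv ?w x) \<in> fst d"
    "chart_inv c (base_part ?n x) = fst (chart_inv ?w x)" "x = snd ?w (chart_inv ?w x)" if x: "x \<in> ?U" for x
  proof -
    from x obtain z where z: "z \<in> fst ?w" "z \<in> fst ?w'" "x = snd ?w z" by auto
    have zx: "chart_inv ?w x = z" unfolding z(3) by (rule chart_inv_left[OF whitney_chart_inj[OF Q c] z(1)])
    have zc: "fst z \<in> fst c" "fst z \<in> fst d" using z(1,2) by (simp_all add: whitney_chart_domain)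
    then show "chart_inv ?w x \<in> fst ?w" "fst (chart_inv ?w x) \<in> fst c" "fst (chart_inv ?w x) \<in> fst d"
      "x = snd ?w (chart_inv ?w x)" using z zx by simp_all
    show "chart_inv c (base_part ?n x) = fst (chart_inv ?w x)"
      unfolding zx unfolding z(3) base_part_whitney_chart[OF Q c zc(1)]
      by (rule chart_inv_left[OF chart_inj[OF mfd_is_chart[OF Q c]] zc(1)])
  qed
  have AV: "A ` ?U \<subseteq> ?V'" using inv unfolding A_def by auto
  have As: "smooth_on ?m ?U (\<lambda>x. A x i)" if i: "i < ?n" for i
    unfolding A_def
    by (rule smooth_on_compose[OF oU oV smooth_on_base_part bp])
      (use mfd_transition_smooth[OF Q c d] i in \<open>simp add: smooth_rep_def\<close>)
  fix l assume l: "l < ?m"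
  show "smooth_on ?m ?U (\<lambda>x. snd ?w' (chart_inv ?w x) l)"
  proof (cases "l < ?n")
    case True
    show ?thesis
      by (rule smooth_on_cong[OF oU _ As[OF True]]) (simp add: A_def inv(4) whitney_chart_base[OF True])
  next
    case False
    obtain \<alpha> i where \<alpha>: "\<alpha> \<in> {1..k}" and i: "i < ?n" and li: "l = fibre_index ?n \<alpha> i"
      by (rule fibre_index_cases[OF l False])
    let ?G = "\<lambda>j. partial i (\<lambda>y. snd c (chart_inv d y) j)"
    have Gs: "smooth_on ?n ?V' (?G j)" if "j < ?n" for j
      using mfd_transition_smooth[OF Q d c] that i
      by (intro smooth_on_partial) (simp_all add: smooth_rep_def Int_commute)
    have "smooth_on ?m ?U (\<lambda>x. \<Sum>j<?n. ?G j (A x) * x (fibre_index ?n \<alpha> j))"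
      by (intro smooth_on_sum[OF oU] smooth_on_mult[OF oU] smooth_on_coordinate
          smooth_on_compose[OF oU oV' As AV Gs]) auto
    then show ?thesis
    proof (rule smooth_on_cong[OF oU, rotated])
      fix x assume x: "x \<in> ?U"
      let ?z = "chart_inv ?w x"
      note ac = charts_atI[OF c inv(2)[OF x]] and ad = charts_atI[OF d inv(3)[OF x]]
      have p: "snd ?z \<alpha> \<in> cotangent_space Q (fst ?z)"
        using inv(1)[OF x] \<alpha> by (auto simp: whitney_chart_domain)
      have "snd ?w' ?z l = snd ?z \<alpha> (coord_vector Q d (fst ?z) i)"
        unfolding li by (rule whitney_chart_fibre[OF i \<alpha>])
      also have "\<dots> = (\<Sum>j<?n. coord_vector Q d (fst ?z) i c j * snd ?z \<alpha> (coord_vector Q c (fst ?z) j))"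
        by (rule cotangent_expansion[OF Q ac coord_vector_in_tangent_space[OF Q ad i] p])
      also have "\<dots> = (\<Sum>j<?n. ?G j (A x) * x (fibre_index ?n \<alpha> j))"
      proof (intro sum.cong refl)
        fix j assume "j \<in> {..<?n}"
        then have j: "j < ?n" by simp
        have "coord_vector Q d (fst ?z) i c j = ?G j (A x)"
          using ac j by (simp add: coord_vector_def jacobian_def A_def inv(4)[OF x])
        moreover have "snd ?z \<alpha> (coord_vector Q c (fst ?z) j) = x (fibre_index ?n \<alpha> j)"
          using whitney_chart_fibre[OF j \<alpha>, of c ?z] inv(5)[OF x] by simp
        ultimately show "coord_vector Q d (fst ?z) i c j * snd ?z \<alpha> (coord_vector Q c (fst ?z) j) =
          ?G j (A x) * x (fibre_index ?n \<alpha> j)" by simp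
      qed
      finally show "(\<Sum>j<?n. ?G j (A x) * x (fibre_index ?n \<alpha> j)) = snd ?w' ?z l" by simp
    qed
  qed
qed

lemma whitney_compatible_atlas:
  assumes Q: "atlas_manifold Q"
  shows "compatible_atlas
    (atlas_topology (mfd_dim Q + k * mfd_dim Q) (whitney_chart Q k ` mfd_charts Q))
    (mfd_dim Q + k * mfd_dim Q) (whitney_chart Q k ` mfd_charts Q)"
proof (rule atlas_topology_compatible_atlas; (elim imageE)?)
  fix w c assume "w = whitney_chart Q k c" "c \<in> mfd_charts Q"
  then show "inj_on (snd w) (fst w)" "openin (Euclidean_space (mfd_dim Q + k * mfd_dim Q)) (snd w ` fst w)"
    using whitney_chart_inj[OF Q] whitney_chart_image_open[OF Q] by simp_all
next
  fix w w' c d assume "w = whitney_chart Q k c" "c \<in> mfd_charts Q" "w' = whitney_chart Q k d" "d \<in> mfd_charts Q"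
  then show "openin (Euclidean_space (mfd_dim Q + k * mfd_dim Q)) (snd w ` (fst w \<inter> fst w'))"
    "compatible (mfd_dim Q + k * mfd_dim Q) w w'"
    using whitney_chart_overlap_open[OF Q] whitney_transition_smooth[OF Q] by (simp_all add: compatible_def)
qed

lemma whitney_sum_simps:
  "mfd_dim (whitney_sum Q k) = mfd_dim Q + k * mfd_dim Q"
  by (simp add: whitney_sum_def Let_def)

lemma whitney_sum_atlas_manifold: "atlas_manifold Q \<Longrightarrow> atlas_manifold (whitney_sum Q k)"
  unfolding whitney_sum_def Let_def by (rule mfd_generated_atlas_manifold[OF whitney_compatible_atlas])

lemma whitney_chart_in_charts:
  "atlas_manifold Q \<Longrightarrow> c \<in> mfd_charts Q \<Longrightarrow> whitney_chart Q k c \<in> mfd_charts (whitney_sum Q k)"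
  unfolding whitney_sum_def Let_def by (rule subsetD[OF mfd_generated_superset[OF whitney_compatible_atlas]]) simp_all

text \<open>The cotangent bundle is the Whitney sum with one summand. This identification matches the adapted
  charts, so the smooth structure of the cotangent bundle is obtained from the case \<open>k = 1\<close>
  above.\<close>

definition whitney_point :: "'a \<times> ('a tvec \<Rightarrow> real) \<Rightarrow> 'a wpoint" where
  "whitney_point z = (fst z, \<lambda>\<alpha>\<in>{1..1}. snd z)"

lemma whitney_point_inj: "inj_on whitney_point A"
proof (rule inj_onI)
  fix z z' :: "'a \<times> ('a tvec \<Rightarrow> real)" assume eq: "whitney_point z = whitney_point z'"
  have "snd (whitney_point y) 1 = snd y" for y :: "'a \<times> ('a tvec \<Rightarrow> real)" by (simp add: whitney_point_def)
  moreover have "fst (whitney_point y) = fst y" for y :: "'a \<times> ('a tvec \<Rightarrow> real)" by (simp add: whitney_point_def)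
  ultimately show "z = z'" using eq by (metis prod_eqI)
qed

lemma cotangent_chart_domain:
  "z \<in> fst (cotangent_chart Q c) \<longleftrightarrow> fst z \<in> fst c \<and> snd z \<in> cotangent_space Q (fst z)"
  by (cases z) (simp add: cotangent_chart_def Let_def)

lemma cotangent_chart_base: "i < mfd_dim Q \<Longrightarrow> snd (cotangent_chart Q c) z i = snd c (fst z) i"
  by (cases z) (simp add: cotangent_chart_def Let_def)

lemma cotangent_chart_fibre:
  "i < mfd_dim Q \<Longrightarrow> snd (cotangent_chart Q c) z (mfd_dim Q + i) = snd z (coord_vector Q c (fst z) i)"
  by (cases z) (simp add: cotangent_chart_def Let_def)

lemma cotangent_chart_matched: "matched whitney_point (cotangent_chart Q c) (whitney_chart Q 1 c)"
  unfolding matched_def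
proof (intro conjI ballI whitney_point_inj)
  show "whitney_point ` fst (cotangent_chart Q c) = fst (whitney_chart Q 1 c)"
  proof
    show "whitney_point ` fst (cotangent_chart Q c) \<subseteq> fst (whitney_chart Q 1 c)"
      by (auto simp: whitney_point_def whitney_chart_domain cotangent_chart_domain)
    show "fst (whitney_chart Q 1 c) \<subseteq> whitney_point ` fst (cotangent_chart Q c)"
    proof
      fix z assume "z \<in> fst (whitney_chart Q 1 c)"
      then have z: "fst z \<in> fst c" "snd z \<in> {1..1} \<rightarrow>\<^sub>E cotangent_space Q (fst z)" by (simp_all add: whitney_chart_domain)
      have "snd z = (\<lambda>\<alpha>\<in>{1..1}. snd z 1)"
      proof
        fix \<alpha> :: nat
        show "snd z \<alpha> = (\<lambda>\<alpha>\<in>{1..1}. snd z 1) \<alpha>"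
          using PiE_arb[OF z(2), of \<alpha>] by (cases "\<alpha> = 1") auto
      qed
      then have "z = whitney_point (fst z, snd z 1)" by (simp add: whitney_point_def prod_eq_iff)
      moreover have "(fst z, snd z 1) \<in> fst (cotangent_chart Q c)"
        using z PiE_mem[OF z(2), of 1] by (simp add: cotangent_chart_domain)
      ultimately show "z \<in> whitney_point ` fst (cotangent_chart Q c)" by (rule image_eqI)
    qed
  qed
  fix z
  show "snd (whitney_chart Q 1 c) (whitney_point z) = snd (cotangent_chart Q c) z"
    by (cases z) (auto simp: whitney_chart_def cotangent_chart_def whitney_point_def Let_def fun_eq_iff)
qed

lemma cotangent_compatible_atlas:
  assumes Q: "atlas_manifold Q"
  shows "compatible_atlas (atlas_topology (mfd_dim Q + mfd_dim Q) (cotangent_chart Q ` mfd_charts Q))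
    (mfd_dim Q + mfd_dim Q) (cotangent_chart Q ` mfd_charts Q)"
proof -
  let ?m = "mfd_dim Q + mfd_dim Q"
  have m: "mfd_dim Q + 1 * mfd_dim Q = ?m" by simp
  have im: "snd (cotangent_chart Q c) ` W = snd (whitney_chart Q 1 c) ` whitney_point ` W"
    if "W \<subseteq> fst (cotangent_chart Q c)" for c W
    by (rule matched_image[OF cotangent_chart_matched that, symmetric])
  have dom: "whitney_point ` fst (cotangent_chart Q c) = fst (whitney_chart Q 1 c)" for c
    using cotangent_chart_matched unfolding matched_def by blast
  have inj: "inj_on (snd (cotangent_chart Q c)) (fst (cotangent_chart Q c))" if c: "c \<in> mfd_charts Q" for c
  proof -
    have "inj_on (snd (whitney_chart Q 1 c) \<circ> whitney_point) (fst (cotangent_chart Q c))"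
      by (rule comp_inj_on[OF whitney_point_inj]) (simp only: dom whitney_chart_inj[OF Q c])
    moreover have "(snd (whitney_chart Q 1 c) \<circ> whitney_point) z = snd (cotangent_chart Q c) z"
      if "z \<in> fst (cotangent_chart Q c)" for z
      unfolding comp_apply using cotangent_chart_matched[of Q c] that unfolding matched_def by (elim conjE bspec)
    ultimately show ?thesis by (subst inj_on_cong[of _ _ "snd (whitney_chart Q 1 c) \<circ> whitney_point"]) simp_all
  qed
  have ov: "openin (Euclidean_space ?m) (snd (cotangent_chart Q c) ` (fst (cotangent_chart Q c) \<inter> fst (cotangent_chart Q d)))"
    if c: "c \<in> mfd_charts Q" and d: "d \<in> mfd_charts Q" for c d
  proof -
    have "whitney_point ` (fst (cotangent_chart Q c) \<inter> fst (cotangent_chart Q d)) =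
        fst (whitney_chart Q 1 c) \<inter> fst (whitney_chart Q 1 d)"
      unfolding inj_on_image_Int[OF whitney_point_inj[of UNIV] subset_UNIV subset_UNIV] dom ..
    then show ?thesis
      using whitney_chart_overlap_open[OF Q c d, of 1] im[OF Int_lower1, of c] by simp
  qed
  have comp: "compatible ?m (cotangent_chart Q c) (cotangent_chart Q d)"
    if c: "c \<in> mfd_charts Q" and d: "d \<in> mfd_charts Q" for c d
  proof -
    have "compatible ?m (cotangent_chart Q c) (cotangent_chart Q d) \<longleftrightarrow>
        compatible ?m (whitney_chart Q 1 c) (whitney_chart Q 1 d)"
      by (rule matched_compatible[OF cotangent_chart_matched cotangent_chart_matched whitney_point_inj inj[OF c] inj[OF d] ov[OF c d]])
        (use ov[OF d c] in \<open>simp add: Int_commute\<close>)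
    then show ?thesis
      using whitney_transition_smooth[OF Q c d, of 1] whitney_transition_smooth[OF Q d c, of 1]
      by (simp add: compatible_def)
  qed
  show ?thesis
  proof (rule atlas_topology_compatible_atlas; (elim imageE)?)
    fix w c assume "w = cotangent_chart Q c" "c \<in> mfd_charts Q"
    then show "inj_on (snd w) (fst w)" "openin (Euclidean_space ?m) (snd w ` fst w)"
      using inj ov[of c c] by simp_all
  next
    fix w w' c d assume "w = cotangent_chart Q c" "c \<in> mfd_charts Q" "w' = cotangent_chart Q d" "d \<in> mfd_charts Q"
    then show "openin (Euclidean_space ?m) (snd w ` (fst w \<inter> fst w'))" "compatible ?m w w'"
      using ov comp by simp_all
  qed
qed

lemma cotangent_bundle_simps: "mfd_dim (cotangent_bundle Q) = mfd_dim Q + mfd_dim Q"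
  by (simp add: cotangent_bundle_def Let_def)

lemma cotangent_bundle_atlas_manifold: "atlas_manifold Q \<Longrightarrow> atlas_manifold (cotangent_bundle Q)"
  unfolding cotangent_bundle_def Let_def by (rule mfd_generated_atlas_manifold[OF cotangent_compatible_atlas])

lemma cotangent_chart_in_charts:
  "atlas_manifold Q \<Longrightarrow> c \<in> mfd_charts Q \<Longrightarrow> cotangent_chart Q c \<in> mfd_charts (cotangent_bundle Q)"
  unfolding cotangent_bundle_def Let_def
  by (rule subsetD[OF mfd_generated_superset[OF cotangent_compatible_atlas]]) simp_all

text \<open>In adapted charts, the projection to the \<open>\<alpha>\<close>-th summand selects the coordinates
  \<open>component_index n \<alpha> j\<close>.\<close>

definition component_index :: "nat \<Rightarrow> nat \<Rightarrow> nat \<Rightarrow> nat" where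
  "component_index n \<alpha> j = (if j < n then j else fibre_index n \<alpha> (j - n))"

lemma component_index_less:
  assumes "\<alpha> \<in> {1..k}" "j < n + n"
  shows "component_index n \<alpha> j < n + k * n"
  using fibre_index_bounds(2)[of "j - n" n \<alpha> k] assms by (auto simp: component_index_def)

lemma whitney_component_coordinate:
  assumes "\<alpha> \<in> {1..k}" "j < mfd_dim Q + mfd_dim Q"
  shows "snd (cotangent_chart Q c) (whitney_component \<alpha> z) j =
    snd (whitney_chart Q k c) z (component_index (mfd_dim Q) \<alpha> j)"
proof (cases "j < mfd_dim Q")
  case True
  then show ?thesis by (cases z) (simp add: whitney_component_def cotangent_chart_base component_index_def whitney_chart_base)
next
  case False
  then have "j = mfd_dim Q + (j - mfd_dim Q)" "j - mfd_dim Q < mfd_dim Q" using assms(2) by auto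
  then show ?thesis
    using cotangent_chart_fibre[of "j - mfd_dim Q" Q c "whitney_component \<alpha> z"]
      whitney_chart_fibre[of "j - mfd_dim Q" Q \<alpha> k c z] assms(1) False
    by (cases z) (simp add: whitney_component_def component_index_def)
qed

lemma whitney_component_simps:
  "fst (whitney_component \<alpha> z) = fst z" "snd (whitney_component \<alpha> z) = snd z \<alpha>"
  by (simp_all add: whitney_component_def case_prod_beta)

lemma whitney_component_domain:
  "\<alpha> \<in> {1..k} \<Longrightarrow> whitney_component \<alpha> ` fst (whitney_chart Q k c) \<subseteq> fst (cotangent_chart Q c)"
proof (rule image_subsetI)
  fix z assume \<alpha>: "\<alpha> \<in> {1..k}" and "z \<in> fst (whitney_chart Q k c)"
  then have z: "fst z \<in> fst c" "snd z \<in> {1..k} \<rightarrow>\<^sub>E cotangent_space Q (fst z)"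
    by (simp_all only: whitney_chart_domain)
  show "whitney_component \<alpha> z \<in> fst (cotangent_chart Q c)"
    unfolding cotangent_chart_domain whitney_component_simps using z(1) PiE_mem[OF z(2) \<alpha>] by (rule conjI)
qed

lemma whitney_component_smooth:
  assumes Q: "atlas_manifold Q" and \<alpha>: "\<alpha> \<in> {1..k}"
  shows "smooth_map (whitney_sum Q k) (cotangent_bundle Q) (whitney_component \<alpha>)"
proof (rule smooth_mapI[OF whitney_sum_atlas_manifold[OF Q] cotangent_bundle_atlas_manifold[OF Q]])
  fix z assume z: "z \<in> carrier (whitney_sum Q k)"
  have "compatible_atlas (mfd_top (whitney_sum Q k)) (mfd_dim Q + k * mfd_dim Q) (whitney_chart Q k ` mfd_charts Q)"
    using whitney_compatible_atlas[OF Q, of k] by (simp add: whitney_sum_def Let_def)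
  then have "z \<in> (\<Union>w\<in>whitney_chart Q k ` mfd_charts Q. fst w)" using z by (simp add: compatible_atlas_def)
  then obtain c where c: "c \<in> mfd_charts Q" "z \<in> fst (whitney_chart Q k c)" by (elim UN_E imageE) simp
  let ?w = "whitney_chart Q k c"
  have "smooth_rep (mfd_dim (whitney_sum Q k)) (mfd_dim (cotangent_bundle Q)) ?w (cotangent_chart Q c) (whitney_component \<alpha>) (fst ?w)"
    unfolding smooth_rep_def whitney_sum_simps cotangent_bundle_simps
  proof (intro allI impI)
    fix j assume j: "j < mfd_dim Q + mfd_dim Q"
    show "smooth_on (mfd_dim Q + k * mfd_dim Q) (snd ?w ` fst ?w)
        (\<lambda>x. snd (cotangent_chart Q c) (whitney_component \<alpha> (chart_inv ?w x)) j)"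
      by (rule smooth_on_cong[OF whitney_chart_image_open[OF Q c(1)] _ smooth_on_coordinate[of _ _ "component_index (mfd_dim Q) \<alpha> j"]])
        (simp add: whitney_component_coordinate[OF \<alpha> j] chart_inv_right(1))
  qed
  then show "\<exists>c\<in>charts_at (whitney_sum Q k) z. \<exists>d\<in>mfd_charts (cotangent_bundle Q).
      whitney_component \<alpha> ` fst c \<subseteq> fst d \<and>
      smooth_rep (mfd_dim (whitney_sum Q k)) (mfd_dim (cotangent_bundle Q)) c d (whitney_component \<alpha>) (fst c)"
    using whitney_component_domain[OF \<alpha>, of Q c]
    by (intro bexI[of _ ?w] bexI[of _ "cotangent_chart Q c"] conjI charts_atI
        whitney_chart_in_charts[OF Q c(1)] cotangent_chart_in_charts[OF Q c(1)] c(2))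
qed

lemma tangent_map_whitney_component:
  assumes Q: "atlas_manifold Q" and \<alpha>: "\<alpha> \<in> {1..k}" and c: "c \<in> mfd_charts Q"
    and z: "z \<in> fst (whitney_chart Q k c)" and u: "u \<in> tangent_space (whitney_sum Q k) z"
    and j: "j < mfd_dim Q + mfd_dim Q"
  shows "tangent_map (whitney_sum Q k) (cotangent_bundle Q) (whitney_component \<alpha>) z u (cotangent_chart Q c) j =
    u (whitney_chart Q k c) (component_index (mfd_dim Q) \<alpha> j)"
proof -
  let ?W = "whitney_sum Q k" and ?T = "cotangent_bundle Q" and ?w = "whitney_chart Q k c" and ?n = "mfd_dim Q"
  let ?i = "component_index ?n \<alpha> j"
  note aW = whitney_sum_atlas_manifold[OF Q, of k] and aT = cotangent_bundle_atlas_manifold[OF Q]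
  note w = charts_atI[OF whitney_chart_in_charts[OF Q c] z]
  have t: "cotangent_chart Q c \<in> charts_at ?T (whitney_component \<alpha> z)"
    using whitney_component_domain[OF \<alpha>, of Q c] z by (intro charts_atI cotangent_chart_in_charts[OF Q c]) auto
  have zW: "z \<in> carrier ?W" by (rule mfd_chart_in_carrier[OF aW charts_atD[OF w]])
  have x: "snd ?w z \<in> snd ?w ` fst ?w" using z by simp
  have jac: "jacobian (whitney_component \<alpha>) ?w (cotangent_chart Q c) z j l = (if l = ?i then 1 else 0)"
    if l: "l < ?n + k * ?n" for l
  proof -
    have "jacobian (whitney_component \<alpha>) ?w (cotangent_chart Q c) z j l = partial l (\<lambda>x. x ?i) (snd ?w z)"
      unfolding jacobian_def
      by (rule partial_cong[OF whitney_chart_image_open[OF Q c] x l])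
        (simp add: whitney_component_coordinate[OF \<alpha> j] chart_inv_right(1))
    then show ?thesis by (simp add: partial_coordinate)
  qed
  have "tangent_map ?W ?T (whitney_component \<alpha>) z u (cotangent_chart Q c) j =
      (\<Sum>l<?n + k * ?n. jacobian (whitney_component \<alpha>) ?w (cotangent_chart Q c) z j l * u ?w l)"
    using tangent_map_coordinate[OF aW aT whitney_component_smooth[OF Q \<alpha>] zW u w t, of j] j
    by (simp add: whitney_sum_simps cotangent_bundle_simps)
  also have "\<dots> = (\<Sum>l<?n + k * ?n. if l = ?i then u ?w ?i else 0)"
    by (intro sum.cong refl) (simp add: jac)
  finally show ?thesis using component_index_less[OF \<alpha> j] by simp
qed

section \<open>The graph of a family of one-forms\<close>

text \<open>With the canonical form \<open>dq \<and> dp\<close>, the pullback along a section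
  \<open>\<theta>\<close> of the cotangent bundle is \<open>- d\<theta>\<close>. Therefore the graph is taken
  of the negatives.\<close>

definition graph_point :: "nat \<Rightarrow> (nat \<Rightarrow> 'a form1) \<Rightarrow> 'a \<Rightarrow> 'a wpoint" where
  "graph_point k \<Theta> q = (q, \<lambda>\<alpha>\<in>{1..k}. (\<lambda>u. - \<Theta> \<alpha> q u))"

definition graph_of :: "'a mfd \<Rightarrow> nat \<Rightarrow> (nat \<Rightarrow> 'a form1) \<Rightarrow> 'a wpoint set" where
  "graph_of Q k \<Theta> = graph_point k \<Theta> ` carrier Q"

text \<open>In adapted coordinates, the translation of the covectors by \<open>s\<close> times the one-forms.
  For \<open>s = 1\<close> it moves the graph of the negatives to the zero section, and \<open>s = - 1\<close>
  undoes it. Adapted charts followed by the first translation are therefore slice charts of the graph.\<close>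

definition graph_shear :: "'a mfd \<Rightarrow> nat \<Rightarrow> (nat \<Rightarrow> 'a form1) \<Rightarrow> real \<Rightarrow> 'a chart \<Rightarrow> (nat \<Rightarrow> real) \<Rightarrow> nat \<Rightarrow> real" where
  "graph_shear Q k \<Theta> s c x = (\<lambda>l. let n = mfd_dim Q in
     if l < n then x l
     else if l < n + k * n then x l + s * coeff1 Q (\<Theta> ((l - n) div n + 1)) c ((l - n) mod n) (base_part n x)
     else 0)"

definition graph_chart :: "'a mfd \<Rightarrow> nat \<Rightarrow> (nat \<Rightarrow> 'a form1) \<Rightarrow> 'a chart \<Rightarrow> 'a wpoint chart" where
  "graph_chart Q k \<Theta> c =
     (fst (whitney_chart Q k c), \<lambda>z. graph_shear Q k \<Theta> 1 c (snd (whitney_chart Q k c) z))"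

definition restricted_graph_chart :: "'a mfd \<Rightarrow> nat \<Rightarrow> (nat \<Rightarrow> 'a form1) \<Rightarrow> 'a chart \<Rightarrow> 'a wpoint chart" where
  "restricted_graph_chart Q k \<Theta> c =
     (fst (graph_chart Q k \<Theta> c) \<inter> graph_of Q k \<Theta>, snd (graph_chart Q k \<Theta> c))"

lemma graph_chart_simps:
  "fst (graph_chart Q k \<Theta> c) = fst (whitney_chart Q k c)"
  "snd (graph_chart Q k \<Theta> c) z = graph_shear Q k \<Theta> 1 c (snd (whitney_chart Q k c) z)"
  by (simp_all add: graph_chart_def)

lemma restricted_graph_chart_simps:
  "fst (restricted_graph_chart Q k \<Theta> c) = fst (whitney_chart Q k c) \<inter> graph_of Q k \<Theta>"
  "snd (restricted_graph_chart Q k \<Theta> c) = snd (graph_chart Q k \<Theta> c)"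
  by (simp_all add: restricted_graph_chart_def graph_chart_simps)

lemma fst_graph_point: "fst (graph_point k \<Theta> q) = q"
  by (simp add: graph_point_def)

lemma snd_graph_point: "\<alpha> \<in> {1..k} \<Longrightarrow> snd (graph_point k \<Theta> q) \<alpha> = (\<lambda>u. - \<Theta> \<alpha> q u)"
  by (simp add: graph_point_def)

lemma graph_shear_base: "i < mfd_dim Q \<Longrightarrow> graph_shear Q k \<Theta> s c x i = x i"
  by (simp add: graph_shear_def Let_def)

lemma graph_shear_fibre:
  assumes "\<alpha> \<in> {1..k}" "i < mfd_dim Q"
  shows "graph_shear Q k \<Theta> s c x (fibre_index (mfd_dim Q) \<alpha> i) =
    x (fibre_index (mfd_dim Q) \<alpha> i) + s * coeff1 Q (\<Theta> \<alpha>) c i (base_part (mfd_dim Q) x)"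
  using fibre_index_bounds[OF assms(2,1)] fibre_index_inverse[OF assms(2), of \<alpha>] assms(1)
  by (simp add: graph_shear_def Let_def)

lemma graph_shear_in_rspace: "graph_shear Q k \<Theta> s c x \<in> rspace (mfd_dim Q + k * mfd_dim Q)"
  by (simp add: graph_shear_def Let_def in_rspace_iff)

lemma base_part_graph_shear:
  "base_part (mfd_dim Q) (graph_shear Q k \<Theta> s c x) = base_part (mfd_dim Q) x"
  by (simp add: base_part_def graph_shear_base fun_eq_iff)

lemma graph_shear_inverse:
  assumes "x \<in> rspace (mfd_dim Q + k * mfd_dim Q)" "s' = - s"
  shows "graph_shear Q k \<Theta> s' c (graph_shear Q k \<Theta> s c x) = x"
  by (rule rspace_eqI[OF graph_shear_in_rspace assms(1)])
    (simp_all add: graph_shear_base graph_shear_fibre base_part_graph_shear assms(2))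

lemma whitney_chart_image_eq:
  assumes "atlas_manifold Q" "c \<in> mfd_charts Q"
  shows "snd (whitney_chart Q k c) ` fst (whitney_chart Q k c) =
    {x \<in> rspace (mfd_dim Q + k * mfd_dim Q). base_part (mfd_dim Q) x \<in> snd c ` fst c}"
proof -
  have "{z \<in> fst (whitney_chart Q k c). fst z \<in> fst c} = fst (whitney_chart Q k c)"
    unfolding set_eq_iff mem_Collect_eq whitney_chart_domain by (simp only: conj_ac conj_absorb conj_left_absorb simp_thms)
  then show ?thesis using whitney_chart_image[OF assms subset_refl, of k] by simp
qed

context
  fixes Q :: "'a mfd" and k :: nat and \<Theta> :: "nat \<Rightarrow> 'a form1"
  assumes Q: "atlas_manifold Q" and \<Theta>: "\<And>\<alpha>. \<alpha> \<in> {1..k} \<Longrightarrow> \<Theta> \<alpha> \<in> one_forms Q"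
begin

lemma graph_point_cotangent:
  assumes "q \<in> carrier Q" "\<alpha> \<in> {1..k}"
  shows "(\<lambda>u. - \<Theta> \<alpha> q u) \<in> cotangent_space Q q"
proof -
  have "\<Theta> \<alpha> q \<in> cotangent_space Q q" by (rule one_formsD(1)[OF \<Theta>[OF assms(2)] assms(1)])
  then show ?thesis by (simp add: cotangent_space_def)
qed

lemma graph_point_in_whitney_chart:
  assumes "c \<in> mfd_charts Q"
  shows "graph_point k \<Theta> q \<in> fst (whitney_chart Q k c) \<longleftrightarrow> q \<in> fst c"
proof
  assume "q \<in> fst c"
  then have "q \<in> carrier Q" by (rule mfd_chart_in_carrier[OF Q assms])
  then have "snd (graph_point k \<Theta> q) \<in> {1..k} \<rightarrow>\<^sub>E cotangent_space Q q"
    unfolding graph_point_def snd_conv using graph_point_cotangent by (intro restrict_PiE_iff[THEN iffD2] ballI)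
  then show "graph_point k \<Theta> q \<in> fst (whitney_chart Q k c)"
    unfolding whitney_chart_domain fst_graph_point using \<open>q \<in> fst c\<close> by (intro conjI)
qed (simp add: whitney_chart_domain fst_graph_point)

lemma coeff1_at_point:
  assumes "c \<in> mfd_charts Q" "q \<in> fst c"
  shows "coeff1 Q \<theta> c i (snd c q) = \<theta> q (coord_vector Q c q i)"
  using chart_inv_left[OF chart_inj[OF mfd_is_chart[OF Q assms(1)]] assms(2)] by (simp add: coeff1_def Let_def)

lemma graph_chart_base:
  "i < mfd_dim Q \<Longrightarrow> snd (graph_chart Q k \<Theta> c) z i = snd c (fst z) i"
  by (simp add: graph_chart_simps graph_shear_base whitney_chart_base)

lemma graph_chart_fibre:
  assumes c: "c \<in> mfd_charts Q" and z: "z \<in> fst (whitney_chart Q k c)" and "\<alpha> \<in> {1..k}" "i < mfd_dim Q"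
  shows "snd (graph_chart Q k \<Theta> c) z (fibre_index (mfd_dim Q) \<alpha> i) =
    snd z \<alpha> (coord_vector Q c (fst z) i) + \<Theta> \<alpha> (fst z) (coord_vector Q c (fst z) i)"
proof -
  have "fst z \<in> fst c" using z by (simp only: whitney_chart_domain)
  then show ?thesis
    using assms(3,4)
    by (simp add: graph_chart_simps graph_shear_fibre whitney_chart_fibre base_part_whitney_chart[OF Q c] coeff1_at_point[OF c])
qed

lemma graph_shear_smooth:
  assumes c: "c \<in> mfd_charts Q" and j: "j < mfd_dim Q + k * mfd_dim Q"
  shows "smooth_on (mfd_dim Q + k * mfd_dim Q) (snd (whitney_chart Q k c) ` fst (whitney_chart Q k c))
    (\<lambda>x. graph_shear Q k \<Theta> s c x j)"
proof (cases "j < mfd_dim Q")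
  case True
  then show ?thesis by (simp add: graph_shear_base smooth_on_coordinate)
next
  case False
  let ?n = "mfd_dim Q" and ?U = "snd (whitney_chart Q k c) ` fst (whitney_chart Q k c)"
  obtain \<alpha> i where \<alpha>: "\<alpha> \<in> {1..k}" and i: "i < ?n" and ji: "j = fibre_index ?n \<alpha> i"
    by (rule fibre_index_cases[OF j False])
  note oU = whitney_chart_image_open[OF Q c, of k]
  have "smooth_on (?n + k * ?n) ?U (\<lambda>x. coeff1 Q (\<Theta> \<alpha>) c i (base_part ?n x))"
    by (rule smooth_on_compose[OF oU chart_image_open[OF mfd_is_chart[OF Q c]] smooth_on_base_part _ one_formsD(3)[OF \<Theta>[OF \<alpha>] c i]])
      (unfold whitney_chart_image_eq[OF Q c], auto)
  then show ?thesis
    unfolding ji graph_shear_fibre[OF \<alpha> i]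
    by (intro smooth_on_add[OF oU] smooth_on_mult[OF oU] smooth_on_coordinate smooth_on_const)
qed

lemma graph_chart_in_charts:
  assumes c: "c \<in> mfd_charts Q"
  shows "graph_chart Q k \<Theta> c \<in> mfd_charts (whitney_sum Q k)"
proof -
  let ?w = "whitney_chart Q k c" and ?m = "mfd_dim Q + k * mfd_dim Q" and ?W = "whitney_sum Q k"
  note aW = whitney_sum_atlas_manifold[OF Q, of k]
  have w: "is_chart (mfd_top ?W) ?m ?w"
    using mfd_is_chart[OF aW whitney_chart_in_charts[OF Q c]] by (simp only: whitney_sum_simps)
  have V: "graph_shear Q k \<Theta> s c x \<in> snd ?w ` fst ?w" "x \<in> rspace ?m" if "x \<in> snd ?w ` fst ?w" for x s
    using that unfolding whitney_chart_image_eq[OF Q c] by (simp_all add: graph_shear_in_rspace base_part_graph_shear)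
  note cc = chart_change[OF w graph_chart_simps(1)[of Q k \<Theta> c] graph_chart_simps(2) refl
      V(1)[of _ 1] V(1)[of _ "-1"] graph_shear_inverse[OF V(2)] graph_shear_inverse[OF V(2)]
      graph_shear_smooth[OF c, of _ 1] graph_shear_smooth[OF c, of _ "-1"]]
  show ?thesis
  proof (rule mfd_maximal[OF aW]; unfold whitney_sum_simps)
    show "is_chart (mfd_top ?W) ?m (graph_chart Q k \<Theta> c)" by (rule cc(1)) simp_all
    fix a assume a: "a \<in> mfd_charts ?W"
    show "compatible ?m (graph_chart Q k \<Theta> c) a"
      using cc(3)[of a] mfd_is_chart[OF aW a] mfd_compatible[OF aW whitney_chart_in_charts[OF Q c] a]
      by (simp only: whitney_sum_simps minus_minus simp_thms)
  qed
qed

text \<open>The sheared covector coordinates of a point \<open>(q, p)\<close> are the components of \<open>p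
  \<alpha> + \<Theta> \<alpha> q\<close>.\<close>

lemma graph_chart_zero_iff:
  assumes c: "c \<in> mfd_charts Q" and z: "z \<in> fst (whitney_chart Q k c)"
  shows "(\<forall>l\<ge>mfd_dim Q. snd (graph_chart Q k \<Theta> c) z l = 0) \<longleftrightarrow> z \<in> graph_of Q k \<Theta>"
proof
  let ?n = "mfd_dim Q"
  have zc: "fst z \<in> fst c" and p: "snd z \<in> {1..k} \<rightarrow>\<^sub>E cotangent_space Q (fst z)"
    using z by (simp_all only: whitney_chart_domain)
  have zQ: "fst z \<in> carrier Q" by (rule mfd_chart_in_carrier[OF Q c zc])
  {
    assume zero: "\<forall>l\<ge>?n. snd (graph_chart Q k \<Theta> c) z l = 0"
    have "snd z = snd (graph_point k \<Theta> (fst z))"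
    proof (rule PiE_ext[OF p])
      show "snd (graph_point k \<Theta> (fst z)) \<in> {1..k} \<rightarrow>\<^sub>E cotangent_space Q (fst z)"
        using graph_point_in_whitney_chart[OF c, of "fst z"] zc
        by (simp only: whitney_chart_domain fst_graph_point simp_thms)
      fix \<alpha> assume \<alpha>: "\<alpha> \<in> {1..k}"
      show "snd z \<alpha> = snd (graph_point k \<Theta> (fst z)) \<alpha>"
        unfolding snd_graph_point[OF \<alpha>]
      proof (rule cotangent_eqI[OF Q charts_atI[OF c zc] PiE_mem[OF p \<alpha>] graph_point_cotangent[OF zQ \<alpha>]])
        fix i assume i: "i < ?n"
        have "snd (graph_chart Q k \<Theta> c) z (fibre_index ?n \<alpha> i) = 0"
          using zero fibre_index_bounds(1)[OF i \<alpha>] by simp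
        then show "snd z \<alpha> (coord_vector Q c (fst z) i) = - \<Theta> \<alpha> (fst z) (coord_vector Q c (fst z) i)"
          unfolding graph_chart_fibre[OF c z \<alpha> i] by simp
      qed
    qed
    then have "z = graph_point k \<Theta> (fst z)" by (simp add: prod_eq_iff fst_graph_point)
    then show "z \<in> graph_of Q k \<Theta>" unfolding graph_of_def using zQ by (rule image_eqI)
  }
  assume "z \<in> graph_of Q k \<Theta>"
  then obtain q where "z = graph_point k \<Theta> q" unfolding graph_of_def by (rule imageE)
  then have zq: "z = graph_point k \<Theta> (fst z)" by (simp add: fst_graph_point)
  show "\<forall>l\<ge>?n. snd (graph_chart Q k \<Theta> c) z l = 0"
  proof (intro allI impI)
    fix l assume l: "l \<ge> ?n"
    show "snd (graph_chart Q k \<Theta> c) z l = 0"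
    proof (cases "l < ?n + k * ?n")
      case True
      obtain \<alpha> i where \<alpha>: "\<alpha> \<in> {1..k}" and i: "i < ?n" and li: "l = fibre_index ?n \<alpha> i"
        by (rule fibre_index_cases[OF True]) (use l in auto)
      have "snd z \<alpha> = (\<lambda>u. - \<Theta> \<alpha> (fst z) u)" using snd_graph_point[OF \<alpha>, of \<Theta> "fst z"] zq by simp
      then show ?thesis unfolding li graph_chart_fibre[OF c z \<alpha> i] by simp
    next
      case False
      then show ?thesis
        using graph_shear_in_rspace[of Q k \<Theta> 1 c "snd (whitney_chart Q k c) z"]
        by (simp add: graph_chart_simps in_rspace_iff)
    qed
  qed
qed

lemma graph_chart_slice:
  assumes c: "c \<in> mfd_charts Q"
  shows "graph_chart Q k \<Theta> c \<in> slice_charts (whitney_sum Q k) (mfd_dim Q) (graph_of Q k \<Theta>)"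
proof -
  let ?g = "graph_chart Q k \<Theta> c"
  have "snd ?g ` (fst ?g \<inter> graph_of Q k \<Theta>) = {x \<in> snd ?g ` fst ?g. \<forall>i\<ge>mfd_dim Q. x i = 0}"
  proof
    show "snd ?g ` (fst ?g \<inter> graph_of Q k \<Theta>) \<subseteq> {x \<in> snd ?g ` fst ?g. \<forall>i\<ge>mfd_dim Q. x i = 0}"
    proof (rule image_subsetI)
      fix z assume "z \<in> fst ?g \<inter> graph_of Q k \<Theta>"
      then have z: "z \<in> fst ?g" "z \<in> graph_of Q k \<Theta>" by (rule IntD1, rule IntD2)
      have "\<forall>i\<ge>mfd_dim Q. snd ?g z i = 0"
        by (rule iffD2[OF graph_chart_zero_iff[OF c z(1)[unfolded graph_chart_simps(1)]] z(2)])
      then show "snd ?g z \<in> {x \<in> snd ?g ` fst ?g. \<forall>i\<ge>mfd_dim Q. x i = 0}"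
        unfolding mem_Collect_eq using imageI[OF z(1)] by (rule conjI[rotated])
    qed
    show "{x \<in> snd ?g ` fst ?g. \<forall>i\<ge>mfd_dim Q. x i = 0} \<subseteq> snd ?g ` (fst ?g \<inter> graph_of Q k \<Theta>)"
    proof
      fix x assume "x \<in> {x \<in> snd ?g ` fst ?g. \<forall>i\<ge>mfd_dim Q. x i = 0}"
      then have x: "x \<in> snd ?g ` fst ?g" "\<forall>i\<ge>mfd_dim Q. x i = 0" unfolding mem_Collect_eq by (rule conjunct1, rule conjunct2)
      from x(1) obtain z where z: "x = snd ?g z" "z \<in> fst ?g" by (rule imageE)
      have "z \<in> graph_of Q k \<Theta>"
        by (rule iffD1[OF graph_chart_zero_iff[OF c z(2)[unfolded graph_chart_simps(1)]] x(2)[unfolded z(1)]])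
      then show "x \<in> snd ?g ` (fst ?g \<inter> graph_of Q k \<Theta>)" unfolding z(1) by (intro imageI IntI z(2))
    qed
  qed
  then show ?thesis using graph_chart_in_charts[OF c] by (simp add: slice_charts_def)
qed

lemma graph_of_charts:
  assumes "z \<in> graph_of Q k \<Theta>"
  shows "fst z \<in> carrier Q" "z = graph_point k \<Theta> (fst z)"
    "c \<in> charts_at Q (fst z) \<Longrightarrow> z \<in> fst (whitney_chart Q k c)"
proof -
  from assms obtain q where q: "z = graph_point k \<Theta> q" "q \<in> carrier Q" unfolding graph_of_def by (rule imageE)
  then show 1: "fst z \<in> carrier Q" "z = graph_point k \<Theta> (fst z)" by (simp_all add: fst_graph_point)
  assume c: "c \<in> charts_at Q (fst z)"
  have "graph_point k \<Theta> (fst z) \<in> fst (whitney_chart Q k c)"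
    unfolding graph_point_in_whitney_chart[OF charts_atD(1)[OF c]] by (rule charts_atD(2)[OF c])
  then show "z \<in> fst (whitney_chart Q k c)" by (subst 1(2))
qed

lemma graph_embedded: "embedded_submanifold (whitney_sum Q k) (mfd_dim Q) (graph_of Q k \<Theta>)"
  unfolding embedded_submanifold_def
proof (intro conjI ballI subsetI)
  let ?W = "whitney_sum Q k"
  note aW = whitney_sum_atlas_manifold[OF Q, of k]
  show "mfd_dim Q \<le> mfd_dim ?W" by (simp add: whitney_sum_simps)
  fix z assume z: "z \<in> graph_of Q k \<Theta>"
  obtain c where c: "c \<in> charts_at Q (fst z)" by (rule charts_at_exists[OF Q graph_of_charts(1)[OF z]])
  note zc = graph_of_charts(3)[OF z c]
  show "z \<in> carrier ?W" by (rule mfd_chart_in_carrier[OF aW whitney_chart_in_charts[OF Q charts_atD(1)[OF c]] zc])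
  show "\<exists>c\<in>slice_charts ?W (mfd_dim Q) (graph_of Q k \<Theta>). z \<in> fst c"
    by (rule bexI[OF _ graph_chart_slice[OF charts_atD(1)[OF c]]]) (simp only: graph_chart_simps zc)
qed

lemma graph_mfd_simps:
  "mfd_dim (foliated_mfd Q k 0 (graph_of Q k \<Theta>)) = mfd_dim Q"
  "carrier (foliated_mfd Q k 0 (graph_of Q k \<Theta>)) = graph_of Q k \<Theta>"
  using graph_embedded by (auto simp: foliated_mfd_def submfd_def embedded_submanifold_def)

lemma graph_atlas_manifold: "atlas_manifold (foliated_mfd Q k 0 (graph_of Q k \<Theta>))"
  unfolding foliated_mfd_def submfd_def add_0_right
  by (rule mfd_generated_atlas_manifold[OF slice_compatible_atlas[OF whitney_sum_atlas_manifold[OF Q] graph_embedded]])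

lemma restricted_graph_chart_in_charts:
  assumes "c \<in> mfd_charts Q"
  shows "restricted_graph_chart Q k \<Theta> c \<in> mfd_charts (foliated_mfd Q k 0 (graph_of Q k \<Theta>))"
  unfolding foliated_mfd_def submfd_def add_0_right
proof (rule subsetD[OF mfd_generated_superset[OF slice_compatible_atlas[OF whitney_sum_atlas_manifold[OF Q] graph_embedded]]])
  show "restricted_graph_chart Q k \<Theta> c \<in>
    {(fst c \<inter> graph_of Q k \<Theta>, snd c) | c. c \<in> slice_charts (whitney_sum Q k) (mfd_dim Q) (graph_of Q k \<Theta>)}"
    unfolding restricted_graph_chart_def mem_Collect_eq
    by (rule exI[of _ "graph_chart Q k \<Theta> c"]) (use graph_chart_slice[OF assms] in simp)
qed

lemma restricted_graph_chart_matched: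
  assumes c: "c \<in> mfd_charts Q"
  shows "matched whitney_proj (restricted_graph_chart Q k \<Theta> c) c"
  unfolding matched_def whitney_proj_def restricted_graph_chart_simps
proof (intro conjI ballI)
  let ?S = "graph_of Q k \<Theta>" and ?w = "whitney_chart Q k c"
  show "inj_on fst (fst ?w \<inter> ?S)"
  proof (rule inj_onI)
    fix z z' assume "z \<in> fst ?w \<inter> ?S" "z' \<in> fst ?w \<inter> ?S" and eq: "fst z = fst z'"
    then have "z \<in> ?S" "z' \<in> ?S" by simp_all
    from graph_of_charts(2)[OF this(1)] graph_of_charts(2)[OF this(2)] eq show "z = z'" by simp
  qed
  show "fst ` (fst ?w \<inter> ?S) = fst c"
  proof
    show "fst ` (fst ?w \<inter> ?S) \<subseteq> fst c" by (rule image_subsetI) (simp add: whitney_chart_domain)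
    show "fst c \<subseteq> fst ` (fst ?w \<inter> ?S)"
    proof
      fix q assume q: "q \<in> fst c"
      then have "graph_point k \<Theta> q \<in> fst ?w" by (simp only: graph_point_in_whitney_chart[OF c])
      moreover have "graph_point k \<Theta> q \<in> ?S"
        unfolding graph_of_def by (rule imageI[OF mfd_chart_in_carrier[OF Q c q]])
      ultimately show "q \<in> fst ` (fst ?w \<inter> ?S)" by (intro image_eqI[of _ _ "graph_point k \<Theta> q"] IntI) (simp add: fst_graph_point)
    qed
  qed
  fix z assume "z \<in> fst ?w \<inter> ?S"
  then have z: "z \<in> fst ?w" "z \<in> ?S" by simp_all
  have "fst z \<in> fst c" using z(1) by (simp only: whitney_chart_domain)
  then have r: "snd c (fst z) \<in> rspace (mfd_dim Q)" using chart_image_subset[OF mfd_is_chart[OF Q c]] by auto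
  show "snd c (fst z) = snd (graph_chart Q k \<Theta> c) z"
  proof
    fix l
    show "snd c (fst z) l = snd (graph_chart Q k \<Theta> c) z l"
      using r graph_chart_zero_iff[OF c z(1)] z(2) graph_chart_base[of l c z]
      by (cases "l < mfd_dim Q") (simp_all add: in_rspace_iff)
  qed
qed

lemma graph_chart_at:
  assumes z: "z \<in> graph_of Q k \<Theta>" and c: "c \<in> charts_at Q (fst z)"
  shows "restricted_graph_chart Q k \<Theta> c \<in> charts_at (foliated_mfd Q k 0 (graph_of Q k \<Theta>)) z"
  using graph_of_charts(3)[OF z c] z
  by (intro charts_atI restricted_graph_chart_in_charts charts_atD(1)[OF c]) (simp add: restricted_graph_chart_simps)

lemma graph_projection_diffeomorphism:
  "diffeomorphism (foliated_mfd Q k 0 (graph_of Q k \<Theta>)) Q whitney_proj"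
proof (rule diffeomorphismI[OF graph_atlas_manifold Q])
  show "mfd_dim Q = mfd_dim (foliated_mfd Q k 0 (graph_of Q k \<Theta>))" by (simp only: graph_mfd_simps)
  show "bij_betw whitney_proj (carrier (foliated_mfd Q k 0 (graph_of Q k \<Theta>))) (carrier Q)"
    unfolding graph_mfd_simps unfolding graph_of_def
    by (rule bij_betw_byWitness[where f' = "graph_point k \<Theta>"]) (auto simp: whitney_proj_def fst_graph_point)
  fix z assume "z \<in> carrier (foliated_mfd Q k 0 (graph_of Q k \<Theta>))"
  then have z: "z \<in> graph_of Q k \<Theta>" by (simp only: graph_mfd_simps)
  obtain c where c: "c \<in> charts_at Q (fst z)" by (rule charts_at_exists[OF Q graph_of_charts(1)[OF z]])
  show "\<exists>r\<in>charts_at (foliated_mfd Q k 0 (graph_of Q k \<Theta>)) z. \<exists>c\<in>mfd_charts Q. matched whitney_proj r c"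
    by (intro bexI[of _ "restricted_graph_chart Q k \<Theta> c"] bexI[of _ c] graph_chart_at[OF z c]
        restricted_graph_chart_matched charts_atD(1)[OF c])
qed

lemma graph_inclusion_smooth:
  "smooth_map (foliated_mfd Q k 0 (graph_of Q k \<Theta>)) (whitney_sum Q k) (\<lambda>z. z)"
proof (rule smooth_mapI[OF graph_atlas_manifold whitney_sum_atlas_manifold[OF Q]])
  let ?M = "foliated_mfd Q k 0 (graph_of Q k \<Theta>)" and ?W = "whitney_sum Q k"
  fix z assume "z \<in> carrier ?M"
  then have z: "z \<in> graph_of Q k \<Theta>" by (simp only: graph_mfd_simps)
  obtain c where c: "c \<in> charts_at Q (fst z)" by (rule charts_at_exists[OF Q graph_of_charts(1)[OF z]])
  let ?r = "restricted_graph_chart Q k \<Theta> c" and ?g = "graph_chart Q k \<Theta> c"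
  have ir: "is_chart (mfd_top ?M) (mfd_dim ?M) ?r"
    by (rule mfd_is_chart[OF graph_atlas_manifold restricted_graph_chart_in_charts[OF charts_atD(1)[OF c]]])
  have "smooth_rep (mfd_dim ?M) (mfd_dim ?W) ?r ?g (\<lambda>z. z) (fst ?r)"
    unfolding smooth_rep_def
  proof (intro allI impI)
    fix j
    show "smooth_on (mfd_dim ?M) (snd ?r ` fst ?r) (\<lambda>x. snd ?g (chart_inv ?r x) j)"
      by (rule smooth_on_cong[OF chart_image_open[OF ir] _ smooth_on_coordinate[of _ _ j]])
        (simp only: restricted_graph_chart_simps(2)[symmetric] chart_inv_right(1))
  qed
  moreover have "(\<lambda>z. z) ` fst ?r \<subseteq> fst ?g" by (simp add: restricted_graph_chart_simps graph_chart_simps)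
  ultimately show "\<exists>r\<in>charts_at ?M z. \<exists>g\<in>mfd_charts ?W. (\<lambda>z. z) ` fst r \<subseteq> fst g \<and>
      smooth_rep (mfd_dim ?M) (mfd_dim ?W) r g (\<lambda>z. z) (fst r)"
    by (intro bexI[of _ ?r] bexI[of _ ?g] conjI graph_chart_at[OF z c] graph_chart_in_charts charts_atD(1)[OF c])
qed

text \<open>In coordinates, the inclusion of the graph is \<open>x \<mapsto> (x, - \<Theta> x)\<close>. Hence
  the covector coordinates of a tangent vector of the graph are derivatives of the coefficients of the
  one-forms.\<close>

lemma tangent_map_graph_inclusion:
  assumes z: "z \<in> graph_of Q k \<Theta>" and c: "c \<in> charts_at Q (fst z)"
    and u: "u \<in> tangent_space (foliated_mfd Q k 0 (graph_of Q k \<Theta>)) z"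
  defines "u' \<equiv> tangent_map (foliated_mfd Q k 0 (graph_of Q k \<Theta>)) (whitney_sum Q k) (\<lambda>z. z) z u (whitney_chart Q k c)"
    and "ur \<equiv> u (restricted_graph_chart Q k \<Theta> c)"
  shows "i < mfd_dim Q \<Longrightarrow> u' i = ur i"
    "i < mfd_dim Q \<Longrightarrow> \<alpha> \<in> {1..k} \<Longrightarrow> u' (fibre_index (mfd_dim Q) \<alpha> i) =
      - (\<Sum>j<mfd_dim Q. partial j (coeff1 Q (\<Theta> \<alpha>) c i) (snd c (fst z)) * ur j)"
proof -
  let ?M = "foliated_mfd Q k 0 (graph_of Q k \<Theta>)" and ?W = "whitney_sum Q k" and ?n = "mfd_dim Q"
  let ?r = "restricted_graph_chart Q k \<Theta> c" and ?w = "whitney_chart Q k c"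
  note cQ = charts_atD(1)[OF c] and ic = mfd_is_chart[OF Q charts_atD(1)[OF c]]
  note m = restricted_graph_chart_matched[OF cQ]
  have ir: "is_chart (mfd_top ?M) ?n ?r"
    using mfd_is_chart[OF graph_atlas_manifold restricted_graph_chart_in_charts[OF cQ]] by (simp only: graph_mfd_simps)
  have zr: "z \<in> fst ?r" by (rule charts_atD(2)[OF graph_chart_at[OF z c]])
  have rz: "snd ?r z = snd c (fst z)" using m zr unfolding matched_def whitney_proj_def by simp
  have x: "snd ?r z \<in> snd ?r ` fst ?r" using zr by (rule imageI)
  have w: "?w \<in> charts_at ?W z"
    by (rule charts_atI[OF whitney_chart_in_charts[OF Q cQ] graph_of_charts(3)[OF z c]])
  have zM: "z \<in> carrier ?M" using z by (simp only: graph_mfd_simps)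
  have u'_eq: "u' l = (\<Sum>j<?n. jacobian (\<lambda>z. z) ?r ?w z l j * ur j)" if "l < ?n + k * ?n" for l
    using tangent_map_coordinate[OF graph_atlas_manifold whitney_sum_atlas_manifold[OF Q] graph_inclusion_smooth zM u
        graph_chart_at[OF z c] w, of l] that
    unfolding u'_def ur_def by (simp only: graph_mfd_simps whitney_sum_simps)
  have inv: "fst (chart_inv ?r x) = chart_inv c x" "chart_inv ?r x \<in> graph_of Q k \<Theta>" "chart_inv c x \<in> fst c"
    "snd c (chart_inv c x) = x" if "x \<in> snd ?r ` fst ?r" for x
  proof -
    show "fst (chart_inv ?r x) = chart_inv c x"
      using matched_chart_inv[OF m chart_inj[OF ir] that] by (simp add: whitney_proj_def)
    show "chart_inv ?r x \<in> graph_of Q k \<Theta>"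
      using chart_inv_right(2)[OF that] by (simp add: restricted_graph_chart_simps)
    have "x \<in> snd c ` fst c" using that matched_image_eq[OF m] by simp
    then show "chart_inv c x \<in> fst c" "snd c (chart_inv c x) = x" by (rule chart_inv_right)+
  qed
  show "u' i = ur i" if i: "i < ?n"
  proof -
    have jac: "jacobian (\<lambda>z. z) ?r ?w z i j = (if j = i then 1 else 0)" if j: "j < ?n" for j
    proof -
      have "jacobian (\<lambda>z. z) ?r ?w z i j = partial j (\<lambda>x. x i) (snd ?r z)"
        unfolding jacobian_def
        by (rule partial_cong[OF chart_image_open[OF ir] x j]) (simp only: whitney_chart_base[OF i] inv)
      then show ?thesis by (simp add: partial_coordinate)
    qed
    have "u' i = (\<Sum>j<?n. if j = i then ur i else 0)"
      unfolding u'_eq[OF trans_less_add1[OF i]] by (intro sum.cong refl) (simp add: jac)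
    then show ?thesis using i by simp
  qed
  show "u' (fibre_index ?n \<alpha> i) = - (\<Sum>j<?n. partial j (coeff1 Q (\<Theta> \<alpha>) c i) (snd c (fst z)) * ur j)"
    if i: "i < ?n" and \<alpha>: "\<alpha> \<in> {1..k}"
  proof -
    have sm: "smooth_on ?n (snd ?r ` fst ?r) (coeff1 Q (\<Theta> \<alpha>) c i)"
      using one_formsD(3)[OF \<Theta>[OF \<alpha>] cQ i] matched_image_eq[OF m] by simp
    have jac: "jacobian (\<lambda>z. z) ?r ?w z (fibre_index ?n \<alpha> i) j = - partial j (coeff1 Q (\<Theta> \<alpha>) c i) (snd c (fst z))"
      if j: "j < ?n" for j
    proof -
      have "jacobian (\<lambda>z. z) ?r ?w z (fibre_index ?n \<alpha> i) j = partial j (\<lambda>x. - 1 * coeff1 Q (\<Theta> \<alpha>) c i x) (snd ?r z)"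
        unfolding jacobian_def
      proof (rule partial_cong[OF chart_image_open[OF ir] x j])
        fix y assume y: "y \<in> snd ?r ` fst ?r"
        have "snd (chart_inv ?r y) \<alpha> = (\<lambda>u. - \<Theta> \<alpha> (chart_inv c y) u)"
          using snd_graph_point[OF \<alpha>, of \<Theta> "chart_inv c y"] graph_of_charts(2)[OF inv(2)[OF y]] inv(1)[OF y] by simp
        then show "snd ?w (chart_inv ?r y) (fibre_index ?n \<alpha> i) = - 1 * coeff1 Q (\<Theta> \<alpha>) c i y"
          unfolding whitney_chart_fibre[OF i \<alpha>] inv(1)[OF y]
          using coeff1_at_point[OF cQ inv(3)[OF y], of "\<Theta> \<alpha>" i] inv(4)[OF y] by simp
      qed
      also have "\<dots> = - partial j (coeff1 Q (\<Theta> \<alpha>) c i) (snd ?r z)"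
        using partial_mult[OF smooth_on_const[of _ _ "- 1"] sm x j] by (simp add: partial_def)
      finally show ?thesis unfolding rz .
    qed
    show ?thesis
      unfolding u'_eq[OF fibre_index_bounds(2)[OF i \<alpha>]] sum_negf[symmetric]
      by (intro sum.cong refl) (simp add: jac)
  qed
qed

text \<open>In every adapted chart, \<open>dq \<and> dp\<close> applied to the images of \<open>u\<close> and
  \<open>v\<close> becomes the coordinate expression of the exterior derivative. That expression has the same
  value in all charts, and this value is the one that the definite description in the canonical symplectic
  form selects.\<close>

lemma graph_canonical_form:
  assumes \<alpha>: "\<alpha> \<in> {1..k}"
  shows "pullback (foliated_mfd Q k 0 (graph_of Q k \<Theta>)) (whitney_sum Q k) (\<lambda>z. z) (canonical_two_form Q k \<alpha>) =
    pullback (foliated_mfd Q k 0 (graph_of Q k \<Theta>)) Q whitney_proj (ext_deriv Q (\<Theta> \<alpha>))"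
proof (intro ext)
  let ?M = "foliated_mfd Q k 0 (graph_of Q k \<Theta>)" and ?W = "whitney_sum Q k" and ?T = "cotangent_bundle Q"
  let ?n = "mfd_dim Q"
  note aM = graph_atlas_manifold and aW = whitney_sum_atlas_manifold[OF Q, of k] and aT = cotangent_bundle_atlas_manifold[OF Q]
  note sM = graph_inclusion_smooth and sW = whitney_component_smooth[OF Q \<alpha>]
  have iso: "mfd_iso ?M Q whitney_proj (inv_into (carrier ?M) whitney_proj)"
    by (rule diffeomorphism_imp_mfd_iso[OF aM Q graph_mfd_simps(1)[symmetric] graph_projection_diffeomorphism])
  fix z u v
  show "pullback ?M ?W (\<lambda>z. z) (canonical_two_form Q k \<alpha>) z u v =
    pullback ?M Q whitney_proj (ext_deriv Q (\<Theta> \<alpha>)) z u v"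
  proof (cases "z \<in> carrier ?M \<and> u \<in> tangent_space ?M z \<and> v \<in> tangent_space ?M z")
    case False
    then show ?thesis unfolding pullback_def by auto
  next
    case True
    then have zM: "z \<in> carrier ?M" and u: "u \<in> tangent_space ?M z" and v: "v \<in> tangent_space ?M z" by simp_all
    have z: "z \<in> graph_of Q k \<Theta>" using zM by (simp only: graph_mfd_simps)
    define u' where "u' = tangent_map ?M ?W (\<lambda>z. z) z u"
    define v' where "v' = tangent_map ?M ?W (\<lambda>z. z) z v"
    define u'' where "u'' = tangent_map ?W ?T (whitney_component \<alpha>) z u'"
    define v'' where "v'' = tangent_map ?W ?T (whitney_component \<alpha>) z v'"
    have zW: "z \<in> carrier ?W" by (rule smooth_map_in_carrier[OF sM zM])
    have zT: "whitney_component \<alpha> z \<in> carrier ?T" by (rule smooth_map_in_carrier[OF sW zW])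
    have u': "u' \<in> tangent_space ?W z" and v': "v' \<in> tangent_space ?W z"
      unfolding u'_def v'_def by (rule tangent_map_in_tangent_space[OF aM aW sM zM], rule u v)+
    have u'': "u'' \<in> tangent_space ?T (whitney_component \<alpha> z)" and v'': "v'' \<in> tangent_space ?T (whitney_component \<alpha> z)"
      unfolding u''_def v''_def by (rule tangent_map_in_tangent_space[OF aW aT sW zW], rule u' v')+
    define D where "D = ext_deriv Q (\<Theta> \<alpha>) (whitney_proj z) (tangent_map ?M Q whitney_proj z u) (tangent_map ?M Q whitney_proj z v)"
    let ?w = "\<lambda>c. \<Sum>i<?n. u'' (cotangent_chart Q c) i * v'' (cotangent_chart Q c) (?n + i) -
        v'' (cotangent_chart Q c) i * u'' (cotangent_chart Q c) (?n + i)"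
    have D: "?w c = D" if c: "c \<in> charts_at Q (fst z)" for c
    proof -
      let ?r = "restricted_graph_chart Q k \<Theta> c"
      let ?H = "\<lambda>j i. partial j (coeff1 Q (\<Theta> \<alpha>) c i) (snd c (fst z))"
      note cQ = charts_atD(1)[OF c] and m = restricted_graph_chart_matched[OF charts_atD(1)[OF c]]
      have coords: "t'' (cotangent_chart Q c) i = t ?r i"
        "t'' (cotangent_chart Q c) (?n + i) = - (\<Sum>j<?n. ?H j i * t ?r j)"
        if t: "t \<in> tangent_space ?M z" and i: "i < ?n"
          and t'': "t'' = tangent_map ?W ?T (whitney_component \<alpha>) z (tangent_map ?M ?W (\<lambda>z. z) z t)" for t t'' i
      proof -
        note t' = tangent_map_in_tangent_space[OF aM aW sM zM t]
        note zc = graph_of_charts(3)[OF z c]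
        show "t'' (cotangent_chart Q c) i = t ?r i"
          unfolding t'' using tangent_map_whitney_component[OF Q \<alpha> cQ zc t', of i] i tangent_map_graph_inclusion(1)[OF z c t i]
          by (simp add: component_index_def)
        show "t'' (cotangent_chart Q c) (?n + i) = - (\<Sum>j<?n. ?H j i * t ?r j)"
          unfolding t'' using tangent_map_whitney_component[OF Q \<alpha> cQ zc t', of "?n + i"] i tangent_map_graph_inclusion(2)[OF z c t i \<alpha>]
          by (simp add: component_index_def)
      qed
      note cu = coords[OF u _ u''_def[unfolded u'_def]] and cv = coords[OF v _ v''_def[unfolded v'_def]]
      have pz: "whitney_proj z = fst z" by (simp add: whitney_proj_def)
      have c': "c \<in> charts_at Q (whitney_proj z)" unfolding pz by (rule c)
      have "D = chart_deriv Q (\<Theta> \<alpha>) c (whitney_proj z) (tangent_map ?M Q whitney_proj z u) (tangent_map ?M Q whitney_proj z v)"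
        unfolding D_def
        by (rule ext_deriv_in_chart[OF Q \<Theta>[OF \<alpha>] mfd_isoD(8)[OF iso zM] c'
              mfd_iso_tangent_map_in[OF iso zM u] mfd_iso_tangent_map_in[OF iso zM v]])
      also have "\<dots> = (\<Sum>j<?n. \<Sum>i<?n. ?H j i * (u ?r j * v ?r i - u ?r i * v ?r j))"
        unfolding pz[symmetric]
        by (intro sum.cong refl)
          (simp add: mfd_iso_tangent_map_coordinate[OF iso zM u graph_chart_at[OF z c] c' m, unfolded graph_mfd_simps]
            mfd_iso_tangent_map_coordinate[OF iso zM v graph_chart_at[OF z c] c' m, unfolded graph_mfd_simps])
      also have "\<dots> = (\<Sum>i<?n. \<Sum>j<?n. ?H j i * (u ?r j * v ?r i - u ?r i * v ?r j))"
        by (rule sum.swap)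
      also have "\<dots> = (\<Sum>i<?n. u ?r i * - (\<Sum>j<?n. ?H j i * v ?r j) - v ?r i * - (\<Sum>j<?n. ?H j i * u ?r j))"
      proof (intro sum.cong refl)
        fix i
        show "(\<Sum>j<?n. ?H j i * (u ?r j * v ?r i - u ?r i * v ?r j)) =
          u ?r i * - (\<Sum>j<?n. ?H j i * v ?r j) - v ?r i * - (\<Sum>j<?n. ?H j i * u ?r j)"
          by (simp add: sum_distrib_left sum_subtractf[symmetric] algebra_simps)
      qed
      also have "\<dots> = ?w c"
        by (intro sum.cong refl) (simp add: cu cv)
      finally show ?thesis by simp
    qed
    obtain c0 where c0: "c0 \<in> charts_at Q (fst z)" by (rule charts_at_exists[OF Q graph_of_charts(1)[OF z]])
    have "pullback ?M ?W (\<lambda>z. z) (canonical_two_form Q k \<alpha>) z u v =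
        canonical_symplectic Q (whitney_component \<alpha> z) u'' v''"
      using True zW u' v' by (simp add: pullback_def canonical_two_form_def u'_def v'_def u''_def v''_def)
    also have "\<dots> = (THE w. \<forall>c\<in>charts_at Q (fst z). w = ?w c)"
      using zT u'' v'' by (simp add: canonical_symplectic_def Let_def whitney_component_simps)
    also have "\<dots> = D"
    proof (rule the_equality)
      show "\<forall>c\<in>charts_at Q (fst z). D = ?w c" using D by (intro ballI) simp
      show "w = D" if "\<forall>c\<in>charts_at Q (fst z). w = ?w c" for w
        using bspec[OF that c0] D[OF c0] by simp
    qed
    also have "\<dots> = pullback ?M Q whitney_proj (ext_deriv Q (\<Theta> \<alpha>)) z u v"
      using True by (simp add: pullback_def D_def)
    finally show ?thesis .
  qed
qed

end

section \<open>From forms on the base to rank-zero bundles\<close>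

definition point_mfd :: "'a \<Rightarrow> 'a mfd" where
  "point_mfd z = mfd_generated (discrete_topology {z}) 0 {}"

lemma point_mfd_smooth_manifold: "smooth_manifold (point_mfd z)"
proof -
  have ch: "c \<in> mfd_charts (point_mfd z) \<longleftrightarrow> is_chart (discrete_topology {z}) 0 c" for c
    unfolding point_mfd_def in_mfd_generated_charts by simp
  have comp: "compatible 0 c d" for c d :: "'a chart"
    by (simp add: compatible_iff_smooth_rep smooth_rep_def)
  have c0: "is_chart (discrete_topology {z}) 0 ({z}, \<lambda>_ _. 0)"
    unfolding is_chart_iff fst_conv snd_conv
  proof (intro conjI allI impI)
    fix W assume "W \<subseteq> {z}"
    have "(\<lambda>_ _. 0) ` W = {} \<or> (\<lambda>_ _. 0) ` W = rspace 0"
      by (auto simp: rspace_def fun_eq_iff)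
    then have "openin (Euclidean_space 0) ((\<lambda>_ _. 0) ` W)" using openin_rspace[of 0] by auto
    then show "openin (discrete_topology {z}) W = openin (Euclidean_space 0) ((\<lambda>_ _. 0) ` W)"
      using \<open>W \<subseteq> {z}\<close> by simp
  qed (simp_all add: in_rspace_iff image_subset_iff)
  have "(\<Union>c\<in>mfd_charts (point_mfd z). fst c) = {z}"
  proof
    show "(\<Union>c\<in>mfd_charts (point_mfd z). fst c) \<subseteq> {z}"
    proof
      fix p assume "p \<in> (\<Union>c\<in>mfd_charts (point_mfd z). fst c)"
      then obtain c where "c \<in> mfd_charts (point_mfd z)" "p \<in> fst c" by (rule UN_E)
      then show "p \<in> {z}" using chart_in_topspace[of "discrete_topology {z}" 0 c p] by (simp add: ch)
    qed
    show "{z} \<subseteq> (\<Union>c\<in>mfd_charts (point_mfd z). fst c)"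
      using c0 ch by (intro subsetI UN_I[of "({z}, \<lambda>_ _. 0)"]) simp_all
  qed
  then have "atlas_manifold (point_mfd z)"
    unfolding atlas_manifold_def compatible_atlas_def
    using comp ch by (simp add: point_mfd_def del: split_paired_All)
  then show ?thesis
    unfolding smooth_manifold_iff by (simp add: point_mfd_def Hausdorff_space_discrete_topology second_countable_discrete_topology)
qed

lemma point_mfd_simps: "mfd_dim (point_mfd z) = 0" "carrier (point_mfd z) = {z}"
  by (simp_all add: point_mfd_def)

lemma open_submfd_carrier:
  assumes "atlas_manifold M"
  shows "open_submfd M (carrier M) = M"
proof -
  have "{c \<in> mfd_charts M. fst c \<subseteq> carrier M} = mfd_charts M"
    using mfd_chart_in_carrier[OF assms] by (intro Collect_conj_eq[THEN trans]) (simp add: Int_absorb2 subset_iff del: split_paired_All)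
  then show ?thesis by (simp add: open_submfd_def subtopology_topspace)
qed

text \<open>The whole base is a trivializing set, with the trivialization \<open>e \<mapsto> (h e, z)\<close>.\<close>

lemma diffeomorphism_imp_point_bundle:
  assumes iso: "mfd_iso M N h g"
  shows "fibre_bundle M N (point_mfd z) h"
proof -
  note M = mfd_isoD(1)[OF iso] and N = mfd_isoD(2)[OF iso] and dim = mfd_isoD(3)[OF iso]
  note F = smooth_manifold_imp_atlas_manifold[OF point_mfd_smooth_manifold[of z]] point_mfd_simps[of z]
  let ?\<Phi> = "\<lambda>e. (h e, z)" and ?P = "prod_mfd N (point_mfd z)"
  have U: "{e \<in> carrier M. h e \<in> carrier N} = carrier M" using mfd_isoD(8)[OF iso] by auto
  have "diffeomorphism M ?P ?\<Phi>"
  proof (rule diffeomorphismI[OF M prod_point_atlas_manifold[OF F N]])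
    show "mfd_dim ?P = mfd_dim M" by (simp only: prod_point_simps[OF F N] dim)
    show "bij_betw ?\<Phi> (carrier M) (carrier ?P)"
      unfolding prod_point_simps[OF F N]
      by (rule bij_betw_byWitness[where f' = "\<lambda>p. g (fst p)"])
        (use mfd_isoD(6,7,8)[OF iso] mfd_isoD(8)[OF mfd_iso_sym[OF iso]] in auto)
    fix p assume p: "p \<in> carrier M"
    obtain c d where c: "c \<in> charts_at M p" and d: "d \<in> charts_at N (h p)" and m: "matched h c d"
      by (rule mfd_iso_matched_chart_at[OF iso p])
    obtain f where f: "f \<in> charts_at (point_mfd z) z"
      by (rule charts_at_exists[OF F(1), of z]) (simp_all add: F(3))
    note dN = charts_atD(1)[OF d]
    let ?pc = "prod_chart (mfd_dim N) d f"
    note pm = prod_point_chart_matched[OF F N dN f]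
    have "matched (\<lambda>q. (q, z)) d ?pc"
      by (rule matched_inverse[OF pm(1)]) (simp add: pm(2) mem_Times_iff prod_eq_iff)
    then have "matched ?\<Phi> c ?pc" by (rule matched_compose[OF m])
    then show "\<exists>c\<in>charts_at M p. \<exists>d\<in>mfd_charts ?P. matched ?\<Phi> c d"
      by (rule bexI[OF bexI[OF _ prod_point_chart[OF F N dN f]] c])
  qed
  then have triv: "diffeomorphism (open_submfd M {e \<in> carrier M. h e \<in> carrier N})
      (prod_mfd (open_submfd N (carrier N)) (point_mfd z)) ?\<Phi>"
    by (simp only: U open_submfd_carrier[OF M] open_submfd_carrier[OF N])
  show ?thesis
    unfolding fibre_bundle_def
  proof (intro conjI ballI)
    show "smooth_map M N h" by (rule mfd_isoD(4)[OF iso])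
    show "carrier (point_mfd z) \<noteq> {}" by (simp add: point_mfd_simps)
    fix b assume b: "b \<in> carrier N"
    show "\<exists>U. openin (mfd_top N) U \<and> b \<in> U \<and>
      (\<exists>\<Phi>. diffeomorphism (open_submfd M {e \<in> carrier M. h e \<in> U}) (prod_mfd (open_submfd N U) (point_mfd z)) \<Phi> \<and>
        (\<forall>e\<in>carrier M. h e \<in> U \<longrightarrow> fst (\<Phi> e) = h e))"
      by (rule exI[of _ "carrier N"]) (use b triv in \<open>intro conjI exI[of _ ?\<Phi>], simp_all\<close>)
  qed
qed

lemma mfd_iso_homeomorphic:
  assumes "mfd_iso M N h g"
  shows "mfd_top M homeomorphic_space mfd_top N"
proof -
  have "homeomorphic_maps (mfd_top M) (mfd_top N) h g"
    using mfd_isoD[OF assms] unfolding homeomorphic_maps_def smooth_map_def by simp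
  then show ?thesis unfolding homeomorphic_space_def by blast
qed

lemma mfd_iso_connected_manifold:
  assumes iso: "mfd_iso M N h g" and N: "connected_manifold N"
  shows "connected_manifold M"
  using N mfd_isoD(1)[OF iso] homeomorphic_Hausdorff_space[OF mfd_iso_homeomorphic[OF iso]]
    homeomorphic_space_second_countability[OF mfd_iso_homeomorphic[OF iso]]
    homeomorphic_connected_space[OF mfd_iso_homeomorphic[OF iso]]
  unfolding connected_manifold_def smooth_manifold_iff by simp

text \<open>Choose primitives \<open>\<Theta>\<close> and let \<open>S\<close> be the graph of their
  negatives. The projection \<open>S \<rightarrow> Q\<close> is a diffeomorphism, which makes \<open>S\<close>
  a bundle with one-point fibre and carries exactness over to \<open>S\<close>; the forms obtained are the
  canonical ones.\<close>

lemma rank_zero_bundle_of_two_forms: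
  assumes conn: "connected_manifold Q" and \<omega>Q: "\<And>\<alpha>. \<alpha> \<in> {1..k} \<Longrightarrow> \<omega>Q \<alpha> \<in> exact_two_forms Q"
  shows "\<exists>S \<omega>S. rank_zero_exact_cfp Q k S \<omega>S \<and>
    (\<forall>\<alpha>\<in>{1..k}. \<omega>S \<alpha> = pullback (foliated_mfd Q k 0 S) Q whitney_proj (\<omega>Q \<alpha>))"
proof -
  have Q: "atlas_manifold Q"
    using conn unfolding connected_manifold_def by (blast intro: smooth_manifold_imp_atlas_manifold)
  have "\<forall>\<alpha>\<in>{1..k}. \<exists>\<theta>. \<theta> \<in> one_forms Q \<and> \<omega>Q \<alpha> = ext_deriv Q \<theta>"
    using \<omega>Q unfolding exact_two_forms_def by blast
  then obtain \<Theta> where \<Theta>: "\<And>\<alpha>. \<alpha> \<in> {1..k} \<Longrightarrow> \<Theta> \<alpha> \<in> one_forms Q"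
    "\<And>\<alpha>. \<alpha> \<in> {1..k} \<Longrightarrow> \<omega>Q \<alpha> = ext_deriv Q (\<Theta> \<alpha>)"
    using bchoice[of "{1..k}" "\<lambda>\<alpha> \<theta>. \<theta> \<in> one_forms Q \<and> \<omega>Q \<alpha> = ext_deriv Q \<theta>"] by blast
  define S where "S = graph_of Q k \<Theta>"
  let ?M = "foliated_mfd Q k 0 S"
  define \<omega>S where "\<omega>S \<alpha> = pullback ?M Q whitney_proj (\<omega>Q \<alpha>)" for \<alpha>
  define z0 :: "'a wpoint" where "z0 = undefined"
  have aM: "atlas_manifold ?M" unfolding S_def by (rule graph_atlas_manifold[OF Q \<Theta>(1)])
  have dim: "mfd_dim Q = mfd_dim ?M" unfolding S_def by (simp only: graph_mfd_simps[OF Q \<Theta>(1)])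
  have iso: "mfd_iso ?M Q whitney_proj (inv_into (carrier ?M) whitney_proj)"
    by (rule diffeomorphism_imp_mfd_iso[OF aM Q dim])
      (unfold S_def, rule graph_projection_diffeomorphism[OF Q \<Theta>(1)])
  have exact: "\<omega>S \<alpha> \<in> exact_two_forms ?M" if "\<alpha> \<in> {1..k}" for \<alpha>
    unfolding \<omega>S_def by (rule pullback_exact[OF iso \<omega>Q[OF that]])
  have "canonical_foliated_presymplectic Q k (point_mfd z0) S \<omega>S"
    unfolding canonical_foliated_presymplectic_def point_mfd_simps
  proof (intro conjI ballI)
    show "smooth_manifold (point_mfd z0)" by (rule point_mfd_smooth_manifold)
    show "embedded_submanifold (whitney_sum Q k) (mfd_dim Q + 0) S"
      unfolding S_def add_0_right by (rule graph_embedded[OF Q \<Theta>(1)])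
    show "connected_manifold ?M" by (rule mfd_iso_connected_manifold[OF iso conn])
    show "fibre_bundle ?M Q (point_mfd z0) whitney_proj" by (rule diffeomorphism_imp_point_bundle[OF iso])
    fix \<alpha> assume \<alpha>: "\<alpha> \<in> {1..k}"
    show "\<omega>S \<alpha> \<in> two_forms ?M" using exact[OF \<alpha>] by (simp add: exact_two_forms_def)
    show "\<omega>S \<alpha> = pullback ?M (whitney_sum Q k) (\<lambda>z. z) (canonical_two_form Q k \<alpha>)"
      unfolding \<omega>S_def \<Theta>(2)[OF \<alpha>] S_def by (rule graph_canonical_form[OF Q \<Theta>(1) \<alpha>, symmetric])
  qed
  then have "rank_zero_exact_cfp Q k S \<omega>S"
    unfolding rank_zero_exact_cfp_def using exact point_mfd_simps[of z0] by blast
  then show ?thesis using \<omega>S_def by blast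
qed

theorem theorem3p11:
  fixes Q :: "'a mfd" and k :: nat
  assumes "connected_manifold Q" and "k \<ge> 1"
  shows
    "(\<forall>S \<omega>S. rank_zero_exact_cfp Q k S \<omega>S \<longrightarrow>
        (\<exists>!\<omega>Q. \<omega>Q \<in> {1..k} \<rightarrow>\<^sub>E exact_two_forms Q \<and>
           (\<forall>\<alpha>\<in>{1..k}. pullback (foliated_mfd Q k 0 S) Q whitney_proj (\<omega>Q \<alpha>) = \<omega>S \<alpha>))) \<and>
     (\<forall>\<omega>Q. (\<forall>\<alpha>\<in>{1..k}. \<omega>Q \<alpha> \<in> exact_two_forms Q) \<longrightarrow>
        (\<exists>S \<omega>S. rank_zero_exact_cfp Q k S \<omega>S \<and>
           (\<forall>\<alpha>\<in>{1..k}. \<omega>S \<alpha> = pullback (foliated_mfd Q k 0 S) Q whitney_proj (\<omega>Q \<alpha>))))"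
proof (intro conjI allI impI)
  have Q: "atlas_manifold Q"
    using assms(1) unfolding connected_manifold_def by (blast intro: smooth_manifold_imp_atlas_manifold)
  show "\<exists>!\<omega>Q. \<omega>Q \<in> {1..k} \<rightarrow>\<^sub>E exact_two_forms Q \<and>
      (\<forall>\<alpha>\<in>{1..k}. pullback (foliated_mfd Q k 0 S) Q whitney_proj (\<omega>Q \<alpha>) = \<omega>S \<alpha>)"
    if "rank_zero_exact_cfp Q k S \<omega>S" for S \<omega>S
    by (rule two_forms_of_rank_zero_bundle[OF Q that])
  show "\<exists>S \<omega>S. rank_zero_exact_cfp Q k S \<omega>S \<and>
      (\<forall>\<alpha>\<in>{1..k}. \<omega>S \<alpha> = pullback (foliated_mfd Q k 0 S) Q whitney_proj (\<omega>Q \<alpha>))"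
    if "\<forall>\<alpha>\<in>{1..k}. \<omega>Q \<alpha> \<in> exact_two_forms Q" for \<omega>Q
    by (rule rank_zero_bundle_of_two_forms[OF assms(1)]) (rule bspec[OF that])
qed

end
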